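(* Let $A_1, A_2$ be unital C*-algebras and let $\mathcal H_1,\mathcal H_2$ be complex Hilbert spaces. Let $\alpha_i\colon A_i\to B(\mathcal H_i)$ ($i=1,2$) be completely positive maps, and suppose that $\alpha_2$ is pure. Suppose that $\beta\colon A_1 \otimes_{\min} A_2 \to B(\mathcal H_1) \otimes_{\min} B(\mathcal H_2)$ is completely positive and that $\alpha_1 \otimes \alpha_2$ dominates $\beta$. Then $\beta = \beta_1 \otimes \alpha_2$ for some completely positive map $\beta_1\colon A_1\to B(\mathcal H_1)$ which is dominated by $\alpha_1$.
   Context: $\otimes_{\min}$ denotes the minimal C*-tensor product, and for completely positive (CP) maps $\phi_i\colon A_i\to B(\mathcal H_i)$, $\phi_1\otimes\phi_2\colon A_1\otimes_{\min}A_2\to B(\mathcal H_1)\otimes_{\min}B(\mathcal H_2)$ is the CP map determined by $a_1\otimes a_2\mapsto \phi_1(a_1)\otimes\phi_2(a_2)$. A CP map $\alpha$ dominates another CP map $\gamma$ (equivalently, $\gamma$ is dominated by $\alpha$) if $\alpha-\gamma$ is also CP. A CP map $\alpha\colon A\to B(\mathcal H)$ is pure if, whenever $\alpha$ dominates a CP map $\gamma\colon A\to B(\mathcal H)$, then $\gamma=c\,\alpha$ for some real $c\ge 0$. *)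

theory Defs
  imports "HOL-Analysis.Analysis"
begin

section \<open>Complex Hilbert spaces\<close>

class scaleC =
  fixes scaleC :: "complex \<Rightarrow> 'a \<Rightarrow> 'a" (infixr "*\<^sub>C" 75)

class complex_vector = scaleC + real_vector +
  assumes scaleC_add_right: "c *\<^sub>C (x + y) = c *\<^sub>C x + c *\<^sub>C y"
    and scaleC_add_left: "(c + d) *\<^sub>C x = c *\<^sub>C x + d *\<^sub>C x"
    and scaleC_scaleC [simp]: "c *\<^sub>C d *\<^sub>C x = (c * d) *\<^sub>C x"
    and scaleC_one [simp]: "1 *\<^sub>C x = x"
    and scaleR_scaleC: "r *\<^sub>R x = complex_of_real r *\<^sub>C x"

definition clinear :: "('a::complex_vector \<Rightarrow> 'b::complex_vector) \<Rightarrow> bool" where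
  "clinear f \<longleftrightarrow> (\<forall>x y. f (x + y) = f x + f y) \<and> (\<forall>c x. f (c *\<^sub>C x) = c *\<^sub>C f x)"

text \<open>The inner product is conjugate linear in the first argument.\<close>

class complex_hilbert = complex_vector + banach +
  fixes cinner :: "'a \<Rightarrow> 'a \<Rightarrow> complex"
  assumes cinner_commute: "cinner x y = cnj (cinner y x)"
    and cinner_add_right: "cinner x (y + z) = cinner x y + cinner x z"
    and cinner_scaleC_right: "cinner x (c *\<^sub>C y) = c * cinner x y"
    and cinner_self: "cinner x x = complex_of_real ((norm x)\<^sup>2)"

lemma scaleC_zero_left [simp]: "0 *\<^sub>C (x::'a::complex_vector) = 0"
  using scaleR_scaleC[of 0 x] by simp

lemma scaleC_minus1: "(-1) *\<^sub>C (x::'a::complex_vector) = - x"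
  using scaleR_scaleC[of "-1" x] by simp

lemma scaleC_zero_right [simp]: "c *\<^sub>C (0::'a::complex_vector) = 0"
  using scaleC_add_right[of c "0::'a" 0] by simp

lemma scaleC_minus_right: "c *\<^sub>C (- x) = - (c *\<^sub>C (x::'a::complex_vector))"
  using scaleC_add_right[of c "x" "-x"] by (simp add: eq_neg_iff_add_eq_0 add.commute)

lemma scaleC_diff_right: "c *\<^sub>C (x - y) = c *\<^sub>C x - c *\<^sub>C (y::'a::complex_vector)"
  using scaleC_add_right[of c x "- y"] by (simp add: scaleC_minus_right)

lemma scaleC_scaleR_commute: "c *\<^sub>C (r *\<^sub>R x) = r *\<^sub>R (c *\<^sub>C (x::'a::complex_vector))"
  by (simp add: scaleR_scaleC mult.commute)

lemma clinear_imp_linear: "clinear f \<Longrightarrow> linear f"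
  by (rule linearI) (auto simp: clinear_def scaleR_scaleC)

lemma cinner_add_left: "cinner (x + y) z = cinner x z + cinner y (z::'a::complex_hilbert)"
  by (metis cinner_commute cinner_add_right complex_cnj_add)

lemma cinner_scaleC_left: "cinner (c *\<^sub>C x) z = cnj c * cinner x (z::'a::complex_hilbert)"
  by (metis cinner_commute cinner_scaleC_right complex_cnj_mult)

lemma cinner_zero_right [simp]: "cinner x (0::'a::complex_hilbert) = 0"
  using cinner_add_right[of x 0 0] by simp

lemma cinner_zero_left [simp]: "cinner (0::'a::complex_hilbert) x = 0"
  using cinner_add_left[of 0 0 x] by simp

lemma cinner_minus_right: "cinner x (- y) = - cinner x (y::'a::complex_hilbert)"
  using cinner_add_right[of x y "-y"] by (simp add: eq_neg_iff_add_eq_0 add.commute)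

lemma cinner_minus_left: "cinner (- x) y = - cinner x (y::'a::complex_hilbert)"
  using cinner_add_left[of x "-x" y] by (simp add: eq_neg_iff_add_eq_0 add.commute)

lemma cinner_diff_right: "cinner x (y - z) = cinner x y - cinner x (z::'a::complex_hilbert)"
  using cinner_add_right[of x y "- z"] by (simp add: cinner_minus_right)

lemma cinner_diff_left: "cinner (x - y) z = cinner x z - cinner y (z::'a::complex_hilbert)"
  using cinner_add_left[of x "- y" z] by (simp add: cinner_minus_left)

lemma cinner_scaleR_right: "cinner x (r *\<^sub>R y) = r *\<^sub>R cinner x (y::'a::complex_hilbert)"
  by (simp add: scaleR_scaleC cinner_scaleC_right scaleR_conv_of_real)

lemma norm_eq_cinner: "(norm (x::'a::complex_hilbert))\<^sup>2 = Re (cinner x x)"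
  by (simp add: cinner_self)

lemma cmod_square: "(complex_of_real (cmod z))\<^sup>2 = z * cnj z"
  by (metis complex_norm_square of_real_power)

lemma norm_scaleC_hilbert: "norm (c *\<^sub>C (x::'a::complex_hilbert)) = cmod c * norm x"
proof -
  have "complex_of_real ((norm (c *\<^sub>C x))\<^sup>2) = complex_of_real ((cmod c * norm x)\<^sup>2)"
    unfolding cinner_self[symmetric] cinner_scaleC_left cinner_scaleC_right
    by (simp add: cinner_self power_mult_distrib cmod_square mult.commute)
  then have "(norm (c *\<^sub>C x))\<^sup>2 = (cmod c * norm x)\<^sup>2"
    using of_real_eq_iff by blast
  then show ?thesis
    by (simp add: power2_eq_iff_nonneg)
qed

lemma norm_diff_scaled:
  fixes x y :: "'a::complex_hilbert"
  shows "(norm (x - t *\<^sub>C y))\<^sup>2 = (norm x)\<^sup>2 - 2 * Re (t * cinner x y) + (cmod t)\<^sup>2 * (norm y)\<^sup>2"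
proof -
  have "cinner (x - t *\<^sub>C y) (x - t *\<^sub>C y)
     = cinner x x - (t * cinner x y + cnj (t * cinner x y)) + (t * cnj t) * cinner y y"
    by (simp add: cinner_diff_left cinner_diff_right cinner_scaleC_left cinner_scaleC_right
        algebra_simps cinner_commute[of y x])
  also have "t * cnj t = complex_of_real ((cmod t)\<^sup>2)"
    using complex_norm_square by metis
  finally show ?thesis
    unfolding norm_eq_cinner by (simp add: cinner_self)
qed

lemma cinner_Cauchy_Schwarz: "cmod (cinner x y) \<le> norm x * norm (y::'a::complex_hilbert)"
proof (cases "y = 0")
  case False
  then have ny: "(norm y)\<^sup>2 > 0" by simp
  define t where "t = cnj (cinner x y) / complex_of_real ((norm y)\<^sup>2)"
  have 1: "t * cinner x y = complex_of_real ((cmod (cinner x y))\<^sup>2 / (norm y)\<^sup>2)"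
    unfolding t_def by (simp add: cmod_square mult.commute)
  have 2: "(cmod t)\<^sup>2 * (norm y)\<^sup>2 = (cmod (cinner x y))\<^sup>2 / (norm y)\<^sup>2"
    using ny unfolding t_def by (simp add: norm_divide norm_power power_divide field_simps)
  have "0 \<le> (norm x)\<^sup>2 - 2 * ((cmod (cinner x y))\<^sup>2 / (norm y)\<^sup>2) + (cmod (cinner x y))\<^sup>2 / (norm y)\<^sup>2"
    using norm_diff_scaled[of x t y] unfolding 1 2
    by (metis Re_complex_of_real zero_le_power2)
  then have "(cmod (cinner x y))\<^sup>2 / (norm y)\<^sup>2 \<le> (norm x)\<^sup>2" by simp
  then have "(cmod (cinner x y))\<^sup>2 \<le> (norm x * norm y)\<^sup>2"
    using ny by (simp add: divide_le_eq power_mult_distrib)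
  then show ?thesis
    by (meson mult_nonneg_nonneg norm_ge_zero power2_le_imp_le)
qed simp

lemma parallelogram:
  fixes x y :: "'a::complex_hilbert"
  shows "(norm (x + y))\<^sup>2 + (norm (x - y))\<^sup>2 = 2 * (norm x)\<^sup>2 + 2 * (norm y)\<^sup>2"
  unfolding norm_eq_cinner
  by (simp add: cinner_add_left cinner_add_right cinner_diff_left cinner_diff_right algebra_simps)

lemma cinner_ext:
  fixes x y :: "'a::complex_hilbert"
  assumes "\<And>z. cinner x z = cinner y z"
  shows "x = y"
proof -
  have "cinner (x - y) (x - y) = 0"
    using assms[of "x - y"] by (simp add: cinner_diff_left)
  then show ?thesis by (simp add: cinner_self)
qed

lemma bounded_linear_cinner_right: "bounded_linear (cinner (x::'a::complex_hilbert))"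
  by (rule bounded_linear_intro[where K="norm x"])
     (auto simp: cinner_add_right cinner_scaleR_right mult.commute[of "norm _" "norm x"] intro: cinner_Cauchy_Schwarz)

lemma Riesz_representation:
  fixes f :: "'a::complex_hilbert \<Rightarrow> complex"
  assumes bl: "bounded_linear f" and C: "\<And>c x. f (c *\<^sub>C x) = c * f x"
  shows "\<exists>u. \<forall>x. f x = cinner u x"
proof (cases "\<forall>x. f x = 0")
  case True
  then show ?thesis by (intro exI[of _ 0]) simp
next
  case False
  interpret f: bounded_linear f by fact
  obtain z where z: "f z \<noteq> 0" using False by blast
  define S where "S = {x. f x = 1}"
  have "inverse (f z) *\<^sub>C z \<in> S" using z by (simp add: S_def C)
  then have Sne: "S \<noteq> {}" by blast
  define d where "d = Inf (norm ` S)"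
  have bdd: "bdd_below (norm ` S)" by (auto intro: bdd_belowI[of _ 0])
  have dle: "d \<le> norm x" if "x \<in> S" for x
    unfolding d_def using that bdd by (intro cInf_lower) auto
  have d0: "0 \<le> d"
    unfolding d_def using Sne by (intro cInf_greatest) auto
  have "\<exists>x\<in>S. norm x < d + inverse (Suc n)" for n :: nat
  proof -
    have "Inf (norm ` S) < d + inverse (Suc n)" by (simp add: d_def)
    then show ?thesis using cInf_less_iff[OF _ bdd] Sne by auto
  qed
  then obtain X where XS: "\<And>n. X n \<in> S" and Xn: "\<And>n::nat. norm (X n) < d + inverse (Suc n)"
    by metis
  have est: "(norm (x - y))\<^sup>2 \<le> 2 * (norm x)\<^sup>2 + 2 * (norm y)\<^sup>2 - 4 * d\<^sup>2"
    if "x \<in> S" "y \<in> S" for x y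
  proof -
    have "(1/2) *\<^sub>R (x + y) \<in> S"
      using that by (simp add: S_def f.add f.scaleR scaleR_conv_of_real)
    then have "d \<le> norm ((1/2) *\<^sub>R (x + y))" by (rule dle)
    then have "2 * d \<le> norm (x + y)" by simp
    then have "(2 * d)\<^sup>2 \<le> (norm (x + y))\<^sup>2" using d0 by (intro power_mono) auto
    then show ?thesis using parallelogram[of x y] by (simp add: power_mult_distrib)
  qed
  have lim: "(\<lambda>n. norm (X n)) \<longlonglongrightarrow> d"
  proof (rule tendsto_sandwich[of "\<lambda>_. d" _ _ "\<lambda>n. d + inverse (real (Suc n))"])
    show "(\<lambda>n. d + inverse (real (Suc n))) \<longlonglongrightarrow> d"
      using tendsto_add[OF tendsto_const[of d] LIMSEQ_inverse_real_of_nat] by simp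
  qed (use dle XS Xn in \<open>auto intro!: always_eventually simp: less_imp_le\<close>)
  have "Cauchy X"
  proof (rule metric_CauchyI)
    fix e :: real assume e: "e > 0"
    have "(\<lambda>n. (norm (X n))\<^sup>2) \<longlonglongrightarrow> d\<^sup>2" by (intro tendsto_power lim)
    then have "eventually (\<lambda>n. (norm (X n))\<^sup>2 < d\<^sup>2 + e\<^sup>2 / 4) sequentially"
      using e by (intro order_tendstoD) auto
    then obtain N where N: "\<And>n. n \<ge> N \<Longrightarrow> (norm (X n))\<^sup>2 < d\<^sup>2 + e\<^sup>2 / 4"
      by (auto simp: eventually_sequentially)
    have "dist (X m) (X n) < e" if "m \<ge> N" "n \<ge> N" for m n
    proof -
      have "(norm (X m - X n))\<^sup>2 < e\<^sup>2"
        using est[OF XS XS, of m n] N[OF that(1)] N[OF that(2)] by simp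
      then show ?thesis using e by (simp add: dist_norm power_less_imp_less_base)
    qed
    then show "\<exists>M. \<forall>m\<ge>M. \<forall>n\<ge>M. dist (X m) (X n) < e" by blast
  qed
  then obtain u where u: "X \<longlonglongrightarrow> u" using Cauchy_convergent convergent_def by blast
  have "(\<lambda>n. f (X n)) \<longlonglongrightarrow> f u" by (rule f.tendsto[OF u])
  moreover have "(\<lambda>n. f (X n)) = (\<lambda>n. 1)" using XS by (auto simp: S_def)
  ultimately have fu: "f u = 1" using LIMSEQ_unique tendsto_const by metis
  then have uS: "u \<in> S" by (simp add: S_def)
  have nu: "norm u = d"
    using tendsto_norm[OF u] lim LIMSEQ_unique by blast
  have u0: "u \<noteq> 0" using fu f.zero by auto
  have orth: "cinner u v = 0" if v: "f v = 0" for v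
  proof (cases "v = 0")
    case False
    then have nv: "(norm v)\<^sup>2 > 0" by simp
    define t where "t = cnj (cinner u v) / complex_of_real ((norm v)\<^sup>2)"
    have 1: "t * cinner u v = complex_of_real ((cmod (cinner u v))\<^sup>2 / (norm v)\<^sup>2)"
      unfolding t_def by (simp add: cmod_square mult.commute)
    have 2: "(cmod t)\<^sup>2 * (norm v)\<^sup>2 = (cmod (cinner u v))\<^sup>2 / (norm v)\<^sup>2"
      using nv unfolding t_def by (simp add: norm_divide norm_power power_divide field_simps)
    have "u - t *\<^sub>C v \<in> S" using fu v by (simp add: S_def f.diff C)
    then have "d\<^sup>2 \<le> (norm (u - t *\<^sub>C v))\<^sup>2" using dle d0 by (intro power_mono) auto
    also have "\<dots> = d\<^sup>2 - (cmod (cinner u v))\<^sup>2 / (norm v)\<^sup>2"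
      unfolding norm_diff_scaled 1 2 nu by simp
    finally have "(cmod (cinner u v))\<^sup>2 / (norm v)\<^sup>2 \<le> 0" by simp
    then show ?thesis using nv by (simp add: divide_le_0_iff)
  qed simp
  show ?thesis
  proof (intro exI allI)
    fix x
    have "f (x - f x *\<^sub>C u) = 0" by (simp add: f.diff C fu)
    then have "cinner u (x - f x *\<^sub>C u) = 0" by (rule orth)
    then have "cinner u x = f x * complex_of_real ((norm u)\<^sup>2)"
      by (simp add: cinner_diff_right cinner_scaleC_right cinner_self)
    then show "f x = cinner ((1 / (norm u)\<^sup>2) *\<^sub>R u) x"
      using u0 by (simp add: scaleR_scaleC cinner_scaleC_left)
  qed
qed

section \<open>Unital C*-algebras\<close>

text \<open>The sort does not force \<open>1 \<noteq> 0\<close>, so that the operators on the zero space are included.\<close>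

class cstar_algebra = complex_vector + banach + real_normed_algebra + monoid_mult +
  fixes star :: "'a \<Rightarrow> 'a"
  assumes mult_scaleC_left: "(c *\<^sub>C x) * y = c *\<^sub>C (x * y)"
    and mult_scaleC_right: "x * (c *\<^sub>C y) = c *\<^sub>C (x * y)"
    and norm_scaleC: "norm (c *\<^sub>C x) = cmod c * norm x"
    and star_star [simp]: "star (star x) = x"
    and star_add: "star (x + y) = star x + star y"
    and star_scaleC: "star (c *\<^sub>C x) = cnj c *\<^sub>C star x"
    and star_mult: "star (x * y) = star y * star x"
    and cstar_identity: "norm (star x * x) = (norm x)\<^sup>2"


lemma star_zero [simp]: "star (0::'a::cstar_algebra) = 0"
  using star_add[of "0::'a" 0] by simp

lemma star_minus: "star (- x) = - star (x::'a::cstar_algebra)"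
  using star_add[of x "- x"] by (simp add: eq_neg_iff_add_eq_0 add.commute)

lemma star_diff: "star (x - y) = star x - star (y::'a::cstar_algebra)"
  using star_add[of x "- y"] by (simp add: star_minus)

lemma star_scaleR: "star (r *\<^sub>R x) = r *\<^sub>R star (x::'a::cstar_algebra)"
  by (simp add: scaleR_scaleC star_scaleC)

lemma star_one [simp]: "star (1::'a::cstar_algebra) = 1"
  using star_mult[of "star 1" "1::'a"] by simp

lemma norm_star [simp]: "norm (star x) = norm (x::'a::cstar_algebra)"
proof -
  have le: "norm y \<le> norm (star y)" for y :: 'a
  proof (cases "y = 0")
    case False
    have "norm y * norm y \<le> norm (star y) * norm y"
      using norm_mult_ineq[of "star y" y] by (simp add: cstar_identity power2_eq_square)
    then show ?thesis using False by simp
  qed simp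
  show ?thesis using le[of x] le[of "star x"] by simp
qed

lemma bounded_linear_star: "bounded_linear (star :: 'a::cstar_algebra \<Rightarrow> 'a)"
  by (rule bounded_linear_intro[where K=1]) (auto simp: star_add star_scaleR)

lemma star_power: "star (x ^ n) = star x ^ n" for x :: "'a::cstar_algebra"
  by (induction n) (simp_all add: star_mult power_commutes)

definition star_hom :: "('a::cstar_algebra \<Rightarrow> 'b::cstar_algebra) \<Rightarrow> bool" where
  "star_hom f \<longleftrightarrow> clinear f \<and> (\<forall>x y. f (x * y) = f x * f y) \<and> (\<forall>x. f (star x) = star (f x))"

lemma abs_gbinomial_half_le: "\<bar>(1/2::real) gchoose n\<bar> \<le> 1"
proof (induction n)
  case (Suc n)
  have "real (Suc n) * ((1/2) gchoose Suc n) = (1/2 - real n) * ((1/2) gchoose n)"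
    by (simp add: gbinomial_mult_1 algebra_simps)
  then have "((1/2) gchoose Suc n) = (1/2 - real n) / real (Suc n) * ((1/2::real) gchoose n)"
    by (simp add: field_simps)
  moreover have "\<bar>(1/2 - real n) / real (Suc n)\<bar> \<le> 1"
    by (simp add: abs_le_iff field_simps)
  ultimately show ?case
    using Suc mult_le_one[of "\<bar>(1/2 - real n) / real (Suc n)\<bar>" "\<bar>(1/2::real) gchoose n\<bar>"]
    by (simp add: abs_mult)
qed simp

lemma cstar_sqrt_one_minus:
  fixes b :: "'a::cstar_algebra"
  assumes sa: "star b = b" and nb: "norm b < 1"
  shows "\<exists>c. star c = c \<and> c * c = 1 - b"
proof -
  define a where "a n = ((1/2::real) gchoose n) * (-1) ^ n" for n
  define t where "t n = a n *\<^sub>R b ^ n" for n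
  have npow: "norm (b ^ Suc n) \<le> norm b ^ Suc n" for n
  proof (induction n)
    case (Suc n)
    have "norm (b ^ Suc (Suc n)) \<le> norm b * norm (b ^ Suc n)"
      using norm_mult_ineq[of b "b ^ Suc n"] by simp
    also have "\<dots> \<le> norm b * norm b ^ Suc n" using Suc by (intro mult_left_mono) auto
    finally show ?case by simp
  qed simp
  have aabs: "\<bar>a n\<bar> \<le> 1" for n
    unfolding a_def using abs_gbinomial_half_le[of n] by (simp add: abs_mult power_abs)
  have sum_t: "summable (\<lambda>n. norm (t n))"
  proof (rule summable_comparison_test_ev)
    show "\<forall>\<^sub>F n in sequentially. norm (norm (t n)) \<le> norm b ^ n"
    proof (rule eventually_sequentiallyI[of 1])
      fix n :: nat assume "1 \<le> n"
      then obtain m where m: "n = Suc m" using Suc_le_D by auto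
      have "\<bar>a n\<bar> * norm (b ^ n) \<le> 1 * norm b ^ n"
        using aabs npow[of m] unfolding m by (intro mult_mono) auto
      then show "norm (norm (t n)) \<le> norm b ^ n" by (simp add: t_def)
    qed
    show "summable (\<lambda>n. norm b ^ n)" using nb by (simp add: summable_geometric)
  qed
  define c where "c = (\<Sum>n. t n)"
  have "star c = (\<Sum>n. star (t n))"
    unfolding c_def using bounded_linear.suminf[OF bounded_linear_star summable_norm_cancel[OF sum_t]] .
  also have "(\<lambda>n. star (t n)) = t"
    by (auto simp: t_def star_scaleR star_power sa)
  finally have 1: "star c = c" by (simp add: c_def)
  have conv: "(\<Sum>i\<le>k. t i * t (k - i)) = (if k = 0 then 1 else if k = 1 then - b else 0)" for k
  proof -
    have "(\<Sum>i\<le>k. t i * t (k - i)) = (\<Sum>i\<le>k. (a i * a (k - i)) *\<^sub>R b ^ k)"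
      by (rule sum.cong) (auto simp: t_def power_add[symmetric])
    also have "\<dots> = (\<Sum>i\<le>k. a i * a (k - i)) *\<^sub>R b ^ k"
      by (simp add: scaleR_sum_left)
    also have "(\<Sum>i\<le>k. a i * a (k - i))
        = (\<Sum>i\<in>{0..k}. ((1/2::real) gchoose i) * ((1/2) gchoose (k - i))) * (-1) ^ k"
      unfolding sum_distrib_right
      by (rule sum.cong) (auto simp: a_def atLeast0AtMost power_add[symmetric] algebra_simps)
    also have "\<dots> = ((1::real) gchoose k) * (-1) ^ k"
      by (simp add: gbinomial_Vandermonde)
    also have "(1::real) gchoose k = of_nat (1 choose k)"
      using binomial_gbinomial[of 1 k, where 'a=real] by simp
    also have "of_nat (1 choose k) * (-1) ^ k = (if k = 0 then 1 else if k = 1 then - 1 else (0::real))"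
      by (cases k) (auto simp: binomial_eq_0)
    finally show ?thesis by auto
  qed
  have "(\<lambda>k. \<Sum>i\<le>k. t i * t (k - i)) sums (c * c)"
    unfolding c_def by (rule Cauchy_product_sums[OF sum_t sum_t])
  then have "(\<lambda>k. if k = 0 then 1 else if k = 1 then - b else 0) sums (c * c)"
    by (simp add: conv)
  moreover have "(\<lambda>k. if k = 0 then 1 else if k = 1 then - b else 0) sums
      (\<Sum>k\<in>{0,1::nat}. if k = 0 then 1 else if k = 1 then - b else 0)"
    by (rule sums_finite) auto
  ultimately have "c * c = 1 - b"
    using sums_unique2 by fastforce
  with 1 show ?thesis by blast
qed

section \<open>Bounded operators on a Hilbert space\<close>

typedef (overloaded) 'h bop =
  "{T :: 'h::complex_hilbert \<Rightarrow>\<^sub>L 'h. \<forall>c x. blinfun_apply T (c *\<^sub>C x) = c *\<^sub>C blinfun_apply T x}"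
  morphisms blinfun_of_bop Abs_bop
  by (rule exI[of _ 0]) simp

setup_lifting type_definition_bop

lift_definition bop_apply :: "'h::complex_hilbert bop \<Rightarrow> 'h \<Rightarrow> 'h" (infixr "\<bullet>\<^sub>o" 85) is blinfun_apply .

lemma blinfun_of_bop_apply: "blinfun_apply (blinfun_of_bop T) x = T \<bullet>\<^sub>o x"
  by (simp add: bop_apply.rep_eq)

lemma bop_eqI: "(\<And>x. S \<bullet>\<^sub>o x = T \<bullet>\<^sub>o x) \<Longrightarrow> S = T"
  by (metis blinfun_eqI blinfun_of_bop_apply blinfun_of_bop_inject)

lemma bounded_linear_bop_apply: "bounded_linear ((\<bullet>\<^sub>o) T)"
  by transfer (simp add: blinfun.bounded_linear_right)

lemma bop_apply_scaleC: "T \<bullet>\<^sub>o (c *\<^sub>C x) = c *\<^sub>C (T \<bullet>\<^sub>o x)"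
  by transfer simp

lemma bop_apply_add: "T \<bullet>\<^sub>o (x + y) = T \<bullet>\<^sub>o x + T \<bullet>\<^sub>o y"
  by transfer (simp add: blinfun.add_right)

lemma bop_apply_diff: "T \<bullet>\<^sub>o (x - y) = T \<bullet>\<^sub>o x - T \<bullet>\<^sub>o y"
  by transfer (simp add: blinfun.diff_right)

lemma bop_apply_zero_right [simp]: "T \<bullet>\<^sub>o 0 = 0"
  by transfer simp

lemma bop_exists:
  fixes f :: "'h::complex_hilbert \<Rightarrow> 'h"
  assumes "bounded_linear f" "\<And>c x. f (c *\<^sub>C x) = c *\<^sub>C f x"
  shows "\<exists>T. \<forall>x. T \<bullet>\<^sub>o x = f x"
  using assms
  by (intro exI[of _ "Abs_bop (Blinfun f)"])
     (simp add: bop_apply.rep_eq Abs_bop_inverse bounded_linear_Blinfun_apply)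

lemma bop_adjoint_exists: "\<exists>S. \<forall>x y. cinner x (T \<bullet>\<^sub>o y) = cinner (S \<bullet>\<^sub>o x) y"
  for T :: "'h::complex_hilbert bop"
proof -
  have "\<exists>u. \<forall>y. cinner x (T \<bullet>\<^sub>o y) = cinner u y" for x
    by (rule Riesz_representation)
       (auto intro: bounded_linear_compose[OF bounded_linear_cinner_right bounded_linear_bop_apply]
         simp: bop_apply_scaleC cinner_scaleC_right)
  then obtain f where f: "\<And>x y. cinner x (T \<bullet>\<^sub>o y) = cinner (f x) y" by metis
  have add: "f (x + y) = f x + f y" for x y
    by (rule cinner_ext) (simp add: cinner_add_left f[symmetric])
  have sc: "f (c *\<^sub>C x) = c *\<^sub>C f x" for c x
    by (rule cinner_ext) (simp add: cinner_scaleC_left f[symmetric])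
  obtain K where K: "\<And>x. norm (T \<bullet>\<^sub>o x) \<le> norm x * K" "K \<ge> 0"
    using bounded_linear.nonneg_bounded[OF bounded_linear_bop_apply] by metis
  have bd: "norm (f x) \<le> norm x * K" for x
  proof (cases "f x = 0")
    case False
    have "(norm (f x))\<^sup>2 = cmod (cinner (f x) (f x))" by (simp add: cinner_self norm_power)
    also have "\<dots> = cmod (cinner x (T \<bullet>\<^sub>o f x))" by (simp add: f)
    also have "\<dots> \<le> norm x * norm (T \<bullet>\<^sub>o f x)" by (rule cinner_Cauchy_Schwarz)
    also have "\<dots> \<le> norm x * (norm (f x) * K)" by (intro mult_left_mono K) auto
    finally have "norm (f x) * norm (f x) \<le> norm (f x) * (norm x * K)"
      by (simp add: power2_eq_square mult_ac)
    then show ?thesis using False by simp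
  qed (use K in simp)
  have "bounded_linear f"
    by (rule bounded_linear_intro[where K=K]) (auto simp: add sc bd scaleR_scaleC)
  then obtain S where "\<And>x. S \<bullet>\<^sub>o x = f x" using bop_exists[of f] sc by blast
  then show ?thesis using f by metis
qed

instantiation bop :: (complex_hilbert) complex_vector
begin

lift_definition zero_bop :: "'a bop" is 0 by simp
lift_definition plus_bop :: "'a bop \<Rightarrow> 'a bop \<Rightarrow> 'a bop" is "(+)"
  by (simp add: blinfun.add_left scaleC_add_right)
lift_definition minus_bop :: "'a bop \<Rightarrow> 'a bop \<Rightarrow> 'a bop" is "(-)"
  by (simp add: blinfun.diff_left scaleC_diff_right)
lift_definition uminus_bop :: "'a bop \<Rightarrow> 'a bop" is uminus
  by (simp add: blinfun.minus_left scaleC_minus_right)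
lift_definition scaleR_bop :: "real \<Rightarrow> 'a bop \<Rightarrow> 'a bop" is "(*\<^sub>R)"
  by (simp add: blinfun.scaleR_left scaleC_scaleR_commute)

definition scaleC_bop :: "complex \<Rightarrow> 'a bop \<Rightarrow> 'a bop" where
  "scaleC_bop c T = (THE S. \<forall>x. S \<bullet>\<^sub>o x = c *\<^sub>C (T \<bullet>\<^sub>o x))"

lemma bop_apply_scaleC_left: "(c *\<^sub>C T) \<bullet>\<^sub>o x = c *\<^sub>C (T \<bullet>\<^sub>o x)" for T :: "'a bop"
proof -
  have "bounded_linear (\<lambda>x. c *\<^sub>C (T \<bullet>\<^sub>o x))"
  proof (rule bounded_linear_intro)
    fix x
    show "norm (c *\<^sub>C (T \<bullet>\<^sub>o x)) \<le> norm x * (norm (blinfun_of_bop T) * cmod c)"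
      using mult_left_mono[OF norm_blinfun[of "blinfun_of_bop T" x], of "cmod c"]
      by (simp add: norm_scaleC_hilbert blinfun_of_bop_apply mult_ac)
  qed (simp_all add: bop_apply_add scaleC_add_right bop_apply_scaleC scaleR_scaleC mult.commute)
  then obtain S where S: "\<forall>x. S \<bullet>\<^sub>o x = c *\<^sub>C (T \<bullet>\<^sub>o x)"
    using bop_exists[of "\<lambda>x. c *\<^sub>C (T \<bullet>\<^sub>o x)"] by (auto simp: bop_apply_scaleC mult.commute)
  have "\<forall>x. (THE S. \<forall>x. S \<bullet>\<^sub>o x = c *\<^sub>C (T \<bullet>\<^sub>o x)) \<bullet>\<^sub>o x = c *\<^sub>C (T \<bullet>\<^sub>o x)"
    by (rule theI[of _ S]) (use S in \<open>auto intro: bop_eqI\<close>)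
  then show ?thesis by (simp add: scaleC_bop_def)
qed

lemma bop_apply_zero [simp]: "(0::'a bop) \<bullet>\<^sub>o x = 0" by transfer simp
lemma bop_apply_plus: "(S + T) \<bullet>\<^sub>o x = S \<bullet>\<^sub>o x + T \<bullet>\<^sub>o x" for S T :: "'a bop"
  by transfer (simp add: blinfun.add_left)
lemma bop_apply_minus: "(S - T) \<bullet>\<^sub>o x = S \<bullet>\<^sub>o x - T \<bullet>\<^sub>o x" for S T :: "'a bop"
  by transfer (simp add: blinfun.diff_left)
lemma bop_apply_uminus: "(- T) \<bullet>\<^sub>o x = - (T \<bullet>\<^sub>o x)" for T :: "'a bop"
  by transfer (simp add: blinfun.minus_left)
lemma bop_apply_scaleR_left: "(r *\<^sub>R T) \<bullet>\<^sub>o x = r *\<^sub>R (T \<bullet>\<^sub>o x)" for T :: "'a bop"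
  by transfer (simp add: blinfun.scaleR_left)

instance
  by standard
    (auto intro!: bop_eqI simp: bop_apply_plus bop_apply_minus bop_apply_uminus bop_apply_scaleR_left
      bop_apply_scaleC_left scaleC_add_right scaleC_add_left scaleR_scaleC algebra_simps)

end

instantiation bop :: (complex_hilbert) real_normed_vector
begin

lift_definition norm_bop :: "'a bop \<Rightarrow> real" is norm .
definition dist_bop :: "'a bop \<Rightarrow> 'a bop \<Rightarrow> real" where "dist_bop S T = norm (S - T)"
definition sgn_bop :: "'a bop \<Rightarrow> 'a bop" where "sgn_bop T = T /\<^sub>R norm T"
definition uniformity_bop :: "('a bop \<times> 'a bop) filter" where
  "uniformity_bop = (INF e\<in>{0<..}. principal {(x, y). dist x y < e})"
definition open_bop :: "'a bop set \<Rightarrow> bool" where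
  "open_bop U = (\<forall>x\<in>U. \<forall>\<^sub>F (x', y) in uniformity. x' = x \<longrightarrow> y \<in> U)"

instance
proof
  fix S T :: "'a bop" and r :: real
  show "(norm T = 0) = (T = 0)" by transfer simp
  show "norm (S + T) \<le> norm S + norm T" by transfer (rule norm_triangle_ineq)
  show "norm (r *\<^sub>R T) = \<bar>r\<bar> * norm T" by transfer simp
qed (simp_all add: dist_bop_def sgn_bop_def uniformity_bop_def open_bop_def)

end

lemma norm_bop_apply: "norm (T \<bullet>\<^sub>o x) \<le> norm T * norm x"
  by transfer (rule norm_blinfun)

lemma norm_bop_bound: "0 \<le> b \<Longrightarrow> (\<And>x. norm (T \<bullet>\<^sub>o x) \<le> b * norm x) \<Longrightarrow> norm T \<le> b"
  by transfer (rule norm_blinfun_bound)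

instance bop :: (complex_hilbert) banach
proof
  fix X :: "nat \<Rightarrow> 'a bop"
  assume C: "Cauchy X"
  define Y where "Y n = blinfun_of_bop (X n)" for n
  have dY: "dist (Y m) (Y n) = dist (X m) (X n)" for m n
    unfolding Y_def by (simp add: dist_bop_def norm_bop.rep_eq minus_bop.rep_eq dist_norm)
  have "Cauchy Y" using C by (simp add: Cauchy_def dY)
  then obtain L where L: "Y \<longlonglongrightarrow> L" using Cauchy_convergent convergent_def by blast
  have Lx: "(\<lambda>n. blinfun_apply (Y n) x) \<longlonglongrightarrow> blinfun_apply L x" for x
    by (intro tendsto_intros L)
  have "blinfun_apply L (c *\<^sub>C x) = c *\<^sub>C blinfun_apply L x" for c x
  proof -
    have "(\<lambda>n. c *\<^sub>C blinfun_apply (Y n) x) \<longlonglongrightarrow> c *\<^sub>C blinfun_apply L x"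
    proof -
      have "bounded_linear (\<lambda>y::'a. c *\<^sub>C y)"
        by (rule bounded_linear_intro[where K="cmod c"])
           (simp_all add: scaleC_add_right scaleC_scaleR_commute norm_scaleC_hilbert)
      from bounded_linear.tendsto[OF this Lx] show ?thesis .
    qed
    moreover have "(\<lambda>n. blinfun_apply (Y n) (c *\<^sub>C x)) = (\<lambda>n. c *\<^sub>C blinfun_apply (Y n) x)"
      by (auto simp: Y_def blinfun_of_bop_apply bop_apply_scaleC)
    ultimately show ?thesis using Lx[of "c *\<^sub>C x"] LIMSEQ_unique by metis
  qed
  then have LL: "blinfun_of_bop (Abs_bop L) = L" by (simp add: Abs_bop_inverse)
  have "dist (X n) (Abs_bop L) = dist (Y n) L" for n
    unfolding Y_def dist_bop_def norm_bop.rep_eq minus_bop.rep_eq LL by (simp add: dist_norm)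
  then have "X \<longlonglongrightarrow> Abs_bop L"
    using L by (simp add: tendsto_iff)
  then show "convergent X" by (auto simp: convergent_def)
qed

text \<open>The product is composition and the involution is the Hilbert space adjoint.\<close>

instantiation bop :: (complex_hilbert) cstar_algebra
begin

lift_definition one_bop :: "'a bop" is id_blinfun by simp
lift_definition times_bop :: "'a bop \<Rightarrow> 'a bop \<Rightarrow> 'a bop" is "(o\<^sub>L)" by simp

definition star_bop :: "'a bop \<Rightarrow> 'a bop" where
  "star_bop T = (THE S. \<forall>x y. cinner x (T \<bullet>\<^sub>o y) = cinner (S \<bullet>\<^sub>o x) y)"

lemma bop_apply_one [simp]: "(1::'a bop) \<bullet>\<^sub>o x = x" by transfer simp
lemma bop_apply_times: "(S * T) \<bullet>\<^sub>o x = S \<bullet>\<^sub>o T \<bullet>\<^sub>o x" for S T :: "'a bop" by transfer simp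

lemma cinner_star_left: "cinner (star T \<bullet>\<^sub>o x) y = cinner x (T \<bullet>\<^sub>o y)" for T :: "'a bop"
proof -
  obtain S where S: "\<forall>x y. cinner x (T \<bullet>\<^sub>o y) = cinner (S \<bullet>\<^sub>o x) y" using bop_adjoint_exists by blast
  have "\<forall>x y. cinner x (T \<bullet>\<^sub>o y) = cinner ((THE S. \<forall>x y. cinner x (T \<bullet>\<^sub>o y) = cinner (S \<bullet>\<^sub>o x) y) \<bullet>\<^sub>o x) y"
  proof (rule theI[of _ S])
    show "S' = S" if "\<forall>x y. cinner x (T \<bullet>\<^sub>o y) = cinner (S' \<bullet>\<^sub>o x) y" for S'
    proof (rule bop_eqI, rule cinner_ext)
      fix x z
      show "cinner (S' \<bullet>\<^sub>o x) z = cinner (S \<bullet>\<^sub>o x) z"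
        using that[rule_format, of x z] S[rule_format, of x z] by simp
    qed
  qed (rule S)
  then have "\<forall>x y. cinner x (T \<bullet>\<^sub>o y) = cinner (star T \<bullet>\<^sub>o x) y"
    unfolding star_bop_def .
  then show ?thesis by metis
qed

lemma cinner_star_right: "cinner x (star T \<bullet>\<^sub>o y) = cinner (T \<bullet>\<^sub>o x) y" for T :: "'a bop"
proof -
  have "cinner x (star T \<bullet>\<^sub>o y) = cnj (cinner (star T \<bullet>\<^sub>o y) x)" by (rule cinner_commute)
  also have "\<dots> = cnj (cinner y (T \<bullet>\<^sub>o x))" by (simp only: cinner_star_left)
  also have "\<dots> = cinner (T \<bullet>\<^sub>o x) y" by (rule cinner_commute[symmetric])
  finally show ?thesis .
qed

lemma star_bop_eqI: "(\<And>x y. cinner (S \<bullet>\<^sub>o x) y = cinner x (T \<bullet>\<^sub>o y)) \<Longrightarrow> star T = S" for T :: "'a bop"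
  by (intro bop_eqI cinner_ext) (simp add: cinner_star_left)

lemma norm_times_bop: "norm (S * T) \<le> norm S * norm T" for S T :: "'a bop"
  by transfer (rule norm_blinfun_compose)

lemma norm_star_bop_le: "norm (star T) \<le> norm T" for T :: "'a bop"
proof (rule norm_bop_bound)
  fix x
  show "norm (star T \<bullet>\<^sub>o x) \<le> norm T * norm x"
  proof (cases "star T \<bullet>\<^sub>o x = 0")
    case False
    let ?y = "star T \<bullet>\<^sub>o x"
    have "(norm ?y)\<^sup>2 = cmod (cinner ?y ?y)" by (simp add: cinner_self norm_power)
    also have "\<dots> = cmod (cinner x (T \<bullet>\<^sub>o ?y))" by (simp add: cinner_star_left)
    also have "\<dots> \<le> norm x * norm (T \<bullet>\<^sub>o ?y)" by (rule cinner_Cauchy_Schwarz)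
    also have "\<dots> \<le> norm x * (norm T * norm ?y)" by (intro mult_left_mono norm_bop_apply) auto
    finally have "norm ?y * norm ?y \<le> norm ?y * (norm T * norm x)"
      by (simp add: power2_eq_square mult_ac)
    then show ?thesis using False by simp
  qed simp
qed simp

instance
proof
  fix R S T :: "'a bop" and c :: complex and r :: real
  show "(R * S) * T = R * (S * T)" by (rule bop_eqI) (simp add: bop_apply_times)
  show "1 * T = T" by (rule bop_eqI) (simp add: bop_apply_times)
  show "T * 1 = T" by (rule bop_eqI) (simp add: bop_apply_times)
  show "(R + S) * T = R * T + S * T" by (rule bop_eqI) (simp add: bop_apply_times bop_apply_plus)
  show "R * (S + T) = R * S + R * T"
    by (rule bop_eqI) (simp add: bop_apply_times bop_apply_plus bop_apply_add)
  show "(r *\<^sub>R S) * T = r *\<^sub>R (S * T)"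
    by (rule bop_eqI) (simp add: bop_apply_times bop_apply_scaleR_left)
  show "S * (r *\<^sub>R T) = r *\<^sub>R (S * T)"
    by (rule bop_eqI) (simp add: bop_apply_times bop_apply_scaleR_left scaleR_scaleC bop_apply_scaleC_left bop_apply_scaleC)
  show "(c *\<^sub>C S) * T = c *\<^sub>C (S * T)"
    by (rule bop_eqI) (simp add: bop_apply_times bop_apply_scaleC_left)
  show "S * (c *\<^sub>C T) = c *\<^sub>C (S * T)"
    by (rule bop_eqI) (simp add: bop_apply_times bop_apply_scaleC_left bop_apply_scaleC)
  show "norm (S * T) \<le> norm S * norm T" by (rule norm_times_bop)
  show "star (star T) = T" by (rule star_bop_eqI) (simp add: cinner_star_right)
  show "star (S + T) = star S + star T"
    by (rule star_bop_eqI) (simp add: bop_apply_plus cinner_add_left cinner_add_right cinner_star_left)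
  show "star (c *\<^sub>C T) = cnj c *\<^sub>C star T"
    by (rule star_bop_eqI)
       (simp add: bop_apply_scaleC_left cinner_scaleC_left cinner_scaleC_right cinner_star_left)
  show "star (S * T) = star T * star S"
    by (rule star_bop_eqI) (simp add: bop_apply_times cinner_star_left)
  show "norm (c *\<^sub>C T) = cmod c * norm T"
  proof (cases "c = 0")
    case False
    have le: "norm (d *\<^sub>C U) \<le> cmod d * norm U" for d and U :: "'a bop"
      by (rule norm_bop_bound)
         (auto simp: bop_apply_scaleC_left norm_scaleC_hilbert mult.assoc intro!: mult_left_mono norm_bop_apply)
    have "norm T \<le> cmod (inverse c) * norm (c *\<^sub>C T)"
      using le[of "inverse c" "c *\<^sub>C T"] False by simp
    then have "cmod c * norm T \<le> norm (c *\<^sub>C T)"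
      using False by (simp add: norm_inverse norm_divide field_simps)
    then show ?thesis using le[of c T] by simp
  qed simp
  show "norm (star T * T) = (norm T)\<^sup>2"
  proof (rule antisym)
    show "norm (star T * T) \<le> (norm T)\<^sup>2"
      using norm_times_bop[of "star T" T] norm_star_bop_le[of T]
      by (metis mult_right_mono norm_ge_zero order_trans power2_eq_square)
    have "norm T \<le> sqrt (norm (star T * T))"
    proof (rule norm_bop_bound)
      fix x
      have "(norm (T \<bullet>\<^sub>o x))\<^sup>2 = cmod (cinner (T \<bullet>\<^sub>o x) (T \<bullet>\<^sub>o x))" by (simp add: cinner_self norm_power)
      also have "\<dots> = cmod (cinner x ((star T * T) \<bullet>\<^sub>o x))"
        by (simp add: bop_apply_times cinner_star_right)
      also have "\<dots> \<le> norm x * norm ((star T * T) \<bullet>\<^sub>o x)" by (rule cinner_Cauchy_Schwarz)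
      also have "\<dots> \<le> norm x * (norm (star T * T) * norm x)"
        by (intro mult_left_mono norm_bop_apply) auto
      also have "\<dots> = (sqrt (norm (star T * T)) * norm x)\<^sup>2"
        by (simp add: power_mult_distrib power2_eq_square[of "norm x"])
      finally show "norm (T \<bullet>\<^sub>o x) \<le> sqrt (norm (star T * T)) * norm x"
        by (rule power2_le_imp_le) simp
    qed simp
    then have "(norm T)\<^sup>2 \<le> (sqrt (norm (star T * T)))\<^sup>2" by (intro power_mono) auto
    then show "(norm T)\<^sup>2 \<le> norm (star T * T)" by simp
  qed
qed

end

text \<open>Star homomorphisms into \<open>B(H)\<close>, unital or not, are contractive.\<close>

lemma star_hom_contractive:
  fixes f :: "'a::cstar_algebra \<Rightarrow> 'h::complex_hilbert bop"
  assumes f: "star_hom f"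
  shows "norm (f x) \<le> norm x"
proof -
  have lin: "linear f" using f by (simp add: star_hom_def clinear_imp_linear)
  have mul: "f (x * y) = f x * f y" and st: "f (star x) = star (f x)" for x y
    using f by (auto simp: star_hom_def)
  have p: "norm (f 1 \<bullet>\<^sub>o \<xi>) \<le> norm \<xi>" for \<xi>
  proof (cases "f 1 \<bullet>\<^sub>o \<xi> = 0")
    case False
    have "f 1 = star (f 1) * f 1" by (metis mul st star_one mult_1)
    then have "cinner (f 1 \<bullet>\<^sub>o \<xi>) (f 1 \<bullet>\<^sub>o \<xi>) = cinner \<xi> (f 1 \<bullet>\<^sub>o \<xi>)"
      by (metis bop_apply_times cinner_star_right)
    then have "(norm (f 1 \<bullet>\<^sub>o \<xi>))\<^sup>2 = cmod (cinner \<xi> (f 1 \<bullet>\<^sub>o \<xi>))"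
      by (metis cinner_self norm_of_real abs_power2)
    also have "\<dots> \<le> norm \<xi> * norm (f 1 \<bullet>\<^sub>o \<xi>)" by (rule cinner_Cauchy_Schwarz)
    finally show ?thesis using False by (simp add: power2_eq_square)
  qed simp
  have le1: "norm (f x) \<le> 1" if x: "norm x < 1" for x
  proof -
    have "star (star x * x) = star x * x" by (simp add: star_mult)
    moreover have "norm (star x * x) < 1"
      using x by (simp add: cstar_identity power_less_one_iff)
    ultimately obtain c where c: "star c = c" "c * c = 1 - star x * x"
      using cstar_sqrt_one_minus by blast
    have eq: "f 1 = star (f x) * f x + star (f c) * f c"
    proof -
      have "1 = star x * x + star c * c" using c by simp
      then have "f 1 = f (star x * x + star c * c)" by simp
      also have "\<dots> = star (f x) * f x + star (f c) * f c" by (simp add: linear_add[OF lin] mul st)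
      finally show ?thesis .
    qed
    show ?thesis
    proof (rule norm_bop_bound)
      fix \<xi>
      have "cinner \<xi> (f 1 \<bullet>\<^sub>o \<xi>) = cinner (f x \<bullet>\<^sub>o \<xi>) (f x \<bullet>\<^sub>o \<xi>) + cinner (f c \<bullet>\<^sub>o \<xi>) (f c \<bullet>\<^sub>o \<xi>)"
        unfolding eq by (simp add: bop_apply_plus bop_apply_times cinner_add_right cinner_star_right)
      then have "cinner \<xi> (f 1 \<bullet>\<^sub>o \<xi>) = complex_of_real ((norm (f x \<bullet>\<^sub>o \<xi>))\<^sup>2 + (norm (f c \<bullet>\<^sub>o \<xi>))\<^sup>2)"
        by (simp add: cinner_self)
      then have "cmod (cinner \<xi> (f 1 \<bullet>\<^sub>o \<xi>)) = (norm (f x \<bullet>\<^sub>o \<xi>))\<^sup>2 + (norm (f c \<bullet>\<^sub>o \<xi>))\<^sup>2"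
        by (simp only: norm_of_real) simp
      then have "(norm (f x \<bullet>\<^sub>o \<xi>))\<^sup>2 \<le> cmod (cinner \<xi> (f 1 \<bullet>\<^sub>o \<xi>))" by simp
      also have "\<dots> \<le> norm \<xi> * norm (f 1 \<bullet>\<^sub>o \<xi>)" by (rule cinner_Cauchy_Schwarz)
      also have "\<dots> \<le> norm \<xi> * norm \<xi>" by (intro mult_left_mono p) auto
      finally have "(norm (f x \<bullet>\<^sub>o \<xi>))\<^sup>2 \<le> (norm \<xi>)\<^sup>2" by (simp add: power2_eq_square)
      then have "norm (f x \<bullet>\<^sub>o \<xi>) \<le> norm \<xi>" by (rule power2_le_imp_le) simp
      then show "norm (f x \<bullet>\<^sub>o \<xi>) \<le> 1 * norm \<xi>" by simp
    qed simp
  qed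
  show ?thesis
  proof (rule field_le_epsilon)
    fix e :: real assume e: "0 < e"
    define r where "r = norm x + e"
    have r: "r > 0" using e by (simp add: r_def add_nonneg_pos)
    have "norm (inverse r *\<^sub>R x) < 1"
      using r e by (simp add: r_def field_simps)
    then have "norm (f (inverse r *\<^sub>R x)) \<le> 1" by (rule le1)
    then have "inverse r * norm (f x) \<le> 1" using r by (simp add: linear_scale[OF lin])
    then show "norm (f x) \<le> norm x + e" using r by (simp add: r_def field_simps)
  qed
qed

section \<open>The Hilbert space of square summable families\<close>

typedef 'i ell2 = "{f :: 'i \<Rightarrow> complex. (\<lambda>i. (cmod (f i))\<^sup>2) summable_on UNIV}"
  morphisms coord Abs_ell2
  by (rule exI[of _ "\<lambda>_. 0"]) simp

setup_lifting type_definition_ell2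

lemma ell2_eqI: "(\<And>i. coord f i = coord g i) \<Longrightarrow> f = g"
  by (metis coord_inject ext)

lemma square_summable_iff:
  "(\<lambda>i. (cmod (f i))\<^sup>2) summable_on UNIV \<longleftrightarrow> (\<exists>B. \<forall>F. finite F \<longrightarrow> (\<Sum>i\<in>F. (cmod (f i))\<^sup>2) \<le> B)"
proof
  assume s: "(\<lambda>i. (cmod (f i))\<^sup>2) summable_on UNIV"
  show "\<exists>B. \<forall>F. finite F \<longrightarrow> (\<Sum>i\<in>F. (cmod (f i))\<^sup>2) \<le> B"
    by (intro exI[of _ "infsum (\<lambda>i. (cmod (f i))\<^sup>2) UNIV"] allI impI finite_sum_le_infsum[OF s]) auto
next
  assume "\<exists>B. \<forall>F. finite F \<longrightarrow> (\<Sum>i\<in>F. (cmod (f i))\<^sup>2) \<le> B"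
  then show "(\<lambda>i. (cmod (f i))\<^sup>2) summable_on UNIV"
    by (intro nonneg_bdd_above_summable_on) (auto simp: bdd_above_def)
qed

lemma L2_set_cmod_add: "L2_set (\<lambda>i. cmod (f i + g i)) F \<le> L2_set (\<lambda>i. cmod (f i)) F + L2_set (\<lambda>i. cmod (g i)) F"
  by (rule order_trans[OF L2_set_mono L2_set_triangle_ineq]) (auto intro: norm_triangle_ineq)

lemma square_summable_add:
  assumes "(\<lambda>i. (cmod (f i))\<^sup>2) summable_on UNIV" "(\<lambda>i. (cmod (g i))\<^sup>2) summable_on UNIV"
  shows "(\<lambda>i. (cmod (f i + g i))\<^sup>2) summable_on UNIV"
proof -
  have "(\<lambda>i. 2 * (cmod (f i))\<^sup>2 + 2 * (cmod (g i))\<^sup>2) summable_on UNIV"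
    by (intro summable_on_add summable_on_cmult_right assms)
  moreover have "(cmod (f i + g i))\<^sup>2 \<le> 2 * (cmod (f i))\<^sup>2 + 2 * (cmod (g i))\<^sup>2" for i
  proof -
    have "(cmod (f i + g i))\<^sup>2 \<le> (cmod (f i) + cmod (g i))\<^sup>2"
      by (intro power_mono norm_triangle_ineq) auto
    also have "\<dots> \<le> 2 * (cmod (f i))\<^sup>2 + 2 * (cmod (g i))\<^sup>2"
      using sum_squares_bound[of "cmod (f i)" "cmod (g i)"] by (simp add: power2_sum)
    finally show ?thesis .
  qed
  ultimately show ?thesis
    by (rule summable_on_comparison_test) auto
qed

lemma square_summable_cmult:
  assumes "(\<lambda>i. (cmod (f i))\<^sup>2) summable_on UNIV"
  shows "(\<lambda>i. (cmod (c * f i))\<^sup>2) summable_on UNIV"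
  using summable_on_cmult_right[OF assms, of "(cmod c)\<^sup>2"] by (simp add: norm_mult power_mult_distrib)

instantiation ell2 :: (type) complex_vector
begin

lift_definition zero_ell2 :: "'a ell2" is "\<lambda>_. 0" by simp
lift_definition plus_ell2 :: "'a ell2 \<Rightarrow> 'a ell2 \<Rightarrow> 'a ell2" is "\<lambda>f g i. f i + g i"
  by (rule square_summable_add)
lift_definition uminus_ell2 :: "'a ell2 \<Rightarrow> 'a ell2" is "\<lambda>f i. - f i" by simp
lift_definition minus_ell2 :: "'a ell2 \<Rightarrow> 'a ell2 \<Rightarrow> 'a ell2" is "\<lambda>f g i. f i - g i"
  using square_summable_add[of _ "\<lambda>i. - _ i"] by simp
lift_definition scaleC_ell2 :: "complex \<Rightarrow> 'a ell2 \<Rightarrow> 'a ell2" is "\<lambda>c f i. c * f i"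
  by (rule square_summable_cmult)
definition scaleR_ell2 :: "real \<Rightarrow> 'a ell2 \<Rightarrow> 'a ell2" where "scaleR_ell2 r f = complex_of_real r *\<^sub>C f"

lemmas coord_simps = zero_ell2.rep_eq plus_ell2.rep_eq uminus_ell2.rep_eq minus_ell2.rep_eq scaleC_ell2.rep_eq

instance
  by standard (auto intro!: ell2_eqI simp: scaleR_ell2_def coord_simps algebra_simps)

end

lemma cinner_summable:
  assumes "(\<lambda>i. (cmod (f i))\<^sup>2) summable_on UNIV" "(\<lambda>i. (cmod (g i))\<^sup>2) summable_on UNIV"
  shows "(\<lambda>i. cnj (f i) * g i) summable_on UNIV"
  by (rule abs_summable_summable)
     (use abs_summable_product[of "\<lambda>i. cnj (f i)" UNIV g] assms
       in \<open>simp add: norm_mult power2_eq_square\<close>)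

instantiation ell2 :: (type) real_normed_vector
begin

lift_definition norm_ell2 :: "'a ell2 \<Rightarrow> real" is "\<lambda>f. sqrt (\<Sum>\<^sub>\<infinity>i. (cmod (f i))\<^sup>2)" .
definition dist_ell2 :: "'a ell2 \<Rightarrow> 'a ell2 \<Rightarrow> real" where "dist_ell2 f g = norm (f - g)"
definition sgn_ell2 :: "'a ell2 \<Rightarrow> 'a ell2" where "sgn_ell2 f = f /\<^sub>R norm f"
definition uniformity_ell2 :: "('a ell2 \<times> 'a ell2) filter" where
  "uniformity_ell2 = (INF e\<in>{0<..}. principal {(x, y). dist x y < e})"
definition open_ell2 :: "'a ell2 set \<Rightarrow> bool" where
  "open_ell2 U = (\<forall>x\<in>U. \<forall>\<^sub>F (x', y) in uniformity. x' = x \<longrightarrow> y \<in> U)"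

lemma coord_summable: "(\<lambda>i. (cmod (coord f i))\<^sup>2) summable_on UNIV" for f :: "'a ell2"
  using coord[of f] by simp

lemma norm_ell2_nonneg: "0 \<le> norm (f::'a ell2)"
  by transfer (simp add: infsum_nonneg)

lemma norm_ell2_square: "(norm f)\<^sup>2 = (\<Sum>\<^sub>\<infinity>i. (cmod (coord f i))\<^sup>2)" for f :: "'a ell2"
  by transfer (simp add: infsum_nonneg)

lemma finite_sum_le_norm_ell2: "finite F \<Longrightarrow> (\<Sum>i\<in>F. (cmod (coord f i))\<^sup>2) \<le> (norm f)\<^sup>2" for f :: "'a ell2"
  unfolding norm_ell2_square by (rule finite_sum_le_infsum[OF coord_summable]) auto

lemma L2_set_le_norm_ell2: "finite F \<Longrightarrow> L2_set (\<lambda>i. cmod (coord f i)) F \<le> norm f" for f :: "'a ell2"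
  unfolding L2_set_def using finite_sum_le_norm_ell2[of F f] norm_ell2_nonneg
  by (simp add: real_le_lsqrt sum_nonneg)

lemma norm_ell2_bound:
  fixes f :: "'a ell2"
  assumes "\<And>F. finite F \<Longrightarrow> (\<Sum>i\<in>F. (cmod (coord f i))\<^sup>2) \<le> B\<^sup>2" "0 \<le> B"
  shows "norm f \<le> B"
proof (rule power2_le_imp_le)
  show "(norm f)\<^sup>2 \<le> B\<^sup>2"
    unfolding norm_ell2_square using assms by (intro infsum_le_finite_sums coord_summable) auto
qed (rule assms)

lemma norm_ell2_bound_L2:
  fixes f :: "'a ell2"
  assumes "\<And>F. finite F \<Longrightarrow> L2_set (\<lambda>i. cmod (coord f i)) F \<le> B"
  shows "norm f \<le> B"
proof (rule norm_ell2_bound)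
  show "0 \<le> B" using assms[of "{}"] by simp
  fix F :: "'a set" assume "finite F"
  then show "(\<Sum>i\<in>F. (cmod (coord f i))\<^sup>2) \<le> B\<^sup>2"
    using assms[of F] by (simp add: L2_set_def sqrt_le_D)
qed

lemma coord_le_norm: "cmod (coord f i) \<le> norm f" for f :: "'a ell2"
  using L2_set_le_norm_ell2[of "{i}" f] by simp

instance
proof
  fix f g :: "'a ell2" and r :: real
  show "(norm f = 0) = (f = 0)"
  proof
    assume "norm f = 0"
    then have "coord f i = 0" for i using coord_le_norm[of f i] by simp
    then show "f = 0" by (intro ell2_eqI) (simp add: coord_simps)
  next
    assume "f = 0"
    then show "norm f = 0" by transfer simp
  qed
  show "norm (f + g) \<le> norm f + norm g"
  proof (rule norm_ell2_bound_L2)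
    fix F :: "'a set" assume "finite F"
    then show "L2_set (\<lambda>i. cmod (coord (f + g) i)) F \<le> norm f + norm g"
      unfolding coord_simps
      by (intro order_trans[OF L2_set_cmod_add] add_mono L2_set_le_norm_ell2)
  qed
  show "norm (r *\<^sub>R f) = \<bar>r\<bar> * norm f"
    unfolding scaleR_ell2_def
    by transfer (simp add: norm_mult power_mult_distrib infsum_cmult_right' real_sqrt_mult)
qed (simp_all add: dist_ell2_def sgn_ell2_def uniformity_ell2_def open_ell2_def)

end

instance ell2 :: (type) banach
proof
  fix X :: "nat \<Rightarrow> 'a ell2"
  assume C: "Cauchy X"
  have "Cauchy (\<lambda>n. coord (X n) i)" for i
  proof (rule metric_CauchyI)
    fix e :: real assume "e > 0"
    then obtain M where M: "\<And>m n. m \<ge> M \<Longrightarrow> n \<ge> M \<Longrightarrow> dist (X m) (X n) < e"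
      using metric_CauchyD[OF C] by blast
    have "dist (coord (X m) i) (coord (X n) i) \<le> dist (X m) (X n)" for m n
      using coord_le_norm[of "X m - X n" i] by (simp add: dist_norm coord_simps)
    then show "\<exists>M. \<forall>m\<ge>M. \<forall>n\<ge>M. dist (coord (X m) i) (coord (X n) i) < e"
      using M by (meson le_less_trans)
  qed
  then have "\<exists>l. (\<lambda>n. coord (X n) i) \<longlonglongrightarrow> l" for i
    using Cauchy_convergent convergent_def by blast
  then obtain g where g: "\<And>i. (\<lambda>n. coord (X n) i) \<longlonglongrightarrow> g i" by metis
  have est: "(\<Sum>i\<in>F. (cmod (coord (X n) i - g i))\<^sup>2) \<le> e\<^sup>2"
    if M: "\<And>m n. m \<ge> M \<Longrightarrow> n \<ge> M \<Longrightarrow> dist (X m) (X n) < e" and n: "n \<ge> M" and F: "finite F" for F M n e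
  proof (rule LIMSEQ_le_const2)
    show "(\<lambda>m. \<Sum>i\<in>F. (cmod (coord (X n) i - coord (X m) i))\<^sup>2) \<longlonglongrightarrow> (\<Sum>i\<in>F. (cmod (coord (X n) i - g i))\<^sup>2)"
      by (intro tendsto_intros g)
    have "(\<Sum>i\<in>F. (cmod (coord (X n) i - coord (X m) i))\<^sup>2) \<le> e\<^sup>2" if "m \<ge> M" for m
    proof -
      have "(\<Sum>i\<in>F. (cmod (coord (X n - X m) i))\<^sup>2) \<le> (norm (X n - X m))\<^sup>2"
        by (rule finite_sum_le_norm_ell2[OF F])
      also have "\<dots> \<le> e\<^sup>2" using M[OF n that] by (intro power_mono) (auto simp: dist_norm)
      finally show ?thesis by (simp add: coord_simps)
    qed
    then show "\<exists>N. \<forall>m\<ge>N. (\<Sum>i\<in>F. (cmod (coord (X n) i - coord (X m) i))\<^sup>2) \<le> e\<^sup>2" by blast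
  qed
  obtain M1 where M1: "\<And>m n. m \<ge> M1 \<Longrightarrow> n \<ge> M1 \<Longrightarrow> dist (X m) (X n) < 1"
    using metric_CauchyD[OF C, of 1] by auto
  have "(\<lambda>i. (cmod (coord (X M1) i - g i))\<^sup>2) summable_on UNIV"
    unfolding square_summable_iff using est[OF M1 order_refl] by blast
  then have "(\<lambda>i. (cmod (coord (X M1) i + - (coord (X M1) i - g i)))\<^sup>2) summable_on UNIV"
    by (intro square_summable_add coord_summable) (simp only: norm_minus_cancel)
  then have gs: "(\<lambda>i. (cmod (g i))\<^sup>2) summable_on UNIV" by simp
  define L where "L = Abs_ell2 g"
  have L: "coord L = g" unfolding L_def using gs by (simp add: Abs_ell2_inverse)
  have "X \<longlonglongrightarrow> L"
  proof (rule metric_LIMSEQ_I)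
    fix e :: real assume e: "e > 0"
    then obtain M where M: "\<And>m n. m \<ge> M \<Longrightarrow> n \<ge> M \<Longrightarrow> dist (X m) (X n) < e / 2"
      using metric_CauchyD[OF C, of "e / 2"] by auto
    have "dist (X n) L < e" if "n \<ge> M" for n
    proof -
      have "norm (X n - L) \<le> e / 2"
        by (rule norm_ell2_bound) (use est[OF M that] e in \<open>auto simp: coord_simps L\<close>)
      then show ?thesis using e by (simp add: dist_norm)
    qed
    then show "\<exists>M. \<forall>n\<ge>M. dist (X n) L < e" by blast
  qed
  then show "convergent X" by (auto simp: convergent_def)
qed

instantiation ell2 :: (type) complex_hilbert
begin

lift_definition cinner_ell2 :: "'a ell2 \<Rightarrow> 'a ell2 \<Rightarrow> complex" is "\<lambda>f g. \<Sum>\<^sub>\<infinity>i. cnj (f i) * g i" .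

instance
proof
  fix f g h :: "'a ell2" and c :: complex
  show "cinner f g = cnj (cinner g f)"
    by transfer (simp flip: infsum_cnj add: mult.commute)
  show "cinner f (g + h) = cinner f g + cinner f h"
    by transfer (simp add: distrib_left infsum_add cinner_summable)
  show "cinner f (c *\<^sub>C g) = c * cinner f g"
    by transfer (simp add: mult.left_commute flip: infsum_cmult_right')
  have "cinner f f = (\<Sum>\<^sub>\<infinity>i. complex_of_real ((cmod (coord f i))\<^sup>2))"
    unfolding cinner_ell2.rep_eq by (rule infsum_cong) (simp add: cmod_square mult.commute)
  also have "\<dots> = complex_of_real (\<Sum>\<^sub>\<infinity>i. (cmod (coord f i))\<^sup>2)"
    by (rule infsum_bounded_linear_strong[OF _ bounded_linear_of_real])
       (simp only: coord_summable summable_on_of_real)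
  finally show "cinner f f = complex_of_real ((norm f)\<^sup>2)"
    by (simp add: norm_ell2_square)
qed

end

lift_definition ket :: "'i \<Rightarrow> 'i ell2" is "\<lambda>i j. if j = i then 1 else 0"
proof -
  fix i :: 'i
  have "(\<lambda>j. (cmod (if j = i then 1 else 0))\<^sup>2) summable_on {i}" by simp
  then show "(\<lambda>j. (cmod (if j = i then 1 else 0))\<^sup>2) summable_on UNIV"
    by (rule summable_on_cong_neutral[THEN iffD1, rotated -1]) auto
qed

lemma cinner_ket: "cinner (ket i) f = coord f i"
proof -
  have "cinner (ket i) f = (\<Sum>\<^sub>\<infinity>j\<in>{i}. coord f j)"
    unfolding cinner_ell2.rep_eq by (rule infsum_cong_neutral) (auto simp: ket.rep_eq)
  then show ?thesis by simp
qed

lemma cinner_ket_right: "cinner f (ket i) = cnj (coord f i)"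
  by (metis cinner_ket cinner_commute)

lemma bop_ket_eqI:
  assumes "\<And>i. S \<bullet>\<^sub>o ket i = T \<bullet>\<^sub>o ket i"
  shows "S = T"
proof (rule bop_eqI, rule ell2_eqI)
  fix f k
  have "coord (star S \<bullet>\<^sub>o ket k) i = coord (star T \<bullet>\<^sub>o ket k) i" for i
  proof -
    have "cnj (coord (star S \<bullet>\<^sub>o ket k) i) = cnj (coord (star T \<bullet>\<^sub>o ket k) i)"
      unfolding cinner_ket_right[symmetric] cinner_star_left by (simp add: assms)
    then show ?thesis by simp
  qed
  then have "star S \<bullet>\<^sub>o ket k = star T \<bullet>\<^sub>o ket k" by (rule ell2_eqI)
  then have "cinner (ket k) (S \<bullet>\<^sub>o f) = cinner (ket k) (T \<bullet>\<^sub>o f)"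
    unfolding cinner_star_left[symmetric] by simp
  then show "coord (S \<bullet>\<^sub>o f) k = coord (T \<bullet>\<^sub>o f) k" by (simp add: cinner_ket)
qed

section \<open>Tensor products of operators on \<open>\<ell>\<^sup>2\<close>\<close>

text \<open>The Hilbert space tensor product of \<open>\<ell>\<^sup>2(I)\<close> and \<open>\<ell>\<^sup>2(J)\<close> is \<open>\<ell>\<^sup>2(I \<times> J)\<close>.\<close>

lift_definition ell2_tensor :: "'i ell2 \<Rightarrow> 'j ell2 \<Rightarrow> ('i \<times> 'j) ell2" is "\<lambda>f g (i, j). f i * g j"
proof -
  fix f :: "'i \<Rightarrow> complex" and g :: "'j \<Rightarrow> complex"
  assume "(\<lambda>i. (cmod (f i))\<^sup>2) summable_on UNIV" "(\<lambda>i. (cmod (g i))\<^sup>2) summable_on UNIV"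
  then obtain A B where A: "\<And>F. finite F \<Longrightarrow> (\<Sum>i\<in>F. (cmod (f i))\<^sup>2) \<le> A"
    and B: "\<And>F. finite F \<Longrightarrow> (\<Sum>i\<in>F. (cmod (g i))\<^sup>2) \<le> B"
    unfolding square_summable_iff by blast
  have "(\<Sum>p\<in>F. (cmod (case p of (i, j) \<Rightarrow> f i * g j))\<^sup>2) \<le> A * B" if F: "finite F" for F
  proof -
    have "(\<Sum>p\<in>F. (cmod (case p of (i, j) \<Rightarrow> f i * g j))\<^sup>2)
        \<le> (\<Sum>p\<in>fst ` F \<times> snd ` F. (cmod (case p of (i, j) \<Rightarrow> f i * g j))\<^sup>2)"
      using F by (intro sum_mono2) (auto simp: image_iff split: prod.splits, force+)
    also have "\<dots> = (\<Sum>i\<in>fst ` F. (cmod (f i))\<^sup>2) * (\<Sum>j\<in>snd ` F. (cmod (g j))\<^sup>2)"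
      by (simp add: sum_product sum.cartesian_product norm_mult power_mult_distrib case_prod_beta)
    also have "\<dots> \<le> A * B"
      using F A[of "{}"] by (intro mult_mono A B) (auto intro: sum_nonneg)
    finally show ?thesis .
  qed
  then show "(\<lambda>i. (cmod (case i of (i, j) \<Rightarrow> f i * g j))\<^sup>2) summable_on UNIV"
    unfolding square_summable_iff by blast
qed

lemma coord_ell2_tensor: "coord (ell2_tensor f g) (i, j) = coord f i * coord g j"
  by (simp add: ell2_tensor.rep_eq)

lemma ket_tensor: "ell2_tensor (ket i) (ket j) = ket (i, j)"
  by (rule ell2_eqI) (auto simp: ell2_tensor.rep_eq ket.rep_eq split: if_splits)

lemma ell2_tensor_add_left: "ell2_tensor (f + f') g = ell2_tensor f g + ell2_tensor f' g"
  by (rule ell2_eqI) (auto simp: ell2_tensor.rep_eq coord_simps algebra_simps)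

lemma ell2_tensor_add_right: "ell2_tensor f (g + g') = ell2_tensor f g + ell2_tensor f g'"
  by (rule ell2_eqI) (auto simp: ell2_tensor.rep_eq coord_simps algebra_simps)

lemma ell2_tensor_scaleC_left: "ell2_tensor (c *\<^sub>C f) g = c *\<^sub>C ell2_tensor f g"
  by (rule ell2_eqI) (auto simp: ell2_tensor.rep_eq coord_simps algebra_simps)

lemma ell2_tensor_scaleC_right: "ell2_tensor f (c *\<^sub>C g) = c *\<^sub>C ell2_tensor f g"
  by (rule ell2_eqI) (auto simp: ell2_tensor.rep_eq coord_simps algebra_simps)

lift_definition column :: "('i \<times> 'j) ell2 \<Rightarrow> 'j \<Rightarrow> 'i ell2" is "\<lambda>f j i. f (i, j)"
proof -
  fix f :: "'i \<times> 'j \<Rightarrow> complex" and j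
  assume "(\<lambda>p. (cmod (f p))\<^sup>2) summable_on UNIV"
  then obtain A where A: "\<And>F. finite F \<Longrightarrow> (\<Sum>p\<in>F. (cmod (f p))\<^sup>2) \<le> A"
    unfolding square_summable_iff by blast
  have "(\<Sum>i\<in>F. (cmod (f (i, j)))\<^sup>2) \<le> A" if "finite F" for F
    using A[of "(\<lambda>i. (i, j)) ` F"] that by (simp add: sum.reindex inj_on_def)
  then show "(\<lambda>i. (cmod (f (i, j)))\<^sup>2) summable_on UNIV"
    unfolding square_summable_iff by blast
qed

lift_definition swap_ell2 :: "('i \<times> 'j) ell2 \<Rightarrow> ('j \<times> 'i) ell2" is "\<lambda>f (j, i). f (i, j)"
proof -
  fix f :: "'i \<times> 'j \<Rightarrow> complex"
  assume "(\<lambda>p. (cmod (f p))\<^sup>2) summable_on UNIV"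
  then obtain A where A: "\<And>F. finite F \<Longrightarrow> (\<Sum>p\<in>F. (cmod (f p))\<^sup>2) \<le> A"
    unfolding square_summable_iff by blast
  have "(\<Sum>p\<in>F. (cmod (case p of (j, i) \<Rightarrow> f (i, j)))\<^sup>2) \<le> A" if "finite F" for F
  proof -
    have "(\<Sum>p\<in>F. (cmod (case p of (j, i) \<Rightarrow> f (i, j)))\<^sup>2) = (\<Sum>p\<in>prod.swap ` F. (cmod (f p))\<^sup>2)"
      by (subst sum.reindex) (auto simp: inj_on_def intro!: sum.cong)
    then show ?thesis using A[of "prod.swap ` F"] that by simp
  qed
  then show "(\<lambda>p. (cmod (case p of (j, i) \<Rightarrow> f (i, j)))\<^sup>2) summable_on UNIV"
    unfolding square_summable_iff by blast
qed

lemma norm_swap_ell2_le: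
  fixes f :: "('i \<times> 'j) ell2"
  shows "norm (swap_ell2 f) \<le> norm f"
proof (rule norm_ell2_bound)
  fix F :: "('j \<times> 'i) set" assume F: "finite F"
  have "(\<Sum>p\<in>F. (cmod (coord (swap_ell2 f) p))\<^sup>2) = (\<Sum>p\<in>prod.swap ` F. (cmod (coord f p))\<^sup>2)"
    by (subst sum.reindex) (auto simp: inj_on_def swap_ell2.rep_eq intro!: sum.cong)
  also have "\<dots> \<le> (norm f)\<^sup>2" using F by (intro finite_sum_le_norm_ell2) simp
  finally show "(\<Sum>p\<in>F. (cmod (coord (swap_ell2 f) p))\<^sup>2) \<le> (norm f)\<^sup>2" .
qed simp

lemma sum_norm_column_le:
  fixes f :: "('i \<times> 'j) ell2"
  assumes J: "finite J"
  shows "(\<Sum>j\<in>J. (norm (column f j))\<^sup>2) \<le> (norm f)\<^sup>2"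
proof -
  have s: "(\<lambda>i. \<Sum>j\<in>J. (cmod (coord (column f j) i))\<^sup>2) summable_on UNIV"
    and eq: "(\<Sum>\<^sub>\<infinity>i. \<Sum>j\<in>J. (cmod (coord (column f j) i))\<^sup>2) = (\<Sum>j\<in>J. (norm (column f j))\<^sup>2)"
    using J by (induction J) (simp_all add: summable_on_add infsum_add coord_summable norm_ell2_square)
  have "(\<Sum>\<^sub>\<infinity>i. \<Sum>j\<in>J. (cmod (coord (column f j) i))\<^sup>2) \<le> (norm f)\<^sup>2"
  proof (rule infsum_le_finite_sums[OF s])
    fix I :: "'i set" assume I: "finite I"
    have "(\<Sum>i\<in>I. \<Sum>j\<in>J. (cmod (coord (column f j) i))\<^sup>2) = (\<Sum>p\<in>I \<times> J. (cmod (coord f p))\<^sup>2)"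
      by (simp add: sum.cartesian_product column.rep_eq case_prod_beta)
    also have "\<dots> \<le> (norm f)\<^sup>2" using I J by (intro finite_sum_le_norm_ell2) simp
    finally show "(\<Sum>i\<in>I. \<Sum>j\<in>J. (cmod (coord (column f j) i))\<^sup>2) \<le> (norm f)\<^sup>2" .
  qed
  then show ?thesis by (simp add: eq)
qed

lemma ampliation_bound:
  fixes S :: "'i ell2 bop" and f :: "('i \<times> 'j) ell2"
  assumes F: "finite F"
  shows "(\<Sum>p\<in>F. (cmod (coord (S \<bullet>\<^sub>o column f (snd p)) (fst p)))\<^sup>2) \<le> (norm S * norm f)\<^sup>2"
proof -
  have "(\<Sum>p\<in>F. (cmod (coord (S \<bullet>\<^sub>o column f (snd p)) (fst p)))\<^sup>2)
      \<le> (\<Sum>p\<in>fst ` F \<times> snd ` F. (cmod (coord (S \<bullet>\<^sub>o column f (snd p)) (fst p)))\<^sup>2)"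
    using F by (intro sum_mono2) (auto simp: image_iff, force+)
  also have "\<dots> = (\<Sum>i\<in>fst ` F. \<Sum>j\<in>snd ` F. (cmod (coord (S \<bullet>\<^sub>o column f j) i))\<^sup>2)"
    by (simp add: sum.cartesian_product case_prod_beta)
  also have "\<dots> = (\<Sum>j\<in>snd ` F. \<Sum>i\<in>fst ` F. (cmod (coord (S \<bullet>\<^sub>o column f j) i))\<^sup>2)"
    by (rule sum.swap)
  also have "\<dots> \<le> (\<Sum>j\<in>snd ` F. (norm S * norm (column f j))\<^sup>2)"
  proof (rule sum_mono)
    fix j
    have "(\<Sum>i\<in>fst ` F. (cmod (coord (S \<bullet>\<^sub>o column f j) i))\<^sup>2) \<le> (norm (S \<bullet>\<^sub>o column f j))\<^sup>2"
      using F by (intro finite_sum_le_norm_ell2) simp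
    also have "\<dots> \<le> (norm S * norm (column f j))\<^sup>2" by (intro power_mono norm_bop_apply) simp
    finally show "(\<Sum>i\<in>fst ` F. (cmod (coord (S \<bullet>\<^sub>o column f j) i))\<^sup>2) \<le> (norm S * norm (column f j))\<^sup>2" .
  qed
  also have "\<dots> = (norm S)\<^sup>2 * (\<Sum>j\<in>snd ` F. (norm (column f j))\<^sup>2)"
    by (simp add: power_mult_distrib sum_distrib_left)
  also have "\<dots> \<le> (norm S)\<^sup>2 * (norm f)\<^sup>2"
    using F by (intro mult_left_mono sum_norm_column_le) auto
  finally show ?thesis by (simp add: power_mult_distrib)
qed

lemma ampliation_exists:
  fixes S :: "'i ell2 bop"
  shows "\<exists>T :: ('i \<times> 'j) ell2 bop. norm T \<le> norm S \<and>
    (\<forall>x y. T \<bullet>\<^sub>o ell2_tensor x y = ell2_tensor (S \<bullet>\<^sub>o x) y)"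
proof -
  define h where "h f p = coord (S \<bullet>\<^sub>o column f (snd p)) (fst p)" for f :: "('i \<times> 'j) ell2" and p
  define A where "A f = Abs_ell2 (h f)" for f
  have cA: "coord (A f) = h f" for f
  proof -
    have "(\<lambda>p. (cmod (h f p))\<^sup>2) summable_on UNIV"
      unfolding square_summable_iff h_def using ampliation_bound by blast
    then show ?thesis by (simp add: A_def Abs_ell2_inverse)
  qed
  have col_add: "column (f + g) j = column f j + column g j" for f g :: "('i \<times> 'j) ell2" and j
    by (rule ell2_eqI) (simp add: column.rep_eq coord_simps)
  have col_sc: "column (c *\<^sub>C f) j = c *\<^sub>C column f j" for c and f :: "('i \<times> 'j) ell2" and j
    by (rule ell2_eqI) (simp add: column.rep_eq coord_simps)
  have add: "A (f + g) = A f + A g" for f g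
    by (rule ell2_eqI) (simp add: cA h_def col_add bop_apply_add coord_simps)
  have sc: "A (c *\<^sub>C f) = c *\<^sub>C A f" for c f
    by (rule ell2_eqI) (simp add: cA h_def col_sc bop_apply_scaleC coord_simps)
  have nA: "norm (A f) \<le> norm S * norm f" for f
    by (rule norm_ell2_bound) (auto simp: cA h_def intro: ampliation_bound)
  have "bounded_linear A"
    by (rule bounded_linear_intro[where K="norm S"]) (auto simp: add sc scaleR_scaleC nA mult.commute[of _ "norm S"])
  then obtain T where T: "\<And>f. T \<bullet>\<^sub>o f = A f" using bop_exists[of A] sc by blast
  have "column (ell2_tensor x y) j = coord y j *\<^sub>C x" for x :: "'i ell2" and y :: "'j ell2" and j
    by (rule ell2_eqI) (simp add: column.rep_eq ell2_tensor.rep_eq coord_simps mult.commute)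
  then have "T \<bullet>\<^sub>o ell2_tensor x y = ell2_tensor (S \<bullet>\<^sub>o x) y" for x y
    by (intro ell2_eqI)
       (auto simp: T cA h_def bop_apply_scaleC coord_simps ell2_tensor.rep_eq mult.commute split: prod.splits)
  moreover have "norm T \<le> norm S"
    by (rule norm_bop_bound) (auto simp: T nA)
  ultimately show ?thesis by blast
qed

lemma swap_ell2_tensor: "swap_ell2 (ell2_tensor x y) = ell2_tensor y x"
  by (rule ell2_eqI) (auto simp: swap_ell2.rep_eq ell2_tensor.rep_eq mult.commute)

lemma ampliation_right_exists:
  fixes S :: "'j ell2 bop"
  shows "\<exists>T :: ('i \<times> 'j) ell2 bop. norm T \<le> norm S \<and>
    (\<forall>x y. T \<bullet>\<^sub>o ell2_tensor x y = ell2_tensor x (S \<bullet>\<^sub>o y))"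
proof -
  obtain T :: "('j \<times> 'i) ell2 bop" where nT: "norm T \<le> norm S"
    and T: "\<And>x y. T \<bullet>\<^sub>o ell2_tensor x y = ell2_tensor (S \<bullet>\<^sub>o x) y"
    using ampliation_exists by blast
  define A where "A f = swap_ell2 (T \<bullet>\<^sub>o swap_ell2 f)" for f :: "('i \<times> 'j) ell2"
  have sw_add: "swap_ell2 (f + g) = swap_ell2 f + swap_ell2 g" for f g :: "('a \<times> 'b) ell2"
    by (rule ell2_eqI) (auto simp: swap_ell2.rep_eq coord_simps split: prod.splits)
  have sw_sc: "swap_ell2 (c *\<^sub>C f) = c *\<^sub>C swap_ell2 f" for c and f :: "('a \<times> 'b) ell2"
    by (rule ell2_eqI) (auto simp: swap_ell2.rep_eq coord_simps split: prod.splits)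
  have add: "A (f + g) = A f + A g" for f g by (simp add: A_def sw_add bop_apply_add)
  have sc: "A (c *\<^sub>C f) = c *\<^sub>C A f" for c f by (simp add: A_def sw_sc bop_apply_scaleC)
  have nA: "norm (A f) \<le> norm S * norm f" for f
  proof -
    have "norm (A f) \<le> norm (T \<bullet>\<^sub>o swap_ell2 f)" unfolding A_def by (rule norm_swap_ell2_le)
    also have "\<dots> \<le> norm T * norm (swap_ell2 f)" by (rule norm_bop_apply)
    also have "\<dots> \<le> norm S * norm f" by (intro mult_mono nT norm_swap_ell2_le) auto
    finally show ?thesis .
  qed
  have "bounded_linear A"
    by (rule bounded_linear_intro[where K="norm S"]) (auto simp: add sc scaleR_scaleC nA mult.commute[of _ "norm S"])
  then obtain U where U: "\<And>f. U \<bullet>\<^sub>o f = A f" using bop_exists[of A] sc by blast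
  have "U \<bullet>\<^sub>o ell2_tensor x y = ell2_tensor x (S \<bullet>\<^sub>o y)" for x y
    by (simp add: U A_def swap_ell2_tensor T)
  moreover have "norm U \<le> norm S"
    by (rule norm_bop_bound) (auto simp: U nA)
  ultimately show ?thesis by blast
qed

definition bop_tensor :: "'i ell2 bop \<Rightarrow> 'j ell2 bop \<Rightarrow> ('i \<times> 'j) ell2 bop" where
  "bop_tensor S T = (THE U. \<forall>x y. U \<bullet>\<^sub>o ell2_tensor x y = ell2_tensor (S \<bullet>\<^sub>o x) (T \<bullet>\<^sub>o y))"

lemma bop_tensor_unique:
  assumes "\<And>x y. U \<bullet>\<^sub>o ell2_tensor x y = V \<bullet>\<^sub>o ell2_tensor x y"
  shows "U = V"
proof (rule bop_ket_eqI)
  fix p :: "'a \<times> 'b"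
  show "U \<bullet>\<^sub>o ket p = V \<bullet>\<^sub>o ket p"
    using assms[of "ket (fst p)" "ket (snd p)"] by (simp add: ket_tensor)
qed

lemma bop_tensor_ex:
  "\<exists>U. norm U \<le> norm S * norm T \<and> (\<forall>x y. U \<bullet>\<^sub>o ell2_tensor x y = ell2_tensor (S \<bullet>\<^sub>o x) (T \<bullet>\<^sub>o y))"
proof -
  obtain A :: "('a \<times> 'b) ell2 bop" where A: "norm A \<le> norm S"
    "\<And>x y. A \<bullet>\<^sub>o ell2_tensor x y = ell2_tensor (S \<bullet>\<^sub>o x) y" using ampliation_exists by blast
  obtain B :: "('a \<times> 'b) ell2 bop" where B: "norm B \<le> norm T"
    "\<And>x y. B \<bullet>\<^sub>o ell2_tensor x y = ell2_tensor x (T \<bullet>\<^sub>o y)" using ampliation_right_exists by blast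
  have "norm (A * B) \<le> norm S * norm T"
    using norm_times_bop[of A B] mult_mono[OF A(1) B(1)] by simp
  moreover have "(A * B) \<bullet>\<^sub>o ell2_tensor x y = ell2_tensor (S \<bullet>\<^sub>o x) (T \<bullet>\<^sub>o y)" for x y
    by (simp add: bop_apply_times A B)
  ultimately show ?thesis by blast
qed

lemma bop_tensor_eqI:
  assumes "\<And>x y. U \<bullet>\<^sub>o ell2_tensor x y = ell2_tensor (S \<bullet>\<^sub>o x) (T \<bullet>\<^sub>o y)"
  shows "bop_tensor S T = U"
  unfolding bop_tensor_def
  by (rule the_equality) (use assms in \<open>auto intro!: bop_tensor_unique\<close>)

lemma bop_tensor_apply: "bop_tensor S T \<bullet>\<^sub>o ell2_tensor x y = ell2_tensor (S \<bullet>\<^sub>o x) (T \<bullet>\<^sub>o y)"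
  and norm_bop_tensor: "norm (bop_tensor S T) \<le> norm S * norm T"
proof -
  obtain U where U: "norm U \<le> norm S * norm T"
    "\<And>x y. U \<bullet>\<^sub>o ell2_tensor x y = ell2_tensor (S \<bullet>\<^sub>o x) (T \<bullet>\<^sub>o y)" using bop_tensor_ex by blast
  have "bop_tensor S T = U" by (rule bop_tensor_eqI) (rule U)
  then show "bop_tensor S T \<bullet>\<^sub>o ell2_tensor x y = ell2_tensor (S \<bullet>\<^sub>o x) (T \<bullet>\<^sub>o y)"
    "norm (bop_tensor S T) \<le> norm S * norm T" using U by auto
qed

lemma bop_tensor_add_left: "bop_tensor (S + S') T = bop_tensor S T + bop_tensor S' T"
  by (rule bop_tensor_eqI) (simp add: bop_apply_plus bop_tensor_apply ell2_tensor_add_left)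

lemma bop_tensor_add_right: "bop_tensor S (T + T') = bop_tensor S T + bop_tensor S T'"
  by (rule bop_tensor_eqI) (simp add: bop_apply_plus bop_tensor_apply ell2_tensor_add_right)

lemma bop_tensor_scaleC_left: "bop_tensor (c *\<^sub>C S) T = c *\<^sub>C bop_tensor S T"
  by (rule bop_tensor_eqI) (simp add: bop_apply_scaleC_left bop_tensor_apply ell2_tensor_scaleC_left)

lemma bop_tensor_scaleC_right: "bop_tensor S (c *\<^sub>C T) = c *\<^sub>C bop_tensor S T"
  by (rule bop_tensor_eqI) (simp add: bop_apply_scaleC_left bop_tensor_apply ell2_tensor_scaleC_right)

lemma bop_tensor_mult: "bop_tensor S T * bop_tensor S' T' = bop_tensor (S * S') (T * T')"
  by (rule bop_tensor_eqI[symmetric]) (simp add: bop_apply_times bop_tensor_apply)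

lemma bop_tensor_star: "star (bop_tensor S T) = bop_tensor (star S) (star T)"
proof (rule bop_ket_eqI, rule ell2_eqI)
  fix p q :: "'a \<times> 'b"
  obtain i j k l where p: "p = (i, j)" and q: "q = (k, l)" by fastforce
  have *: "coord (star R \<bullet>\<^sub>o ket m) n = cnj (coord (R \<bullet>\<^sub>o ket n) m)" for R :: "'c ell2 bop" and m n
    by (metis cinner_ket cinner_star_right cinner_ket_right)
  have "coord (star (bop_tensor S T) \<bullet>\<^sub>o ket p) q = cnj (coord (bop_tensor S T \<bullet>\<^sub>o ket q) p)" by (rule *)
  also have "\<dots> = cnj (coord (S \<bullet>\<^sub>o ket k) i) * cnj (coord (T \<bullet>\<^sub>o ket l) j)"
    by (simp add: p q ket_tensor[symmetric] bop_tensor_apply coord_ell2_tensor)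
  also have "\<dots> = coord (bop_tensor (star S) (star T) \<bullet>\<^sub>o ket p) q"
    by (simp add: p q ket_tensor[symmetric] bop_tensor_apply coord_ell2_tensor *)
  finally show "coord (star (bop_tensor S T) \<bullet>\<^sub>o ket p) q = coord (bop_tensor (star S) (star T) \<bullet>\<^sub>o ket p) q" .
qed

lifting_forget bop.lifting
lifting_forget ell2.lifting

section \<open>The minimal tensor product\<close>

text \<open>
  The minimal norm of \<open>\<Sum> a\<^sub>k \<otimes> b\<^sub>k\<close> is the supremum of the operator norms of
  \<open>\<Sum> \<pi>(a\<^sub>k) \<otimes> \<rho>(b\<^sub>k)\<close> over all representations \<open>\<pi>\<close> of the first and \<open>\<rho>\<close> of the second factor.
  A type cannot quantify over all Hilbert spaces, but for an algebra with underlying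
  type \<open>'a\<close> the representations on \<open>\<ell>\<^sup>2('a)\<close> suffice: a vector of a Hilbert space tensor product of two
  representation spaces is a limit of finite sums of elementary tensors, hence only subrepresentations
  generated by finitely many vectors matter, and these have Hilbert space dimension at most the
  cardinality of \<open>'a\<close>. For this reduction it is essential that representations may be degenerate:
  \<open>\<pi>(1)\<close> is only required to be a projection. In particular there are faithful representations on
  \<open>\<ell>\<^sup>2('a)\<close>, so the supremum is also the usual spatial norm.

  The minimal tensor product is then the completion of the algebraic tensor product, realised as the
  closed linear span of the elementary tensors among the bounded families of operators indexed by
  pairs of representations, with the supremum norm.
\<close>

typedef (overloaded) ('a, 'b) rep_pair =
  "{(\<pi> :: 'a::cstar_algebra \<Rightarrow> 'a ell2 bop, \<rho> :: 'b::cstar_algebra \<Rightarrow> 'b ell2 bop). star_hom \<pi> \<and> star_hom \<rho>}"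
  morphisms reps Abs_rep_pair
  by (rule exI[of _ "(\<lambda>_. 0, \<lambda>_. 0)"]) (auto simp: star_hom_def clinear_def)

lemma star_hom_reps: "star_hom (fst (reps p))" "star_hom (snd (reps p))"
  using reps[of p] by auto

lemma reps_simps:
  "fst (reps p) (a * a') = fst (reps p) a * fst (reps p) a'"
  "fst (reps p) (star a) = star (fst (reps p) a)"
  "fst (reps p) (a + a') = fst (reps p) a + fst (reps p) a'"
  "fst (reps p) (c *\<^sub>C a) = c *\<^sub>C fst (reps p) a"
  "snd (reps p) (b * b') = snd (reps p) b * snd (reps p) b'"
  "snd (reps p) (star b) = star (snd (reps p) b)"
  "snd (reps p) (b + b') = snd (reps p) b + snd (reps p) b'"
  "snd (reps p) (c *\<^sub>C b) = c *\<^sub>C snd (reps p) b"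
  using star_hom_reps[of p] by (auto simp: star_hom_def clinear_def)

text \<open>The discrete metric only serves to make every bounded family an element of
  \<open>('a, 'b) rep_pair \<Rightarrow>\<^sub>C _\<close>.\<close>

instantiation rep_pair :: (cstar_algebra, cstar_algebra) metric_space
begin

definition dist_rep_pair :: "('a, 'b) rep_pair \<Rightarrow> ('a, 'b) rep_pair \<Rightarrow> real" where
  "dist_rep_pair p q = (if p = q then 0 else 1)"
definition uniformity_rep_pair :: "(('a, 'b) rep_pair \<times> ('a, 'b) rep_pair) filter" where
  "uniformity_rep_pair = (INF e\<in>{0<..}. principal {(x, y). dist x y < e})"
definition open_rep_pair :: "('a, 'b) rep_pair set \<Rightarrow> bool" where
  "open_rep_pair U = (\<forall>x\<in>U. \<forall>\<^sub>F (x', y) in uniformity. x' = x \<longrightarrow> y \<in> U)"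

instance
  by standard (auto simp: dist_rep_pair_def uniformity_rep_pair_def open_rep_pair_def)

end

lemma bcontfun_rep_pairI:
  fixes f :: "('a::cstar_algebra, 'b::cstar_algebra) rep_pair \<Rightarrow> 'c::real_normed_vector"
  assumes "\<And>p. norm (f p) \<le> B"
  shows "f \<in> bcontfun"
proof (rule bcontfun_normI[OF _ assms])
  show "continuous_on UNIV f"
    unfolding continuous_on_iff
    by (intro ballI allI impI exI[of _ 1]) (auto simp: dist_rep_pair_def split: if_splits)
qed

type_synonym ('a, 'b) rep_family = "('a, 'b) rep_pair \<Rightarrow>\<^sub>C ('a \<times> 'b) ell2 bop"

setup_lifting type_definition_bcontfun

lift_definition elementary :: "'a::cstar_algebra \<Rightarrow> 'b::cstar_algebra \<Rightarrow> ('a, 'b) rep_family" is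
  "\<lambda>a b p. bop_tensor (fst (reps p) a) (snd (reps p) b)"
proof -
  fix a :: 'a and b :: 'b
  have "norm (bop_tensor (fst (reps p) a) (snd (reps p) b)) \<le> norm a * norm b" for p :: "('a, 'b) rep_pair"
    by (rule order_trans[OF norm_bop_tensor])
       (intro mult_mono star_hom_contractive star_hom_reps, auto)
  then show "(\<lambda>p. bop_tensor (fst (reps p) a) (snd (reps p) b)) \<in> bcontfun"
    by (rule bcontfun_rep_pairI)
qed

lift_definition family_mult :: "('a::cstar_algebra, 'b::cstar_algebra) rep_family \<Rightarrow> ('a, 'b) rep_family \<Rightarrow> ('a, 'b) rep_family"
  is "\<lambda>F G p. F p * G p"
proof -
  fix F G :: "('a, 'b) rep_pair \<Rightarrow> ('a \<times> 'b) ell2 bop"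
  assume "F \<in> bcontfun" "G \<in> bcontfun"
  then obtain A B where A: "\<And>p. norm (F p) \<le> A" and B: "\<And>p. norm (G p) \<le> B"
    by (auto simp: bcontfun_def bounded_iff)
  have "norm (F p * G p) \<le> A * B" for p
    using A[of p] B[of p] order_trans[OF norm_ge_zero A]
    by (intro order_trans[OF norm_mult_ineq] mult_mono) auto
  then show "(\<lambda>p. F p * G p) \<in> bcontfun" by (rule bcontfun_rep_pairI)
qed

lift_definition family_star :: "('a::cstar_algebra, 'b::cstar_algebra) rep_family \<Rightarrow> ('a, 'b) rep_family"
  is "\<lambda>F p. star (F p)"
proof -
  fix F :: "('a, 'b) rep_pair \<Rightarrow> ('a \<times> 'b) ell2 bop"
  assume "F \<in> bcontfun"
  then obtain A where A: "\<And>p. norm (F p) \<le> A" by (auto simp: bcontfun_def bounded_iff)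
  show "(\<lambda>p. star (F p)) \<in> bcontfun" by (rule bcontfun_rep_pairI[of _ A]) (simp add: A)
qed

lift_definition family_scaleC :: "complex \<Rightarrow> ('a::cstar_algebra, 'b::cstar_algebra) rep_family \<Rightarrow> ('a, 'b) rep_family"
  is "\<lambda>c F p. c *\<^sub>C F p"
proof -
  fix F :: "('a, 'b) rep_pair \<Rightarrow> ('a \<times> 'b) ell2 bop" and c
  assume "F \<in> bcontfun"
  then obtain A where A: "\<And>p. norm (F p) \<le> A" by (auto simp: bcontfun_def bounded_iff)
  show "(\<lambda>p. c *\<^sub>C F p) \<in> bcontfun"
    by (rule bcontfun_rep_pairI[of _ "cmod c * A"]) (simp add: A norm_scaleC mult_left_mono)
qed

lemma bounded_linear_family_mult_left: "bounded_linear (\<lambda>F. family_mult F G)"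
proof (rule bounded_linear_intro)
  fix F
  show "norm (family_mult F G) \<le> norm F * norm G"
    by (rule norm_bound)
       (auto simp: family_mult.rep_eq intro!: order_trans[OF norm_mult_ineq] mult_mono norm_bounded)
qed (auto intro!: bcontfun_eqI simp: family_mult.rep_eq algebra_simps)

lemma bounded_linear_family_mult_right: "bounded_linear (family_mult F)"
proof (rule bounded_linear_intro)
  fix G
  show "norm (family_mult F G) \<le> norm G * norm F"
    by (subst mult.commute, rule norm_bound)
       (auto simp: family_mult.rep_eq intro!: order_trans[OF norm_mult_ineq] mult_mono norm_bounded)
qed (auto intro!: bcontfun_eqI simp: family_mult.rep_eq algebra_simps)

lemma bounded_linear_family_star: "bounded_linear family_star"
proof (rule bounded_linear_intro)
  fix F :: "('a, 'b) rep_family"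
  show "norm (family_star F) \<le> norm F * 1"
    by (rule norm_bound) (auto simp: family_star.rep_eq norm_bounded)
qed (auto intro!: bcontfun_eqI simp: family_star.rep_eq star_add star_scaleR)

lemma bounded_linear_family_scaleC: "bounded_linear (family_scaleC c)"
proof (rule bounded_linear_intro)
  fix F :: "('a, 'b) rep_family"
  show "norm (family_scaleC c F) \<le> norm F * cmod c"
    by (subst mult.commute, rule norm_bound)
       (auto simp: family_scaleC.rep_eq norm_scaleC intro!: mult_left_mono norm_bounded)
qed (auto intro!: bcontfun_eqI simp: family_scaleC.rep_eq scaleC_add_right scaleC_scaleR_commute)

lemma elementary_mult: "family_mult (elementary a b) (elementary a' b') = elementary (a * a') (b * b')"
  by (intro bcontfun_eqI) (simp add: family_mult.rep_eq elementary.rep_eq bop_tensor_mult reps_simps)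

lemma elementary_star: "family_star (elementary a b) = elementary (star a) (star b)"
  by (intro bcontfun_eqI) (simp add: family_star.rep_eq elementary.rep_eq bop_tensor_star reps_simps)

lemma elementary_scaleC_left: "elementary (c *\<^sub>C a) b = family_scaleC c (elementary a b)"
  by (intro bcontfun_eqI)
     (simp add: family_scaleC.rep_eq elementary.rep_eq bop_tensor_scaleC_left reps_simps)

lemma elementary_scaleC_right: "elementary a (c *\<^sub>C b) = family_scaleC c (elementary a b)"
  by (intro bcontfun_eqI)
     (simp add: family_scaleC.rep_eq elementary.rep_eq bop_tensor_scaleC_right reps_simps)

lemma elementary_add_left: "elementary (a + a') b = elementary a b + elementary a' b"
  by (intro bcontfun_eqI) (simp add: elementary.rep_eq bop_tensor_add_left reps_simps)

lemma elementary_add_right: "elementary a (b + b') = elementary a b + elementary a b'"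
  by (intro bcontfun_eqI) (simp add: elementary.rep_eq bop_tensor_add_right reps_simps)

text \<open>The real span of the elementary tensors is a complex subspace, since
  \<open>c (a \<otimes> b) = (c a) \<otimes> b\<close>.\<close>

definition elementary_hull :: "('a::cstar_algebra, 'b::cstar_algebra) rep_family set" where
  "elementary_hull = closure (span (range (\<lambda>(a, b). elementary a b)))"

lemma closed_elementary_hull: "closed elementary_hull"
  by (simp add: elementary_hull_def)

lemma elementary_in_hull: "elementary a b \<in> elementary_hull"
  unfolding elementary_hull_def
  by (rule closure_subset[THEN subsetD], rule span_base) auto

lemma subspace_elementary_hull:
  "subspace (elementary_hull :: ('a::cstar_algebra, 'b::cstar_algebra) rep_family set)"
proof -
  let ?S = "span (range (\<lambda>(a, b). elementary a b)) :: ('a, 'b) rep_family set"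
  show ?thesis
    unfolding subspace_def elementary_hull_def
  proof (intro conjI ballI allI)
    show "0 \<in> closure ?S" by (rule closure_subset[THEN subsetD]) (rule span_zero)
  next
    fix x y assume "x \<in> closure ?S" "y \<in> closure ?S"
    then obtain u v where "\<And>n. u n \<in> ?S" "u \<longlonglongrightarrow> x" "\<And>n. v n \<in> ?S" "v \<longlonglongrightarrow> y"
      unfolding closure_sequential by blast
    then show "x + y \<in> closure ?S"
      unfolding closure_sequential
      by (intro exI[of _ "\<lambda>n. u n + v n"]) (auto intro: span_add tendsto_add)
  next
    fix c :: real and x assume "x \<in> closure ?S"
    then obtain u where "\<And>n. u n \<in> ?S" "u \<longlonglongrightarrow> x"
      unfolding closure_sequential by blast
    then show "c *\<^sub>R x \<in> closure ?S"
      unfolding closure_sequential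
      by (intro exI[of _ "\<lambda>n. c *\<^sub>R u n"]) (auto intro: span_scale tendsto_scaleR)
  qed
qed

lemma elementary_hull_image:
  assumes F: "F \<in> elementary_hull" and h: "bounded_linear h"
    and C: "\<And>a b. h (elementary a b) \<in> C" "closed C" "subspace C"
  shows "h F \<in> C"
proof -
  have "closed (h -` C)"
    using C(2) linear_continuous_on[OF h] by (simp add: closed_vimage)
  moreover have "subspace (h -` C)"
    by (rule linear_subspace_vimage[OF bounded_linear.linear[OF h] C(3)])
  moreover have "range (\<lambda>(a, b). elementary a b) \<subseteq> h -` C"
    using C(1) by auto
  ultimately have "elementary_hull \<subseteq> h -` C"
    unfolding elementary_hull_def by (intro closure_minimal span_minimal)
  then show ?thesis using F by auto
qed

lemma elementary_hull_mult:
  assumes F: "F \<in> elementary_hull" and G: "G \<in> elementary_hull"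
  shows "family_mult F G \<in> elementary_hull"
proof (rule elementary_hull_image[OF F bounded_linear_family_mult_left _ closed_elementary_hull subspace_elementary_hull])
  fix a b
  show "family_mult (elementary a b) G \<in> elementary_hull"
    by (rule elementary_hull_image[OF G bounded_linear_family_mult_right _ closed_elementary_hull subspace_elementary_hull])
       (simp add: elementary_mult elementary_in_hull)
qed

lemma elementary_hull_star: "F \<in> elementary_hull \<Longrightarrow> family_star F \<in> elementary_hull"
  by (rule elementary_hull_image[OF _ bounded_linear_family_star _ closed_elementary_hull subspace_elementary_hull])
     (simp_all add: elementary_star elementary_in_hull)

lemma elementary_hull_scaleC: "F \<in> elementary_hull \<Longrightarrow> family_scaleC c F \<in> elementary_hull"
  by (rule elementary_hull_image[OF _ bounded_linear_family_scaleC _ closed_elementary_hull subspace_elementary_hull])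
     (simp_all add: elementary_scaleC_left[symmetric] elementary_in_hull)

lemma elementary_hull_one_left:
  assumes "F \<in> elementary_hull" shows "family_mult (elementary 1 1) F = F"
proof -
  have "family_mult (elementary 1 1) F - F \<in> {0}"
    by (rule elementary_hull_image[OF assms])
       (auto intro!: bounded_linear_sub bounded_linear_family_mult_right bounded_linear_ident simp: elementary_mult)
  then show ?thesis by simp
qed

lemma elementary_hull_one_right:
  assumes "F \<in> elementary_hull" shows "family_mult F (elementary 1 1) = F"
proof -
  have "family_mult F (elementary 1 1) - F \<in> {0}"
    by (rule elementary_hull_image[OF assms])
       (auto intro!: bounded_linear_sub bounded_linear_family_mult_left bounded_linear_ident simp: elementary_mult)
  then show ?thesis by simp
qed

lifting_forget bcontfun.lifting

typedef (overloaded) ('a, 'b) min_tensor =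
  "elementary_hull :: ('a::cstar_algebra, 'b::cstar_algebra) rep_family set"
  morphisms family Abs_min_tensor
  using elementary_in_hull by blast

setup_lifting type_definition_min_tensor

instantiation min_tensor :: (cstar_algebra, cstar_algebra) complex_vector
begin

lift_definition zero_min_tensor :: "('a, 'b) min_tensor" is 0
  by (rule subspace_0[OF subspace_elementary_hull])
lift_definition plus_min_tensor :: "('a, 'b) min_tensor \<Rightarrow> ('a, 'b) min_tensor \<Rightarrow> ('a, 'b) min_tensor" is "(+)"
  by (rule subspace_add[OF subspace_elementary_hull])
lift_definition minus_min_tensor :: "('a, 'b) min_tensor \<Rightarrow> ('a, 'b) min_tensor \<Rightarrow> ('a, 'b) min_tensor" is "(-)"
  by (rule subspace_diff[OF subspace_elementary_hull])
lift_definition uminus_min_tensor :: "('a, 'b) min_tensor \<Rightarrow> ('a, 'b) min_tensor" is uminus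
  by (rule subspace_neg[OF subspace_elementary_hull])
lift_definition scaleR_min_tensor :: "real \<Rightarrow> ('a, 'b) min_tensor \<Rightarrow> ('a, 'b) min_tensor" is "(*\<^sub>R)"
  by (rule subspace_scale[OF subspace_elementary_hull])
lift_definition scaleC_min_tensor :: "complex \<Rightarrow> ('a, 'b) min_tensor \<Rightarrow> ('a, 'b) min_tensor" is family_scaleC
  by (rule elementary_hull_scaleC)

instance
proof
  fix x y :: "('a, 'b) min_tensor" and c d :: complex and r :: real
  show "c *\<^sub>C (x + y) = c *\<^sub>C x + c *\<^sub>C y"
    by transfer (auto intro!: bcontfun_eqI simp: family_scaleC.rep_eq scaleC_add_right)
  show "(c + d) *\<^sub>C x = c *\<^sub>C x + d *\<^sub>C x"
    by transfer (auto intro!: bcontfun_eqI simp: family_scaleC.rep_eq scaleC_add_left)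
  show "c *\<^sub>C d *\<^sub>C x = (c * d) *\<^sub>C x"
    by transfer (auto intro!: bcontfun_eqI simp: family_scaleC.rep_eq)
  show "1 *\<^sub>C x = x"
    by transfer (auto intro!: bcontfun_eqI simp: family_scaleC.rep_eq)
  show "r *\<^sub>R x = complex_of_real r *\<^sub>C x"
    by transfer (auto intro!: bcontfun_eqI simp: family_scaleC.rep_eq scaleR_scaleC)
qed (transfer, simp add: algebra_simps)+

end

instantiation min_tensor :: (cstar_algebra, cstar_algebra) real_normed_vector
begin

lift_definition norm_min_tensor :: "('a, 'b) min_tensor \<Rightarrow> real" is norm .
definition dist_min_tensor :: "('a, 'b) min_tensor \<Rightarrow> ('a, 'b) min_tensor \<Rightarrow> real" where
  "dist_min_tensor x y = norm (x - y)"
definition sgn_min_tensor :: "('a, 'b) min_tensor \<Rightarrow> ('a, 'b) min_tensor" where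
  "sgn_min_tensor x = x /\<^sub>R norm x"
definition uniformity_min_tensor :: "(('a, 'b) min_tensor \<times> ('a, 'b) min_tensor) filter" where
  "uniformity_min_tensor = (INF e\<in>{0<..}. principal {(x, y). dist x y < e})"
definition open_min_tensor :: "('a, 'b) min_tensor set \<Rightarrow> bool" where
  "open_min_tensor U = (\<forall>x\<in>U. \<forall>\<^sub>F (x', y) in uniformity. x' = x \<longrightarrow> y \<in> U)"

instance
proof
  fix x y :: "('a, 'b) min_tensor" and r :: real
  show "(norm x = 0) = (x = 0)" by transfer simp
  show "norm (x + y) \<le> norm x + norm y" by transfer (rule norm_triangle_ineq)
  show "norm (r *\<^sub>R x) = \<bar>r\<bar> * norm x" by transfer simp
qed (simp_all add: dist_min_tensor_def sgn_min_tensor_def uniformity_min_tensor_def open_min_tensor_def)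

end

instance min_tensor :: (cstar_algebra, cstar_algebra) banach
proof
  fix X :: "nat \<Rightarrow> ('a, 'b) min_tensor"
  assume C: "Cauchy X"
  define Y where "Y n = family (X n)" for n
  have dY: "dist (Y m) (Y n) = dist (X m) (X n)" for m n
    unfolding Y_def by (simp add: dist_min_tensor_def norm_min_tensor.rep_eq minus_min_tensor.rep_eq dist_norm)
  have "Cauchy Y" using C by (simp add: Cauchy_def dY)
  then obtain L where L: "Y \<longlonglongrightarrow> L" using Cauchy_convergent convergent_def by blast
  have "L \<in> elementary_hull"
    by (rule closed_sequentially[OF closed_elementary_hull _ L]) (simp add: Y_def family)
  then have LL: "family (Abs_min_tensor L) = L" by (simp add: Abs_min_tensor_inverse)
  have "dist (X n) (Abs_min_tensor L) = dist (Y n) L" for n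
    unfolding Y_def dist_min_tensor_def norm_min_tensor.rep_eq minus_min_tensor.rep_eq LL by (simp add: dist_norm)
  then have "X \<longlonglongrightarrow> Abs_min_tensor L"
    using L by (simp add: tendsto_iff)
  then show "convergent X" by (auto simp: convergent_def)
qed

instantiation min_tensor :: (cstar_algebra, cstar_algebra) cstar_algebra
begin

lift_definition one_min_tensor :: "('a, 'b) min_tensor" is "elementary 1 1"
  by (rule elementary_in_hull)
lift_definition times_min_tensor :: "('a, 'b) min_tensor \<Rightarrow> ('a, 'b) min_tensor \<Rightarrow> ('a, 'b) min_tensor"
  is family_mult by (rule elementary_hull_mult)
lift_definition star_min_tensor :: "('a, 'b) min_tensor \<Rightarrow> ('a, 'b) min_tensor" is family_star
  by (rule elementary_hull_star)

instance
proof
  fix x y z :: "('a, 'b) min_tensor" and c :: complex and r :: real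
  show "(x * y) * z = x * (y * z)"
    by transfer (auto intro!: bcontfun_eqI simp: family_mult.rep_eq mult.assoc)
  show "1 * x = x" by transfer (rule elementary_hull_one_left)
  show "x * 1 = x" by transfer (rule elementary_hull_one_right)
  show "(x + y) * z = x * z + y * z"
    by transfer (auto intro!: bcontfun_eqI simp: family_mult.rep_eq distrib_right)
  show "x * (y + z) = x * y + x * z"
    by transfer (auto intro!: bcontfun_eqI simp: family_mult.rep_eq distrib_left)
  show "(r *\<^sub>R x) * y = r *\<^sub>R (x * y)"
    by transfer (auto intro!: bcontfun_eqI simp: family_mult.rep_eq)
  show "x * (r *\<^sub>R y) = r *\<^sub>R (x * y)"
    by transfer (auto intro!: bcontfun_eqI simp: family_mult.rep_eq)
  show "(c *\<^sub>C x) * y = c *\<^sub>C (x * y)"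
    by transfer (auto intro!: bcontfun_eqI simp: family_mult.rep_eq family_scaleC.rep_eq mult_scaleC_left)
  show "x * (c *\<^sub>C y) = c *\<^sub>C (x * y)"
    by transfer (auto intro!: bcontfun_eqI simp: family_mult.rep_eq family_scaleC.rep_eq mult_scaleC_right)
  show "norm (x * y) \<le> norm x * norm y"
    by transfer
       (auto simp: family_mult.rep_eq intro!: norm_bound order_trans[OF norm_mult_ineq] mult_mono norm_bounded)
  show "star (star x) = x"
    by transfer (auto intro!: bcontfun_eqI simp: family_star.rep_eq)
  show "star (x + y) = star x + star y"
    by transfer (auto intro!: bcontfun_eqI simp: family_star.rep_eq star_add)
  show "star (c *\<^sub>C x) = cnj c *\<^sub>C star x"
    by transfer (auto intro!: bcontfun_eqI simp: family_star.rep_eq family_scaleC.rep_eq star_scaleC)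
  show "star (x * y) = star y * star x"
    by transfer (auto intro!: bcontfun_eqI simp: family_star.rep_eq family_mult.rep_eq star_mult)
  show "norm (c *\<^sub>C x) = cmod c * norm x"
  proof transfer
    fix c and F :: "('a, 'b) rep_family"
    have le: "norm (family_scaleC d G) \<le> cmod d * norm G" for d and G :: "('a, 'b) rep_family"
      by (rule norm_bound)
         (auto simp: family_scaleC.rep_eq norm_scaleC intro!: mult_left_mono norm_bounded)
    show "norm (family_scaleC c F) = cmod c * norm F"
    proof (cases "c = 0")
      case True
      then show ?thesis using le[of 0 F] by simp
    next
      case False
      have "family_scaleC (inverse c) (family_scaleC c F) = F"
        using False by (intro bcontfun_eqI) (simp add: family_scaleC.rep_eq)
      then have "norm F \<le> cmod (inverse c) * norm (family_scaleC c F)"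
        using le[of "inverse c" "family_scaleC c F"] by simp
      then have "cmod c * norm F \<le> norm (family_scaleC c F)"
        using False by (simp add: norm_inverse norm_divide field_simps)
      then show ?thesis using le[of c F] by simp
    qed
  qed
  show "norm (star x * x) = (norm x)\<^sup>2"
  proof transfer
    fix F :: "('a, 'b) rep_family"
    show "norm (family_mult (family_star F) F) = (norm F)\<^sup>2"
    proof (rule antisym)
      show "norm (family_mult (family_star F) F) \<le> (norm F)\<^sup>2"
        by (rule norm_bound)
           (auto simp: family_mult.rep_eq family_star.rep_eq cstar_identity intro!: power_mono norm_bounded)
      have "norm F \<le> sqrt (norm (family_mult (family_star F) F))"
      proof (rule norm_bound)
        fix p
        have "(norm (apply_bcontfun F p))\<^sup>2 = norm (apply_bcontfun (family_mult (family_star F) F) p)"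
          by (simp add: family_mult.rep_eq family_star.rep_eq cstar_identity)
        also have "\<dots> \<le> norm (family_mult (family_star F) F)" by (rule norm_bounded)
        finally show "norm (apply_bcontfun F p) \<le> sqrt (norm (family_mult (family_star F) F))"
          by (rule real_le_rsqrt)
      qed
      then have "(norm F)\<^sup>2 \<le> (sqrt (norm (family_mult (family_star F) F)))\<^sup>2"
        by (intro power_mono) auto
      then show "(norm F)\<^sup>2 \<le> norm (family_mult (family_star F) F)" by simp
    qed
  qed
qed

end

lift_definition tensor :: "'a::cstar_algebra \<Rightarrow> 'b::cstar_algebra \<Rightarrow> ('a, 'b) min_tensor" (infixr "\<otimes>\<^sub>m" 75)
  is elementary by (rule elementary_in_hull)

lemma tensor_mult: "(a \<otimes>\<^sub>m b) * (a' \<otimes>\<^sub>m b') = (a * a') \<otimes>\<^sub>m (b * b')"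
  by transfer (rule elementary_mult)

lemma tensor_star: "star (a \<otimes>\<^sub>m b) = star a \<otimes>\<^sub>m star b"
  by transfer (rule elementary_star)

lemma tensor_one: "1 \<otimes>\<^sub>m 1 = 1"
  by transfer (rule refl)

lemma tensor_add_left: "(a + a') \<otimes>\<^sub>m b = a \<otimes>\<^sub>m b + a' \<otimes>\<^sub>m b"
  by transfer (rule elementary_add_left)

lemma tensor_add_right: "a \<otimes>\<^sub>m (b + b') = a \<otimes>\<^sub>m b + a \<otimes>\<^sub>m b'"
  by transfer (rule elementary_add_right)

lemma tensor_scaleC_left: "(c *\<^sub>C a) \<otimes>\<^sub>m b = c *\<^sub>C (a \<otimes>\<^sub>m b)"
  by transfer (rule elementary_scaleC_left)

lemma tensor_scaleC_right: "a \<otimes>\<^sub>m (c *\<^sub>C b) = c *\<^sub>C (a \<otimes>\<^sub>m b)"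
  by transfer (rule elementary_scaleC_right)

section \<open>Completely positive maps\<close>

text \<open>An \<open>n \<times> n\<close> matrix over \<open>'a\<close> is a function whose values matter for indices below \<open>n\<close> only.
  Positivity of \<open>X\<close> in the C*-algebra \<open>M\<^sub>n('a)\<close> means \<open>X = Y\<^sup>* Y\<close> for some \<open>Y\<close>.\<close>

definition matrix_positive :: "nat \<Rightarrow> (nat \<Rightarrow> nat \<Rightarrow> 'a::cstar_algebra) \<Rightarrow> bool" where
  "matrix_positive n X \<longleftrightarrow> (\<exists>Y. \<forall>i<n. \<forall>j<n. X i j = (\<Sum>k<n. star (Y k i) * Y k j))"

definition completely_positive :: "('a::cstar_algebra \<Rightarrow> 'b::cstar_algebra) \<Rightarrow> bool" where
  "completely_positive \<phi> \<longleftrightarrow>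
    clinear \<phi> \<and> (\<forall>n X. matrix_positive n X \<longrightarrow> matrix_positive n (\<lambda>i j. \<phi> (X i j)))"

definition dominates :: "('a::cstar_algebra \<Rightarrow> 'b::cstar_algebra) \<Rightarrow> ('a \<Rightarrow> 'b) \<Rightarrow> bool" where
  "dominates \<alpha> \<gamma> \<longleftrightarrow> completely_positive (\<lambda>x. \<alpha> x - \<gamma> x)"

definition pure_cp :: "('a::cstar_algebra \<Rightarrow> 'h::complex_hilbert bop) \<Rightarrow> bool" where
  "pure_cp \<alpha> \<longleftrightarrow> completely_positive \<alpha> \<and>
    (\<forall>\<gamma>. completely_positive \<gamma> \<and> dominates \<alpha> \<gamma> \<longrightarrow> (\<exists>c::real. c \<ge> 0 \<and> \<gamma> = (\<lambda>x. c *\<^sub>R \<alpha> x)))"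

text \<open>\<open>\<Phi>\<close> is the tensor product \<open>\<phi>\<^sub>1 \<otimes> \<phi>\<^sub>2\<close>: the completely positive map determined by its values on
  elementary tensors. For completely positive \<open>\<phi>\<^sub>1\<close> and \<open>\<phi>\<^sub>2\<close> there is exactly one such \<open>\<Phi>\<close>
  (uniqueness because completely positive maps are bounded and elementary tensors span densely).\<close>

definition is_cp_tensor ::
  "('a::cstar_algebra \<Rightarrow> 'h::complex_hilbert bop) \<Rightarrow> ('b::cstar_algebra \<Rightarrow> 'k::complex_hilbert bop) \<Rightarrow>
    (('a, 'b) min_tensor \<Rightarrow> ('h bop, 'k bop) min_tensor) \<Rightarrow> bool" where
  "is_cp_tensor \<phi>\<^sub>1 \<phi>\<^sub>2 \<Phi> \<longleftrightarrow>
    completely_positive \<Phi> \<and> (\<forall>a b. \<Phi> (a \<otimes>\<^sub>m b) = \<phi>\<^sub>1 a \<otimes>\<^sub>m \<phi>\<^sub>2 b)"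

end

theory Submission
  imports Defs
begin

text \<open>
  For \<open>a = d\<^sup>* d\<close> and a vector \<open>\<xi>\<close>, slicing with the vector functional of \<open>\<xi>\<close> gives a completely positive map
  \<open>b \<mapsto> (\<omega>\<^sub>\<xi> \<otimes> id) \<beta>(a \<otimes> b)\<close> that is dominated by \<open>\<langle>\<xi>, \<alpha>\<^sub>1(a) \<xi>\<rangle> \<alpha>\<^sub>2\<close>. Purity of \<open>\<alpha>\<^sub>2\<close> makes it \<open>c(\<xi>, a) \<alpha>\<^sub>2\<close>.
  If \<open>\<alpha>\<^sub>2 \<noteq> 0\<close>, pick \<open>e\<close> and \<open>\<eta>\<close> with \<open>k = \<langle>\<eta>, \<alpha>\<^sub>2(e\<^sup>* e) \<eta>\<rangle> > 0\<close>; then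
  \<open>\<beta>\<^sub>1(a) = (id \<otimes> \<omega>\<^sub>\<eta>) \<beta>(a \<otimes> e\<^sup>* e) / k\<close> satisfies \<open>\<langle>\<xi>, \<beta>\<^sub>1(a) \<xi>\<rangle> = c(\<xi>, a)\<close>, so \<open>\<beta>(a \<otimes> b)\<close> and
  \<open>\<beta>\<^sub>1(a) \<otimes> \<alpha>\<^sub>2(b)\<close> have the same slices, and slices separate the points of the minimal tensor product.
  Slices are completely positive because a matrix over \<open>B(H)\<close> with a positive quadratic form on \<open>H\<^sup>n\<close> has
  a square root in \<open>M\<^sub>n(B(H))\<close>.
\<close>

section \<open>Positive matrices over \<open>B(H)\<close>\<close>

text \<open>Absolute convergence of the binomial series of \<open>sqrt (1 - t)\<close> at \<open>t = 1\<close>; the square root lemma for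
  C*-algebras needs norm strictly below \<open>1\<close> and would only cover positive matrices bounded away from \<open>0\<close>.\<close>

lemma summable_gbinomial_half: "summable (\<lambda>m. \<bar>(1/2::real) gchoose m\<bar>)"
proof (rule summableI_nonneg_bounded[where x=2])
  fix n
  define a where "a m = ((1/2::real) gchoose m) * (-1) ^ m" for m
  \<comment> \<open>As a rising factorial starting at -1/2, the coefficient has exactly one negative
    factor, namely the first.\<close>
  have sgn: "a (Suc m) \<le> 0" for m
  proof -
    have "a (Suc m) = pochhammer (-(1/2)) (Suc m) / fact (Suc m)"
      unfolding a_def by (simp only: gbinomial_pochhammer) (simp add: power_add[symmetric] field_simps)
    also have "\<dots> = - (1/2) * pochhammer (1/2) m / fact (Suc m)"
      by (simp add: pochhammer_rec)
    also have "\<dots> \<le> 0" by (simp add: divide_le_0_iff pochhammer_nonneg)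
    finally show ?thesis .
  qed
  \<comment> \<open>The alternating sum of the binomials of 1/2 collapses to one signed binomial of
    -1/2, which is a rising factorial of 1/2 and so nonnegative.\<close>
  have part: "(\<Sum>m\<le>n. a m) \<ge> 0" for n
  proof -
    have "(\<Sum>m\<le>n. a m) = pochhammer (1/2) n / fact n"
      unfolding a_def gbinomial_sum_lower_neg
      by (simp only: gbinomial_pochhammer) (simp add: power_add[symmetric] field_simps)
    then show ?thesis by (simp add: pochhammer_nonneg)
  qed
  \<comment> \<open>All terms except \<open>a 0 = 1\<close> are nonpositive, so the absolute value
    is \<open>- a m\<close>; the summand 2 repairs the case \<open>m = 0\<close>. It is also the
    bound on the partial sums.\<close>
  have abs: "\<bar>(1/2::real) gchoose m\<bar> = (if m = 0 then 2 else 0) - a m" for m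
  proof (cases m)
    case (Suc k)
    have "\<bar>(1/2::real) gchoose m\<bar> = \<bar>a m\<bar>" by (simp add: a_def abs_mult power_abs)
    then show ?thesis using sgn[of k] Suc by simp
  qed (simp add: a_def)
  have "(\<Sum>m<n. \<bar>(1/2::real) gchoose m\<bar>) \<le> (\<Sum>m\<le>n. \<bar>(1/2::real) gchoose m\<bar>)"
    by (rule sum_mono2) auto
  also have "\<dots> = 2 - (\<Sum>m\<le>n. a m)"
    by (simp add: abs sum_subtractf)
  finally show "(\<Sum>m<n. \<bar>(1/2::real) gchoose m\<bar>) \<le> 2" using part[of n] by simp
qed simp

section \<open>Powers and square roots of matrices over a C*-algebra\<close>

primrec mat_pow :: "nat \<Rightarrow> (nat \<Rightarrow> nat \<Rightarrow> 'a::cstar_algebra) \<Rightarrow> nat \<Rightarrow> nat \<Rightarrow> nat \<Rightarrow> 'a" where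
  "mat_pow n A 0 = (\<lambda>i j. if i = j then 1 else 0)"
| "mat_pow n A (Suc m) = (\<lambda>i j. \<Sum>k<n. A i k * mat_pow n A m k j)"

lemma mat_pow_add:
  "i < n \<Longrightarrow> mat_pow n A (p + q) i j = (\<Sum>k<n. mat_pow n A p i k * mat_pow n A q k j)"
proof (induction p arbitrary: i)
  case 0
  have "(\<Sum>k<n. (if i = k then 1 else 0) * mat_pow n A q k j) = (\<Sum>k<n. if i = k then mat_pow n A q k j else 0)"
    by (rule sum.cong) auto
  then show ?case using 0 by simp
next
  case (Suc p)
  have "mat_pow n A (Suc p + q) i j = (\<Sum>k<n. \<Sum>l<n. A i k * mat_pow n A p k l * mat_pow n A q l j)"
    by (simp add: Suc.IH sum_distrib_left mult.assoc)
  also have "\<dots> = (\<Sum>l<n. \<Sum>k<n. A i k * mat_pow n A p k l * mat_pow n A q l j)"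
    by (rule sum.swap)
  finally show ?case by (simp add: sum_distrib_right)
qed

lemma star_sum: "star (\<Sum>k\<in>K. f k) = (\<Sum>k\<in>K. star (f k))" for f :: "'i \<Rightarrow> 'a::cstar_algebra"
  by (induction K rule: infinite_finite_induct) (simp_all add: star_add)

lemma mat_pow_1: "j < n \<Longrightarrow> mat_pow n A (Suc 0) i j = A i j"
proof -
  assume "j < n"
  have "(\<Sum>k<n. A i k * (if k = j then 1 else 0)) = (\<Sum>k<n. if k = j then A i k else 0)"
    by (rule sum.cong) auto
  then show ?thesis using \<open>j < n\<close> by simp
qed

lemma star_mat_pow:
  assumes herm: "\<And>i j. i < n \<Longrightarrow> j < n \<Longrightarrow> star (A i j) = A j i"
  shows "i < n \<Longrightarrow> j < n \<Longrightarrow> star (mat_pow n A m i j) = mat_pow n A m j i"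
proof (induction m arbitrary: i j)
  case (Suc m)
  \<comment> \<open>The involution reverses products and moves \<open>A\<close> to the right, while
    the recursion of \<open>mat_pow\<close> multiplies on the left. Writing \<open>A\<close> as a
    first power lets \<open>mat_pow_add\<close> regroup the product.\<close>
  have "star (mat_pow n A (Suc m) i j) = (\<Sum>k<n. mat_pow n A m j k * mat_pow n A (Suc 0) k i)"
    unfolding mat_pow.simps(2)[of n A m] star_sum star_mult
    using Suc by (intro sum.cong refl) (simp add: herm mat_pow_1 del: mat_pow.simps)
  also have "\<dots> = mat_pow n A (m + Suc 0) j i" using Suc.prems by (rule_tac mat_pow_add[symmetric])
  finally show ?case by simp
qed auto

text \<open>\<open>C\<close> is the binomial series of sqrt (1 - t) evaluated at \<open>A\<close>
  entry by entry. Its coefficients are absolutely summable, so bounded powers suffice for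
  convergence. Bounding the entries of the powers avoids introducing a norm on matrices.\<close>

lemma matrix_sqrt_one_minus:
  fixes A :: "nat \<Rightarrow> nat \<Rightarrow> 'a::cstar_algebra"
  assumes herm: "\<And>i j. i < n \<Longrightarrow> j < n \<Longrightarrow> star (A i j) = A j i"
    and bd: "\<And>m i j. i < n \<Longrightarrow> j < n \<Longrightarrow> norm (mat_pow n A m i j) \<le> K"
  shows "\<exists>C. \<forall>i<n. \<forall>j<n. star (C i j) = C j i \<and>
    (\<Sum>k<n. C i k * C k j) = (if i = j then 1 else 0) - A i j"
proof -
  define a where "a m = ((1/2::real) gchoose m) * (-1) ^ m" for m
  define t where "t m i j = a m *\<^sub>R mat_pow n A m i j" for m i j
  define C where "C i j = (\<Sum>m. t m i j)" for i j
  have sum_t: "summable (\<lambda>m. norm (t m i j))" if "i < n" "j < n" for i j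
  proof (rule summable_comparison_test)
    show "summable (\<lambda>m. \<bar>(1/2::real) gchoose m\<bar> * K)"
      by (intro summable_mult2 summable_gbinomial_half)
    show "\<exists>N. \<forall>m\<ge>N. norm (norm (t m i j)) \<le> \<bar>(1/2::real) gchoose m\<bar> * K"
      using bd[OF that] by (auto simp: t_def a_def abs_mult power_abs intro!: mult_left_mono)
  qed
  have star_C: "star (C i j) = C j i" if ij: "i < n" "j < n" for i j
  proof -
    have "star (C i j) = (\<Sum>m. star (t m i j))"
      unfolding C_def using bounded_linear.suminf[OF bounded_linear_star summable_norm_cancel[OF sum_t[OF ij]]] .
    also have "(\<lambda>m. star (t m i j)) = (\<lambda>m. t m j i)"
      using ij by (auto simp: t_def star_scaleR star_mat_pow[OF herm])
    finally show ?thesis by (simp add: C_def)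
  qed
  \<comment> \<open>By Vandermonde, the convolution of the coefficients with themselves yields the
    coefficients of 1 - t: the formal series squares to 1 - t.\<close>
  have conv: "(\<Sum>l\<le>p. a l * a (p - l)) = (if p = 0 then 1 else if p = 1 then - 1 else 0)" for p
  proof -
    have "(\<Sum>l\<le>p. a l * a (p - l))
        = (\<Sum>l\<in>{0..p}. ((1/2::real) gchoose l) * ((1/2) gchoose (p - l))) * (-1) ^ p"
      unfolding sum_distrib_right
      by (rule sum.cong) (auto simp: a_def atLeast0AtMost power_add[symmetric] algebra_simps)
    also have "\<dots> = ((1::real) gchoose p) * (-1) ^ p"
      by (simp add: gbinomial_Vandermonde)
    also have "(1::real) gchoose p = of_nat (1 choose p)"
      using binomial_gbinomial[of 1 p, where 'a=real] by simp
    also have "of_nat (1 choose p) * (-1) ^ p = (if p = 0 then 1 else if p = 1 then - 1 else (0::real))"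
      by (cases p) (auto simp: binomial_eq_0)
    finally show ?thesis .
  qed
  have sq: "(\<Sum>k<n. C i k * C k j) = (if i = j then 1 else 0) - A i j" if ij: "i < n" "j < n" for i j
  proof -
    have "(\<lambda>p. \<Sum>k<n. \<Sum>l\<le>p. t l i k * t (p - l) k j) sums (\<Sum>k<n. C i k * C k j)"
      unfolding C_def by (intro sums_sum Cauchy_product_sums sum_t) (use ij in auto)
    moreover have "(\<Sum>k<n. \<Sum>l\<le>p. t l i k * t (p - l) k j)
        = (if p = 0 then 1 else if p = 1 then - 1 else 0) *\<^sub>R mat_pow n A p i j" for p
    proof -
      have "(\<Sum>k<n. \<Sum>l\<le>p. t l i k * t (p - l) k j) = (\<Sum>l\<le>p. \<Sum>k<n. t l i k * t (p - l) k j)"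
        by (rule sum.swap)
      also have "\<dots> = (\<Sum>l\<le>p. (a l * a (p - l)) *\<^sub>R mat_pow n A p i j)"
      proof (rule sum.cong)
        fix l assume "l \<in> {..p}"
        then have "(\<Sum>k<n. mat_pow n A l i k * mat_pow n A (p - l) k j) = mat_pow n A p i j"
          using mat_pow_add[OF ij(1), of A l "p - l" j] by simp
        then show "(\<Sum>k<n. t l i k * t (p - l) k j) = (a l * a (p - l)) *\<^sub>R mat_pow n A p i j"
          by (simp add: t_def scaleR_sum_right[symmetric] mult.commute)
      qed simp
      finally show ?thesis by (simp only: scaleR_sum_left[symmetric] conv)
    qed
    ultimately have "(\<lambda>p. (if p = 0 then 1 else if p = 1 then - 1 else 0) *\<^sub>R mat_pow n A p i j)
        sums (\<Sum>k<n. C i k * C k j)" by simp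
    moreover have "(\<lambda>p. (if p = 0 then 1 else if p = 1 then - 1 else 0) *\<^sub>R mat_pow n A p i j) sums
        (\<Sum>p\<in>{0,Suc 0}. (if p = 0 then 1 else if p = 1 then - 1 else 0) *\<^sub>R mat_pow n A p i j)"
      by (rule sums_finite) auto
    ultimately have "(\<Sum>k<n. C i k * C k j)
        = (\<Sum>p\<in>{0,Suc 0}. (if p = 0 then 1 else if p = 1 then - 1 else 0) *\<^sub>R mat_pow n A p i j)"
      by (rule sums_unique2)
    also have "\<dots> = (if i = j then 1 else 0) - A i j"
      using mat_pow_1[OF ij(2), of A i] by simp
    finally show ?thesis .
  qed
  show ?thesis using star_C sq by blast
qed

section \<open>Matrices over \<open>B(H)\<close> acting on tuples of vectors\<close>

lemma bop_apply_sum: "(\<Sum>k\<in>K. f k) \<bullet>\<^sub>o x = (\<Sum>k\<in>K. f k \<bullet>\<^sub>o x)"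
  by (induction K rule: infinite_finite_induct) (simp_all add: bop_apply_plus)

lemma cinner_sum_right: "cinner x (\<Sum>k\<in>K. f k) = (\<Sum>k\<in>K. cinner x (f k))"
  by (induction K rule: infinite_finite_induct) (simp_all add: cinner_add_right)

lemma cinner_sum_left: "cinner (\<Sum>k\<in>K. f k) x = (\<Sum>k\<in>K. cinner (f k) x)"
  by (induction K rule: infinite_finite_induct) (simp_all add: cinner_add_left)

lemma bop_apply_sum_right: "T \<bullet>\<^sub>o (\<Sum>k\<in>K. f k) = (\<Sum>k\<in>K. T \<bullet>\<^sub>o f k)"
  by (induction K rule: infinite_finite_induct) (simp_all add: bop_apply_add)

lemma matrix_positive_scaleR:
  assumes "matrix_positive n X" "0 \<le> r"
  shows "matrix_positive n (\<lambda>i j. r *\<^sub>R X i j)"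
proof -
  obtain Y where Y: "\<forall>i<n. \<forall>j<n. X i j = (\<Sum>k<n. star (Y k i) * Y k j)"
    using assms(1) by (auto simp: matrix_positive_def)
  show ?thesis
    unfolding matrix_positive_def
    by (rule exI[of _ "\<lambda>k i. sqrt r *\<^sub>R Y k i"])
       (use Y assms(2) in \<open>simp add: star_scaleR scaleR_sum_right\<close>)
qed

text \<open>Since \<open>X \<le> r\<close>, the matrix \<open>A = 1 - X / r\<close> is a contraction on \<open>H\<^sup>n\<close>, and \<open>X = r (1 - A)\<close>.\<close>

lemma matrix_positive_bopI:
  fixes X :: "nat \<Rightarrow> nat \<Rightarrow> 'h::complex_hilbert bop"
  assumes herm: "\<And>i j. i < n \<Longrightarrow> j < n \<Longrightarrow> star (X i j) = X j i"
    and pos: "\<And>x. 0 \<le> Re (\<Sum>i<n. \<Sum>j<n. cinner (x i) (X i j \<bullet>\<^sub>o x j))"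
  shows "matrix_positive n X"
proof -
  \<comment> \<open>Instead of a type for the n-fold direct sum of H, tuples are functions on
    indices below \<open>n\<close>: \<open>ap\<close> is the action of a matrix, \<open>ip\<close>
    the inner product and \<open>sq\<close> the squared norm.\<close>
  define ap where "ap M x i = (\<Sum>j<n. M i j \<bullet>\<^sub>o x j)" for M :: "nat \<Rightarrow> nat \<Rightarrow> 'h bop" and x i
  define ip where "ip x y = (\<Sum>i<n. cinner (x i) (y i))" for x y :: "nat \<Rightarrow> 'h"
  define sq where "sq x = (\<Sum>i<n. (norm (x i))\<^sup>2)" for x :: "nat \<Rightarrow> 'h"
  \<comment> \<open>The sum of the entry norms bounds the quadratic form of \<open>X\<close>; adding
    1 keeps \<open>r\<close> positive even for \<open>X = 0\<close>.\<close>
  define r where "r = 1 + (\<Sum>i<n. \<Sum>j<n. norm (X i j))"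
  have r: "r > 0" unfolding r_def by (intro add_pos_nonneg sum_nonneg) auto
  have sq0: "0 \<le> sq x" for x by (simp add: sq_def sum_nonneg)
  have sq_ip: "ip x x = of_real (sq x)" for x
    by (simp add: ip_def sq_def cinner_self)
  have pos': "0 \<le> Re (ip x (ap X x))" for x
    using pos[of x] by (simp add: ip_def ap_def cinner_sum_right)
  have ipX: "Re (ip x (ap X y)) = Re (ip y (ap X x))" for x y
  proof -
    have "ip x (ap X y) = (\<Sum>i<n. \<Sum>j<n. cinner (X j i \<bullet>\<^sub>o x i) (y j))"
      unfolding ip_def ap_def cinner_sum_right
      by (intro sum.cong refl) (metis herm lessThan_iff cinner_star_left)
    also have "\<dots> = (\<Sum>j<n. \<Sum>i<n. cinner (X j i \<bullet>\<^sub>o x i) (y j))"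
      by (rule sum.swap)
    also have "\<dots> = (\<Sum>j<n. \<Sum>i<n. cnj (cinner (y j) (X j i \<bullet>\<^sub>o x i)))"
      by (intro sum.cong refl cinner_commute)
    also have "\<dots> = cnj (ip y (ap X x))"
      by (simp add: ip_def ap_def cinner_sum_right)
    finally show ?thesis by simp
  qed
  have upper: "Re (ip x (ap X x)) \<le> r * sq x" for x
  proof -
    have x_le: "norm (x i) \<le> sqrt (sq x)" if "i < n" for i
      unfolding sq_def using that
      by (intro real_le_rsqrt member_le_sum[of i "{..<n}" "\<lambda>i. (norm (x i))\<^sup>2"]) auto
    have "Re (ip x (ap X x)) \<le> cmod (ip x (ap X x))" by (rule complex_Re_le_cmod)
    also have "\<dots> \<le> (\<Sum>i<n. \<Sum>j<n. cmod (cinner (x i) (X i j \<bullet>\<^sub>o x j)))"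
      unfolding ip_def ap_def cinner_sum_right
      by (intro order_trans[OF norm_sum] sum_mono order_refl)
    also have "\<dots> \<le> (\<Sum>i<n. \<Sum>j<n. norm (X i j) * sq x)"
    proof (intro sum_mono)
      fix i j assume ij: "i \<in> {..<n}" "j \<in> {..<n}"
      have "cmod (cinner (x i) (X i j \<bullet>\<^sub>o x j)) \<le> norm (x i) * norm (X i j \<bullet>\<^sub>o x j)"
        by (rule cinner_Cauchy_Schwarz)
      also have "\<dots> \<le> norm (x i) * (norm (X i j) * norm (x j))"
        by (intro mult_left_mono norm_bop_apply) auto
      also have "\<dots> \<le> sqrt (sq x) * (norm (X i j) * sqrt (sq x))"
        using ij by (intro mult_mono x_le mult_left_mono mult_nonneg_nonneg) (auto simp: sq0)
      also have "\<dots> = norm (X i j) * (sqrt (sq x) * sqrt (sq x))" by (simp only: mult_ac)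
      finally show "cmod (cinner (x i) (X i j \<bullet>\<^sub>o x j)) \<le> norm (X i j) * sq x"
        using sq0[of x] by simp
    qed
    also have "\<dots> = (r - 1) * sq x" by (simp add: r_def sum_distrib_right)
    also have "\<dots> \<le> r * sq x" using sq0[of x] by (intro mult_right_mono) auto
    finally show ?thesis .
  qed
  have ip_diff: "Re (ip (\<lambda>i. x i - s *\<^sub>R y i) (\<lambda>i. u i - s *\<^sub>R v i))
      = Re (ip x u) - s * Re (ip x v) - s * Re (ip y u) + s\<^sup>2 * Re (ip y v)" for x y u v s
    by (simp add: ip_def cinner_diff_left cinner_diff_right scaleR_scaleC cinner_scaleC_left
        cinner_scaleC_right sum_subtractf sum.distrib sum_distrib_left algebra_simps power2_eq_square)
  \<comment> \<open>This is the operator inequality "X squared is at most r X", obtained without a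
    root of \<open>X\<close>: evaluate the positive form at x - X x / r and bound the form at X x by
    \<open>upper\<close>.\<close>
  have X_sq: "sq (ap X x) \<le> r * Re (ip x (ap X x))" for x
  proof -
    let ?y = "ap X x"
    have "ap X (\<lambda>i. u i - s *\<^sub>R v i) = (\<lambda>i. ap X u i - s *\<^sub>R ap X v i)" for u v s
      unfolding ap_def
      by (rule ext) (simp add: bop_apply_diff linear_scale[OF bounded_linear.linear[OF bounded_linear_bop_apply]]
          sum_subtractf scaleR_sum_right)
    then have "0 \<le> Re (ip x ?y) - (1/r) * Re (ip x (ap X ?y)) - (1/r) * Re (ip ?y ?y) + (1/r)\<^sup>2 * Re (ip ?y (ap X ?y))"
      using pos'[of "\<lambda>i. x i - (1/r) *\<^sub>R ?y i"] by (simp only: ip_diff)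
    also have "\<dots> \<le> Re (ip x ?y) - (1/r) * sq ?y - (1/r) * sq ?y + (1/r)\<^sup>2 * (r * sq ?y)"
      using ipX[of x ?y] upper[of ?y] r by (auto simp: sq_ip intro!: mult_left_mono)
    also have "\<dots> = Re (ip x ?y) - (1/r) * sq ?y"
      using r by (simp add: power2_eq_square)
    finally show ?thesis using r by (simp add: field_simps)
  qed
  define A where "A i j = (if i = j then 1 else 0) - (1/r) *\<^sub>R X i j" for i j
  have ap_A: "ap A x i = x i - (1/r) *\<^sub>R ap X x i" if "i < n" for x i
  proof -
    have "(\<Sum>j<n. (if i = j then 1 else 0) \<bullet>\<^sub>o x j) = (\<Sum>j<n. if i = j then x j else 0)"
      by (rule sum.cong) auto
    then show ?thesis
      using that by (simp add: ap_def A_def bop_apply_minus bop_apply_scaleR_left sum_subtractf scaleR_sum_right)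
  qed
  \<comment> \<open>In the expansion of the squared norm of x - X x / r, \<open>X_sq\<close> absorbs
    the quadratic term into half of the linear one.\<close>
  have contr: "sq (ap A x) \<le> sq x" for x
  proof -
    have "complex_of_real (sq (ap A x)) = ip (\<lambda>i. x i - (1/r) *\<^sub>R ap X x i) (\<lambda>i. x i - (1/r) *\<^sub>R ap X x i)"
      unfolding sq_ip[symmetric] by (auto simp: ip_def ap_A)
    then have "sq (ap A x) = Re (ip (\<lambda>i. x i - (1/r) *\<^sub>R ap X x i) (\<lambda>i. x i - (1/r) *\<^sub>R ap X x i))"
      by (metis Re_complex_of_real)
    also have "\<dots> = sq x - (1/r) * Re (ip x (ap X x)) - (1/r) * Re (ip (ap X x) x) + (1/r)\<^sup>2 * sq (ap X x)"
      unfolding ip_diff by (simp add: sq_ip)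
    also have "Re (ip (ap X x) x) = Re (ip x (ap X x))"
      unfolding ip_def by (simp, intro sum.cong refl) (metis cinner_commute cnj.sel(1))
    also have "(1/r)\<^sup>2 * sq (ap X x) \<le> (1/r)\<^sup>2 * (r * Re (ip x (ap X x)))"
      by (intro mult_left_mono X_sq) auto
    also have "sq x - (1/r) * Re (ip x (ap X x)) - (1/r) * Re (ip x (ap X x)) + (1/r)\<^sup>2 * (r * Re (ip x (ap X x)))
        = sq x - (1/r) * Re (ip x (ap X x))"
      using r by (simp add: power2_eq_square)
    also have "\<dots> \<le> sq x" using r pos'[of x] by simp
    finally show ?thesis by simp
  qed
  have ap_pow: "ap (mat_pow n A (Suc m)) x = ap A (ap (mat_pow n A m) x)" for m x
  proof
    fix i
    have "ap (mat_pow n A (Suc m)) x i = (\<Sum>j<n. \<Sum>k<n. A i k \<bullet>\<^sub>o mat_pow n A m k j \<bullet>\<^sub>o x j)"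
      by (simp add: ap_def bop_apply_sum bop_apply_times)
    also have "\<dots> = (\<Sum>k<n. \<Sum>j<n. A i k \<bullet>\<^sub>o mat_pow n A m k j \<bullet>\<^sub>o x j)" by (rule sum.swap)
    finally show "ap (mat_pow n A (Suc m)) x i = ap A (ap (mat_pow n A m) x) i"
      by (simp add: ap_def bop_apply_sum_right)
  qed
  have pow_contr: "sq (ap (mat_pow n A m) x) \<le> sq x" for m x
  proof (induction m)
    case 0
    have "ap (mat_pow n A 0) x i = x i" if "i < n" for i
    proof -
      have "ap (mat_pow n A 0) x i = (\<Sum>j<n. if i = j then x j else 0)"
        unfolding ap_def by (rule sum.cong) auto
      then show ?thesis using that by simp
    qed
    then show ?case by (simp add: sq_def)
  next
    case (Suc m)
    show ?case unfolding ap_pow using contr Suc order_trans by blast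
  qed
  have bd: "norm (mat_pow n A m i j) \<le> 1" if ij: "i < n" "j < n" for m i j
  proof (rule norm_bop_bound)
    fix x :: 'h
    \<comment> \<open>The tuple with \<open>x\<close> in slot \<open>j\<close> and 0 elsewhere turns
      the bound on tuples into a bound on the entry with indices \<open>i\<close> and
      \<open>j\<close>.\<close>
    define e where "e k = (if k = j then x else 0)" for k
    have "ap (mat_pow n A m) e i = (\<Sum>k<n. if k = j then mat_pow n A m i k \<bullet>\<^sub>o x else 0)"
      unfolding ap_def e_def by (rule sum.cong) auto
    then have *: "ap (mat_pow n A m) e i = mat_pow n A m i j \<bullet>\<^sub>o x" using ij by simp
    have "sq e = (\<Sum>k<n. if k = j then (norm x)\<^sup>2 else 0)"
      unfolding sq_def e_def by (rule sum.cong) auto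
    then have sq_e: "sq e = (norm x)\<^sup>2" using ij by simp
    have "(norm (mat_pow n A m i j \<bullet>\<^sub>o x))\<^sup>2 \<le> sq (ap (mat_pow n A m) e)"
      unfolding sq_def *[symmetric] using ij
      by (intro member_le_sum[of i "{..<n}" "\<lambda>i. (norm (ap (mat_pow n A m) e i))\<^sup>2"]) auto
    also have "\<dots> \<le> (norm x)\<^sup>2" using pow_contr[of m e] sq_e by simp
    finally have "norm (mat_pow n A m i j \<bullet>\<^sub>o x) \<le> norm x" by (rule power2_le_imp_le) simp
    then show "norm (mat_pow n A m i j \<bullet>\<^sub>o x) \<le> 1 * norm x" by simp
  qed simp
  have hermA: "star (A i j) = A j i" if "i < n" "j < n" for i j
    using that by (simp add: A_def star_diff star_scaleR herm)
  obtain C where C: "\<forall>i<n. \<forall>j<n. star (C i j) = C j i \<and> (\<Sum>k<n. C i k * C k j) = (if i = j then 1 else 0) - A i j"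
    using matrix_sqrt_one_minus[OF hermA bd] by blast
  \<comment> \<open>Since \<open>C\<close> is selfadjoint, its square 1 - A, which is X / r, is also
    its adjoint times \<open>C\<close>.\<close>
  have "matrix_positive n (\<lambda>i j. (1/r) *\<^sub>R X i j)"
    unfolding matrix_positive_def
    by (rule exI[of _ C]) (use C in \<open>auto simp: A_def\<close>)
  from matrix_positive_scaleR[OF this, of r] show ?thesis using r by simp
qed

section \<open>Adjoints\<close>

text \<open>Maps between different spaces are needed below, for instance isometries and their
  adjoints, whereas \<open>bop\<close> only has operators on one space.\<close>

definition bounded_clinear ::
  "('a::{complex_vector,real_normed_vector} \<Rightarrow> 'b::{complex_vector,real_normed_vector}) \<Rightarrow> bool" where
  "bounded_clinear f \<longleftrightarrow> bounded_linear f \<and> (\<forall>c x. f (c *\<^sub>C x) = c *\<^sub>C f x)"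

lemma bounded_clinearD:
  assumes "bounded_clinear f"
  shows "f (x + y) = f x + f y" "f (c *\<^sub>C x) = c *\<^sub>C f x" "bounded_linear f"
  using assms by (auto simp: bounded_clinear_def linear_add bounded_linear.linear)

lemma bounded_clinearI:
  assumes "\<And>x y. f (x + y) = f x + f y" "\<And>c x. f (c *\<^sub>C x) = c *\<^sub>C f x" "\<And>x. norm (f x) \<le> K * norm x"
  shows "bounded_clinear f"
  unfolding bounded_clinear_def using assms(2)
  by (auto intro!: bounded_linear_intro[where K=K] simp: assms scaleR_scaleC mult.commute[of "norm _" K])

lemma bounded_clinear_compose:
  "bounded_clinear f \<Longrightarrow> bounded_clinear g \<Longrightarrow> bounded_clinear (\<lambda>x. f (g x))"
  unfolding bounded_clinear_def using bounded_linear_compose[of f g] by auto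

lemma bounded_clinear_bop: "bounded_clinear ((\<bullet>\<^sub>o) T)"
  by (simp add: bounded_clinear_def bounded_linear_bop_apply bop_apply_scaleC)

text \<open>Riesz representation is applied to the functional y -> <x, A y> for each x; inserting y
  = f x bounds the representing vector f x by the bound of \<open>A\<close>.\<close>

lemma adjoint_exists:
  fixes A :: "'h::complex_hilbert \<Rightarrow> 'l::complex_hilbert"
  assumes A: "bounded_clinear A"
  shows "\<exists>B. bounded_clinear B \<and> (\<forall>x y. cinner x (A y) = cinner (B x) y)"
proof -
  have "\<exists>u. \<forall>y. cinner x (A y) = cinner u y" for x
    by (rule Riesz_representation)
       (auto intro: bounded_linear_compose[OF bounded_linear_cinner_right] bounded_clinearD[OF A]
         simp: bounded_clinearD[OF A] cinner_scaleC_right)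
  then obtain f where f: "\<And>x y. cinner x (A y) = cinner (f x) y" by metis
  obtain K where K: "\<And>x. norm (A x) \<le> norm x * K" "K \<ge> 0"
    using bounded_linear.nonneg_bounded[OF bounded_clinearD(3)[OF A]] by metis
  have bd: "norm (f x) \<le> K * norm x" for x
  proof (cases "f x = 0")
    case False
    have "(norm (f x))\<^sup>2 = cmod (cinner (f x) (f x))" by (simp add: cinner_self norm_power)
    also have "\<dots> = cmod (cinner x (A (f x)))" by (simp add: f)
    also have "\<dots> \<le> norm x * norm (A (f x))" by (rule cinner_Cauchy_Schwarz)
    also have "\<dots> \<le> norm x * (norm (f x) * K)" by (intro mult_left_mono K) auto
    finally have "norm (f x) * norm (f x) \<le> norm (f x) * (K * norm x)"
      by (simp add: power2_eq_square mult_ac)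
    then show ?thesis using False by simp
  qed (use K in simp)
  have "bounded_clinear f"
  proof (rule bounded_clinearI[where K=K])
    show "f (x + y) = f x + f y" for x y
      by (rule cinner_ext) (simp add: cinner_add_left f[symmetric])
    show "f (c *\<^sub>C x) = c *\<^sub>C f x" for c x
      by (rule cinner_ext) (simp add: cinner_scaleC_left f[symmetric])
  qed (rule bd)
  then show ?thesis using f by blast
qed

section \<open>The identity representation on \<open>\<ell>\<^sup>2\<close>\<close>

lemma cinner_eq_swap: "cinner x y = cinner u v \<Longrightarrow> cinner y x = cinner v u"
  by (metis cinner_commute)

lemma Bessel_inequality:
  fixes e :: "'i \<Rightarrow> 'h::complex_hilbert"
  assumes orth: "\<And>i j. i \<noteq> j \<Longrightarrow> cinner (e i) (e j) = 0"
    and nrm: "\<And>i. e i = 0 \<or> norm (e i) = 1" and F: "finite F"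
  shows "(\<Sum>i\<in>F. (cmod (cinner (e i) x))\<^sup>2) \<le> (norm x)\<^sup>2"
proof -
  define c where "c i = cinner (e i) x" for i
  define s where "s = (\<Sum>i\<in>F. c i *\<^sub>C e i)"
  define r where "r = (\<Sum>i\<in>F. (cmod (c i))\<^sup>2)"
  have cc: "cnj z * z = of_real ((cmod z)\<^sup>2)" for z
    using complex_norm_square[of z] by (simp add: mult.commute)
  have sx: "cinner s x = of_real r"
    unfolding s_def cinner_sum_left r_def of_real_sum cinner_scaleC_left c_def[symmetric] cc ..
  have es: "cinner (e i) s = c i" if "i \<in> F" for i
  proof -
    have "cinner (e i) s = (\<Sum>j\<in>F. if i = j then c i * cinner (e i) (e i) else 0)"
      unfolding s_def cinner_sum_right by (rule sum.cong) (auto simp: cinner_scaleC_right orth)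
    also have "\<dots> = c i * cinner (e i) (e i)" using that F by simp
    also have "\<dots> = c i" using nrm[of i] by (auto simp: cinner_self c_def)
    finally show ?thesis .
  qed
  have "cinner s s = (\<Sum>i\<in>F. cnj (c i) * cinner (e i) s)"
    by (subst (1) s_def) (simp add: cinner_sum_left cinner_scaleC_left)
  also have "\<dots> = of_real r"
    unfolding r_def of_real_sum by (rule sum.cong) (simp_all only: es cc)
  finally have ss: "cinner s s = of_real r" .
  have xs: "Re (cinner x s) = r" using sx by (subst cinner_commute) simp
  have "0 \<le> (norm (x - s))\<^sup>2" by simp
  also have "\<dots> = (norm x)\<^sup>2 - r"
    unfolding norm_eq_cinner by (simp add: cinner_diff_left cinner_diff_right ss sx xs)
  finally show ?thesis by (simp add: r_def c_def)
qed

text \<open>\<open>V\<close> collects the Fourier coefficients. Instead of summing Parseval's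
  identity, the adjoint \<open>W\<close> of \<open>V\<close> is used: W (V x) and x have the same
  Fourier coefficients, so completeness of the family makes them equal.\<close>

lemma isometry_of_orthonormal:
  fixes e :: "'i \<Rightarrow> 'h::complex_hilbert"
  assumes orth: "\<And>i j. i \<noteq> j \<Longrightarrow> cinner (e i) (e j) = 0"
    and nrm: "\<And>i. e i = 0 \<or> norm (e i) = 1"
    and compl: "\<And>x. (\<And>i. cinner (e i) x = 0) \<Longrightarrow> x = 0"
  shows "\<exists>V :: 'h \<Rightarrow> 'i ell2. bounded_clinear V \<and> (\<forall>x y. cinner (V x) (V y) = cinner x y)"
proof -
  define V where "V x = Abs_ell2 (\<lambda>i. cinner (e i) x)" for x
  have cV: "coord (V x) i = cinner (e i) x" for x i
  proof -
    have "(\<lambda>i. (cmod (cinner (e i) x))\<^sup>2) summable_on UNIV"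
      unfolding square_summable_iff using Bessel_inequality[of e, OF orth nrm] by blast
    then show ?thesis by (simp add: V_def Abs_ell2_inverse)
  qed
  have V: "bounded_clinear V"
  proof (rule bounded_clinearI)
    show "norm (V x) \<le> 1 * norm x" for x
      by (rule norm_ell2_bound) (auto simp: cV intro: Bessel_inequality[of e, OF orth nrm])
  qed (auto intro!: ell2_eqI simp: cV coord_simps cinner_add_right cinner_scaleC_right)
  obtain W where W: "\<And>x y. cinner x (V y) = cinner (W x) y"
    using adjoint_exists[OF V] by blast
  have Ve: "cinner (V (e i)) (V x) = cinner (e i) x" for i x
  proof (cases "e i = 0")
    case True
    then have "V (e i) = 0" by (intro ell2_eqI) (simp add: cV coord_simps)
    then show ?thesis using True by simp
  next
    case False
    then have "V (e i) = ket i"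
      using nrm[of i] orth by (intro ell2_eqI) (auto simp: cV ket.rep_eq cinner_self)
    then show ?thesis by (simp add: cinner_ket cV)
  qed
  have WV: "W (V x) = x" for x
  proof -
    have "cinner (e i) (x - W (V x)) = 0" for i
      using cinner_eq_swap[OF W[of "V x" "e i"]] Ve[of i x] by (simp add: cinner_diff_right)
    then show ?thesis using compl[of "x - W (V x)"] by simp
  qed
  have "cinner (V x) (V y) = cinner x y" for x y by (simp add: W WV)
  then show ?thesis using V by blast
qed

text \<open>Zorn's lemma; a nonzero vector orthogonal to a maximal orthonormal set could be
  normalised and adjoined.\<close>

lemma maximal_orthonormal_set:
  "\<exists>M :: 'h::complex_hilbert set. (\<forall>m\<in>M. norm m = 1) \<and> (\<forall>m\<in>M. \<forall>m'\<in>M. m \<noteq> m' \<longrightarrow> cinner m m' = 0)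
    \<and> (\<forall>x. (\<forall>m\<in>M. cinner m x = 0) \<longrightarrow> x = 0)"
proof -
  define \<O> where "\<O> = {M :: 'h set. (\<forall>m\<in>M. norm m = 1) \<and> (\<forall>m\<in>M. \<forall>m'\<in>M. m \<noteq> m' \<longrightarrow> cinner m m' = 0)}"
  have "\<exists>M\<in>\<O>. \<forall>X\<in>\<O>. M \<subseteq> X \<longrightarrow> X = M"
  proof (rule subset_Zorn')
    fix C assume C: "subset.chain \<O> C"
    then have CO: "C \<subseteq> \<O>" and lin: "\<And>X Y. X \<in> C \<Longrightarrow> Y \<in> C \<Longrightarrow> X \<subseteq> Y \<or> Y \<subseteq> X"
      by (auto simp: subset_chain_def)
    have "norm m = 1" if "m \<in> \<Union>C" for m
      using that CO by (auto simp: \<O>_def)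
    moreover have "cinner m m' = 0" if m: "m \<in> \<Union>C" "m' \<in> \<Union>C" "m \<noteq> m'" for m m'
    proof -
      obtain X Y where XY: "X \<in> C" "m \<in> X" "Y \<in> C" "m' \<in> Y" using m by blast
      then obtain Z where "Z \<in> C" "m \<in> Z" "m' \<in> Z" using lin[of X Y] by blast
      then show ?thesis using CO m(3) by (auto simp: \<O>_def)
    qed
    ultimately show "\<Union>C \<in> \<O>" by (auto simp: \<O>_def)
  qed
  then obtain M where M: "M \<in> \<O>" and max: "\<And>X. X \<in> \<O> \<Longrightarrow> M \<subseteq> X \<Longrightarrow> X = M" by blast
  have "x = 0" if x: "\<forall>m\<in>M. cinner m x = 0" for x
  proof (rule ccontr)
    assume x0: "x \<noteq> 0"
    define u where "u = (1 / norm x) *\<^sub>R x"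
    have nu: "norm u = 1" using x0 by (simp add: u_def)
    have mu: "cinner m u = 0" "cinner u m = 0" if "m \<in> M" for m
    proof -
      show "cinner m u = 0" using x that by (simp add: u_def cinner_scaleR_right)
      then show "cinner u m = 0" by (subst cinner_commute) simp
    qed
    have "insert u M \<in> \<O>" using M nu mu by (auto simp: \<O>_def)
    then have "u \<in> M" using max[of "insert u M"] by blast
    then have "cinner u u = 0" using mu by blast
    then show False using nu by (simp add: cinner_self)
  qed
  then show ?thesis using M by (auto simp: \<O>_def)
qed

text \<open>A maximal orthonormal set \<open>M\<close> is indexed by \<open>'h bop\<close> via the rank one projections.\<close>

lemma isometry_exists:
  "\<exists>V :: 'h::complex_hilbert \<Rightarrow> 'h bop ell2. bounded_clinear V \<and> (\<forall>x y. cinner (V x) (V y) = cinner x y)"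
proof -
  obtain M :: "'h set" where M: "\<And>m. m \<in> M \<Longrightarrow> norm m = 1"
      "\<And>m m'. m \<in> M \<Longrightarrow> m' \<in> M \<Longrightarrow> m \<noteq> m' \<Longrightarrow> cinner m m' = 0"
      "\<And>x. (\<And>m. m \<in> M \<Longrightarrow> cinner m x = 0) \<Longrightarrow> x = 0"
    using maximal_orthonormal_set by metis
  have "\<exists>P. \<forall>x. P \<bullet>\<^sub>o x = cinner m x *\<^sub>C m" for m :: 'h
  proof (rule bop_exists)
    have "bounded_clinear (\<lambda>x. cinner m x *\<^sub>C m)"
    proof (rule bounded_clinearI)
      fix x
      show "norm (cinner m x *\<^sub>C m) \<le> (norm m * norm m) * norm x"
        using mult_right_mono[OF cinner_Cauchy_Schwarz[of m x], of "norm m"]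
        by (simp add: norm_scaleC_hilbert mult_ac)
    qed (simp_all add: cinner_add_right scaleC_add_left cinner_scaleC_right)
    then show "bounded_linear (\<lambda>x. cinner m x *\<^sub>C m)" by (rule bounded_clinearD)
  qed (simp add: cinner_scaleC_right)
  then obtain P :: "'h \<Rightarrow> 'h bop" where P: "\<And>m x. P m \<bullet>\<^sub>o x = cinner m x *\<^sub>C m" by metis
  \<comment> \<open>Distinct members of \<open>M\<close> are orthogonal, so applying equal rank one
    projections to \<open>m\<close> would give \<open>m = 0\<close>.\<close>
  have inj: "inj_on P M"
  proof (rule inj_onI, rule ccontr)
    fix m m' assume m: "m \<in> M" "m' \<in> M" "P m = P m'" "m \<noteq> m'"
    have "P m \<bullet>\<^sub>o m = P m' \<bullet>\<^sub>o m" using m by simp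
    then have "m = 0" using M(1)[OF m(1)] M(2)[OF m(2,1)] m(4) by (simp add: P cinner_self)
    then show False using M(1)[OF m(1)] by simp
  qed
  \<comment> \<open>Every index in \<open>'h bop\<close> needs a vector; those outside the image of
    \<open>M\<close> get 0, which is harmless for \<open>isometry_of_orthonormal\<close>.\<close>
  define e where "e i = (if i \<in> P ` M then inv_into M P i else 0)" for i
  have eM: "e i = 0 \<or> e i \<in> M" for i by (auto simp: e_def inv_into_into)
  have eP: "e (P m) = m" if "m \<in> M" for m using that inj by (simp add: e_def)
  show ?thesis
  proof (rule isometry_of_orthonormal[where e=e])
    fix i j :: "'h bop" assume "i \<noteq> j"
    show "cinner (e i) (e j) = 0"
    proof (cases "i \<in> P ` M \<and> j \<in> P ` M")
      case True
      then have "e i \<noteq> e j" using \<open>i \<noteq> j\<close> by (auto simp: eP)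
      moreover have "e i \<in> M" "e j \<in> M" using True by (auto simp: eP)
      ultimately show ?thesis using M(2) by blast
    qed (auto simp: e_def)
  next
    show "e i = 0 \<or> norm (e i) = 1" for i using eM[of i] M(1) by blast
  next
    fix x assume "\<And>i. cinner (e i) x = 0"
    then show "x = 0" using M(3) eP by metis
  qed
qed

text \<open>The target is the space on which \<open>rep_pair\<close> lets representations of
  \<open>'h bop\<close> act, so that a copy of the identity representation of \<open>B(H)\<close>
  occurs among them.\<close>

definition embed :: "'h::complex_hilbert \<Rightarrow> 'h bop ell2" where
  "embed = (SOME V. bounded_clinear V \<and> (\<forall>x y. cinner (V x) (V y) = cinner x y))"

lemma bounded_clinear_embed: "bounded_clinear embed"
  and cinner_embed: "cinner (embed x) (embed y) = cinner x y"
  using someI_ex[OF isometry_exists] unfolding embed_def by auto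

definition embed_adj :: "'h bop ell2 \<Rightarrow> 'h::complex_hilbert" where
  "embed_adj = (SOME B. bounded_clinear B \<and> (\<forall>x y. cinner x (embed y) = cinner (B x) y))"

lemma bounded_clinear_embed_adj: "bounded_clinear embed_adj"
  and cinner_embed_adj: "cinner x (embed y) = cinner (embed_adj x) y"
  using someI_ex[OF adjoint_exists[OF bounded_clinear_embed]] unfolding embed_adj_def by auto

lemma embed_adj_embed: "embed_adj (embed x) = x"
  by (rule cinner_ext) (simp add: cinner_embed_adj[symmetric] cinner_embed)

text \<open>Conjugation by the isometry \<open>embed\<close>. It is multiplicative because
  \<open>embed_adj\<close> is a left inverse of \<open>embed\<close>; the unit goes to the range
  projection of \<open>embed\<close>, so the possibility of degenerate representations is used
  here.\<close>

definition id_rep :: "'h::complex_hilbert bop \<Rightarrow> 'h bop ell2 bop" where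
  "id_rep S = (SOME U. \<forall>w. U \<bullet>\<^sub>o w = embed (S \<bullet>\<^sub>o embed_adj w))"

lemma id_rep_apply: "id_rep S \<bullet>\<^sub>o w = embed (S \<bullet>\<^sub>o embed_adj w)"
proof -
  have "bounded_clinear (\<lambda>w. embed (S \<bullet>\<^sub>o embed_adj w))"
    by (intro bounded_clinear_compose[OF bounded_clinear_embed] bounded_clinear_embed_adj
        bounded_clinear_compose[OF bounded_clinear_bop])
  then have "\<exists>U. \<forall>w. U \<bullet>\<^sub>o w = embed (S \<bullet>\<^sub>o embed_adj w)"
    by (intro bop_exists) (auto simp: bounded_clinear_def)
  from someI_ex[OF this] show ?thesis unfolding id_rep_def by blast
qed

lemma id_rep_embed: "id_rep S \<bullet>\<^sub>o embed x = embed (S \<bullet>\<^sub>o x)"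
  by (simp add: id_rep_apply embed_adj_embed)

lemma star_hom_id_rep: "star_hom id_rep"
proof -
  have "id_rep (star S) = star (id_rep S)" for S :: "'a bop"
  proof (rule star_bop_eqI[symmetric])
    fix x y :: "'a bop ell2"
    have "cinner (id_rep (star S) \<bullet>\<^sub>o x) y = cinner (star S \<bullet>\<^sub>o embed_adj x) (embed_adj y)"
      unfolding id_rep_apply by (rule cinner_eq_swap) (rule cinner_embed_adj)
    then show "cinner (id_rep (star S) \<bullet>\<^sub>o x) y = cinner x (id_rep S \<bullet>\<^sub>o y)"
      by (simp add: id_rep_apply cinner_embed_adj cinner_star_left)
  qed
  then show ?thesis
    unfolding star_hom_def clinear_def
    by (auto intro!: bop_eqI simp: id_rep_apply bop_apply_plus bop_apply_scaleC_left bop_apply_times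
        embed_adj_embed bounded_clinearD[OF bounded_clinear_embed])
qed

section \<open>Slices of the minimal tensor product\<close>

lemma cinner_ell2_tensor:
  "cinner (ell2_tensor f g) (ell2_tensor f' g') = cinner f f' * cinner g g'"
proof -
  let ?h = "\<lambda>p. cnj (coord (ell2_tensor f g) p) * coord (ell2_tensor f' g') p"
  have "?h summable_on UNIV \<times> UNIV"
    using cinner_summable[OF coord_summable coord_summable, of "ell2_tensor f g" "ell2_tensor f' g'"] by simp
  from infsum_Sigma_banach[OF this]
  have "cinner (ell2_tensor f g) (ell2_tensor f' g') = (\<Sum>\<^sub>\<infinity>x. \<Sum>\<^sub>\<infinity>y. ?h (x, y))"
    unfolding cinner_ell2.rep_eq by simp
  also have "\<dots> = (\<Sum>\<^sub>\<infinity>x. \<Sum>\<^sub>\<infinity>y. (cnj (coord f x) * coord f' x) * (cnj (coord g y) * coord g' y))"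
    by (simp add: coord_ell2_tensor mult_ac)
  also have "\<dots> = cinner f f' * cinner g g'"
    unfolding cinner_ell2.rep_eq infsum_cmult_right' infsum_cmult_left' ..
  finally show ?thesis .
qed

lemma norm_ell2_tensor: "norm (ell2_tensor f g) = norm f * norm g"
proof -
  have "complex_of_real ((norm (ell2_tensor f g))\<^sup>2) = complex_of_real ((norm f * norm g)\<^sup>2)"
    unfolding cinner_self[symmetric] cinner_ell2_tensor by (simp add: cinner_self power_mult_distrib)
  then have "(norm (ell2_tensor f g))\<^sup>2 = (norm f * norm g)\<^sup>2"
    using of_real_eq_iff by blast
  then show ?thesis by (simp add: power2_eq_iff_nonneg)
qed

lemma bounded_clinear_ell2_tensor:
  "bounded_clinear (ell2_tensor f)" "bounded_clinear (\<lambda>f. ell2_tensor f g)"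
  by (rule bounded_clinearI[where K="norm f"]; simp add: ell2_tensor_add_right ell2_tensor_scaleC_right norm_ell2_tensor)
     (rule bounded_clinearI[where K="norm g"]; simp add: ell2_tensor_add_left ell2_tensor_scaleC_left norm_ell2_tensor)

text \<open>For bounded complex linear \<open>A\<close> and \<open>B\<close> this is the adjoint of
  \<open>A\<close> composed with \<open>U\<close> and \<open>B\<close>. Two different maps are
  allowed because separating points requires off-diagonal slices.\<close>

definition compress :: "('h \<Rightarrow> 'l) \<Rightarrow> ('h \<Rightarrow> 'l) \<Rightarrow> 'l::complex_hilbert bop \<Rightarrow> 'h::complex_hilbert bop" where
  "compress A B U = (SOME L. \<forall>x y. cinner x (L \<bullet>\<^sub>o y) = cinner (A x) (U \<bullet>\<^sub>o B y))"

lemma cinner_compress: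
  assumes A: "bounded_clinear A" and B: "bounded_clinear B"
  shows "cinner x (compress A B U \<bullet>\<^sub>o y) = cinner (A x) (U \<bullet>\<^sub>o B y)"
proof -
  obtain A' where A': "bounded_clinear A'" "\<And>x y. cinner x (A y) = cinner (A' x) y"
    using adjoint_exists[OF A] by blast
  have "bounded_clinear (\<lambda>y. A' (U \<bullet>\<^sub>o B y))"
    by (intro bounded_clinear_compose[OF A'(1)] bounded_clinear_compose[OF bounded_clinear_bop] B)
  then obtain L where "\<forall>y. L \<bullet>\<^sub>o y = A' (U \<bullet>\<^sub>o B y)"
    using bop_exists[of "\<lambda>y. A' (U \<bullet>\<^sub>o B y)"] by (auto simp: bounded_clinear_def)
  then have "\<forall>x y. cinner x (L \<bullet>\<^sub>o y) = cinner (A x) (U \<bullet>\<^sub>o B y)"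
    by (simp add: cinner_eq_swap[OF A'(2)[symmetric]])
  then show ?thesis
    unfolding compress_def using someI_ex[of "\<lambda>L. \<forall>x y. cinner x (L \<bullet>\<^sub>o y) = cinner (A x) (U \<bullet>\<^sub>o B y)"] by blast
qed

lemma cinner_ext_right:
  fixes x y :: "'a::complex_hilbert"
  assumes "\<And>z. cinner z x = cinner z y"
  shows "x = y"
  by (rule cinner_ext, rule cinner_eq_swap, rule assms)

lemma bop_eqI_cinner: "(\<And>x y. cinner x (S \<bullet>\<^sub>o y) = cinner x (T \<bullet>\<^sub>o y)) \<Longrightarrow> S = T"
  by (intro bop_eqI cinner_ext_right)

lemma bounded_clinear_compress:
  assumes A: "bounded_clinear A" and B: "bounded_clinear B"
  shows "bounded_clinear (compress A B)"
proof -
  obtain K where K: "\<And>x. norm (A x) \<le> norm x * K" "K \<ge> 0"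
    using bounded_linear.nonneg_bounded[OF bounded_clinearD(3)[OF A]] by metis
  obtain L where L: "\<And>x. norm (B x) \<le> norm x * L" "L \<ge> 0"
    using bounded_linear.nonneg_bounded[OF bounded_clinearD(3)[OF B]] by metis
  show ?thesis
  proof (rule bounded_clinearI)
    fix U
    show "norm (compress A B U) \<le> (K * L) * norm U"
    proof (rule norm_bop_bound)
      fix y
      let ?z = "compress A B U \<bullet>\<^sub>o y"
      show "norm ?z \<le> K * L * norm U * norm y"
      proof (cases "?z = 0")
        case False
        have "(norm ?z)\<^sup>2 = cmod (cinner (A ?z) (U \<bullet>\<^sub>o B y))"
          unfolding cinner_compress[OF A B, symmetric] by (simp add: cinner_self norm_power)
        also have "\<dots> \<le> norm (A ?z) * norm (U \<bullet>\<^sub>o B y)" by (rule cinner_Cauchy_Schwarz)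
        also have "\<dots> \<le> (norm ?z * K) * (norm U * (norm y * L))"
          using K L by (intro mult_mono K order_trans[OF norm_bop_apply] mult_left_mono L) auto
        finally have "norm ?z * norm ?z \<le> norm ?z * (K * L * norm U * norm y)"
          by (simp add: power2_eq_square mult_ac)
        then show ?thesis using False by simp
      qed (use K L in simp)
    qed (use K L in simp)
  qed (auto intro!: bop_eqI_cinner simp: cinner_compress[OF A B] bop_apply_plus cinner_add_right
      bop_apply_scaleC_left cinner_scaleC_right)
qed

text \<open>The vectors x + y and x + i y control the sum and the difference of <x, D y> and <y, D
  x>; complex scalars are essential.\<close>

lemma bop_polarization:
  assumes "\<And>x. cinner x (D \<bullet>\<^sub>o x) = 0"
  shows "D = 0"
proof (rule bop_eqI_cinner)
  fix x y
  have 1: "cinner x (D \<bullet>\<^sub>o y) + cinner y (D \<bullet>\<^sub>o x) = 0"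
    using assms[of "x + y"] by (simp add: bop_apply_add cinner_add_left cinner_add_right assms add.commute)
  have "\<i> * cinner x (D \<bullet>\<^sub>o y) - \<i> * cinner y (D \<bullet>\<^sub>o x) = 0"
    using assms[of "x + \<i> *\<^sub>C y"]
    by (simp add: bop_apply_add bop_apply_scaleC cinner_add_left cinner_add_right cinner_scaleC_left cinner_scaleC_right assms)
  then have "cinner x (D \<bullet>\<^sub>o y) = cinner y (D \<bullet>\<^sub>o x)" by simp
  with 1 show "cinner x (D \<bullet>\<^sub>o y) = cinner x (0 \<bullet>\<^sub>o y)" by simp
qed

text \<open>Elements of the tensor product are families indexed by pairs of representations, so the
  component at the pair of \<pi> and \<rho> is the value of the product representation of \<pi> and
  \<rho>.\<close>

definition ev :: "('a, 'b) rep_pair \<Rightarrow> ('a::cstar_algebra, 'b::cstar_algebra) min_tensor \<Rightarrow> ('a \<times> 'b) ell2 bop" where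
  "ev p T = apply_bcontfun (family T) p"

lemma star_hom_ev: "star_hom (ev p)"
  unfolding star_hom_def clinear_def ev_def
  by (simp add: plus_min_tensor.rep_eq scaleC_min_tensor.rep_eq times_min_tensor.rep_eq star_min_tensor.rep_eq
      family_scaleC.rep_eq family_mult.rep_eq family_star.rep_eq)

lemma bounded_clinear_ev: "bounded_clinear (ev p)"
proof (rule bounded_clinearI[where K=1])
  show "norm (ev p T) \<le> 1 * norm T" for T
    by (simp add: ev_def norm_min_tensor.rep_eq norm_bounded)
qed (use star_hom_ev[of p] in \<open>auto simp: star_hom_def clinear_def\<close>)

lemma ev_tensor:
  "star_hom \<pi> \<Longrightarrow> star_hom \<rho> \<Longrightarrow> ev (Abs_rep_pair (\<pi>, \<rho>)) (a \<otimes>\<^sub>m b) = bop_tensor (\<pi> a) (\<rho> b)"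
  by (simp add: ev_def tensor.rep_eq elementary.rep_eq Abs_rep_pair_inverse)

lemma min_tensor_eqI:
  assumes "\<And>\<pi> \<rho>. star_hom \<pi> \<Longrightarrow> star_hom \<rho> \<Longrightarrow> ev (Abs_rep_pair (\<pi>, \<rho>)) S = ev (Abs_rep_pair (\<pi>, \<rho>)) T"
  shows "S = T"
proof -
  have "apply_bcontfun (family S) p = apply_bcontfun (family T) p" for p
    using assms[OF star_hom_reps[of p]] by (simp add: ev_def reps_inverse)
  then have "family S = family T" by (rule bcontfun_eqI)
  then show ?thesis by (simp add: family_inject)
qed

text \<open>Elementary tensors span a dense subspace, and the difference of the two maps is
  continuous.\<close>

lemma tensor_bounded_linear_eq:
  fixes f g :: "('a::cstar_algebra, 'b::cstar_algebra) min_tensor \<Rightarrow> 'c::real_normed_vector"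
  assumes f: "bounded_linear f" and g: "bounded_linear g" and eq: "\<And>a b. f (a \<otimes>\<^sub>m b) = g (a \<otimes>\<^sub>m b)"
  shows "f T = g T"
proof -
  define h where "h T = f T - g T" for T
  have h: "bounded_linear h" unfolding h_def by (intro bounded_linear_sub f g)
  interpret h: bounded_linear h by (rule h)
  let ?E = "span (range (\<lambda>(a, b). elementary a b)) :: ('a, 'b) rep_family set"
  \<comment> \<open>Span and closure live in the type of families, so vanishing of \<open>h\<close>
    is expressed through preimages under the isometry \<open>family\<close>.\<close>
  have E: "\<exists>t. family t = F \<and> h t = 0" if "F \<in> ?E" for F
    using that
  proof (rule span_induct)
    show "subspace {F. \<exists>t. family t = F \<and> h t = 0}"
      unfolding subspace_def mem_Collect_eq
    proof (intro conjI allI impI ballI)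
      show "\<exists>t. family t = 0 \<and> h t = 0"
        by (rule exI[of _ 0]) (simp add: zero_min_tensor.rep_eq)
    next
      fix x y :: "('a, 'b) rep_family" assume "x \<in> {F. \<exists>t. family t = F \<and> h t = 0}" "y \<in> {F. \<exists>t. family t = F \<and> h t = 0}"
      then obtain s t where "family s = x" "h s = 0" "family t = y" "h t = 0" by blast
      then show "\<exists>t. family t = x + y \<and> h t = 0"
        by (intro exI[of _ "s + t"]) (simp add: plus_min_tensor.rep_eq h.add)
    next
      fix c :: real and x :: "('a, 'b) rep_family" assume "x \<in> {F. \<exists>t. family t = F \<and> h t = 0}"
      then obtain t where "family t = x" "h t = 0" by blast
      then show "\<exists>t. family t = c *\<^sub>R x \<and> h t = 0"
        by (intro exI[of _ "c *\<^sub>R t"]) (simp add: scaleR_min_tensor.rep_eq h.scaleR)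
    qed
  next
    fix F :: "('a, 'b) rep_family" assume "F \<in> range (\<lambda>(a, b). elementary a b)"
    then obtain a b where "F = elementary a b" by auto
    then show "\<exists>t. family t = F \<and> h t = 0"
      by (intro exI[of _ "a \<otimes>\<^sub>m b"]) (simp add: tensor.rep_eq h_def eq)
  qed
  have "family T \<in> closure ?E" using family[of T] by (simp add: elementary_hull_def)
  then obtain u where u: "\<And>n. u n \<in> ?E" "u \<longlonglongrightarrow> family T"
    unfolding closure_sequential by blast
  have "\<forall>n. \<exists>t. family t = u n \<and> h t = 0" using E[OF u(1)] by blast
  then obtain t where "\<forall>n. family (t n) = u n \<and> h (t n) = 0" by (rule choice[THEN exE])
  then have t: "family (t n) = u n" "h (t n) = 0" for n by auto
  have "dist (t n) T = dist (u n) (family T)" for n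
    by (simp add: dist_min_tensor_def norm_min_tensor.rep_eq minus_min_tensor.rep_eq t dist_norm)
  then have "t \<longlonglongrightarrow> T" using u(2) by (simp add: tendsto_iff)
  then have "(\<lambda>n. h (t n)) \<longlonglongrightarrow> h T" by (rule h.tendsto)
  then have "h T = 0" by (simp add: t(2) LIMSEQ_const_iff)
  then show ?thesis by (simp add: h_def)
qed

section \<open>Slice maps and their compatibility with representations\<close>

lemma bounded_linear_cinner_bop: "bounded_linear (\<lambda>U. cinner x (U \<bullet>\<^sub>o y))"
proof (rule bounded_linear_intro[where K="norm x * norm y"])
  fix U
  have "cmod (cinner x (U \<bullet>\<^sub>o y)) \<le> norm x * norm (U \<bullet>\<^sub>o y)" by (rule cinner_Cauchy_Schwarz)
  also have "\<dots> \<le> norm x * (norm U * norm y)" by (intro mult_left_mono norm_bop_apply) auto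
  finally show "norm (cinner x (U \<bullet>\<^sub>o y)) \<le> norm U * (norm x * norm y)" by (simp only: mult_ac)
qed (simp_all add: bop_apply_plus bop_apply_scaleR_left cinner_add_right cinner_scaleR_right)

lemma bounded_linear_star_hom:
  fixes f :: "'a::cstar_algebra \<Rightarrow> 'h::complex_hilbert bop"
  assumes "star_hom f" shows "bounded_linear f"
  using assms star_hom_contractive[OF assms] clinear_imp_linear[of f]
  by (intro bounded_linear_intro[where K=1]) (auto simp: star_hom_def linear_add linear_scale)

lemma clinear_star_hom: "star_hom f \<Longrightarrow> f (c *\<^sub>C x) = c *\<^sub>C f x"
  by (simp add: star_hom_def clinear_def)

lemmas bounded_clinear_slice_maps =
  bounded_clinear_compose[OF bounded_clinear_ell2_tensor(1) bounded_clinear_embed]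
  bounded_clinear_compose[OF bounded_clinear_ell2_tensor(2) bounded_clinear_embed]

text \<open>Slicing the first factor by w and w' leaves an operator in \<open>B(K)\<close>, computed
  with the identity representation, to which any \<rho> can be applied afterwards. On an elementary
  tensor of a and b both sides are <w, \<pi>(a) w'> <u, \<rho>(b) u'>; density does the
  rest.\<close>

lemma slice_right:
  fixes T :: "('a::cstar_algebra, 'k::complex_hilbert bop) min_tensor"
  assumes \<pi>: "star_hom \<pi>" and \<rho>: "star_hom \<rho>"
  shows "cinner (ell2_tensor w u) (ev (Abs_rep_pair (\<pi>, \<rho>)) T \<bullet>\<^sub>o ell2_tensor w' u')
    = cinner u (\<rho> (compress (\<lambda>y. ell2_tensor w (embed y)) (\<lambda>y. ell2_tensor w' (embed y))
        (ev (Abs_rep_pair (\<pi>, id_rep)) T)) \<bullet>\<^sub>o u')"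
    (is "?f T = ?g T")
proof (rule tensor_bounded_linear_eq)
  show "bounded_linear ?f"
    by (rule bounded_linear_compose[OF bounded_linear_cinner_bop bounded_clinearD(3)[OF bounded_clinear_ev]])
  show "bounded_linear ?g"
    by (rule bounded_linear_compose[OF bounded_linear_cinner_bop],
        rule bounded_linear_compose[OF bounded_linear_star_hom[OF \<rho>]],
        rule bounded_linear_compose[OF bounded_clinearD(3)[OF bounded_clinear_compress]],
        (rule bounded_clinear_slice_maps)+, rule bounded_clinearD(3)[OF bounded_clinear_ev])
  fix a :: 'a and b :: "'k bop"
  have "compress (\<lambda>y. ell2_tensor w (embed y)) (\<lambda>y. ell2_tensor w' (embed y)) (bop_tensor (\<pi> a) (id_rep b))
      = cinner w (\<pi> a \<bullet>\<^sub>o w') *\<^sub>C b"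
    by (rule bop_eqI_cinner)
      (simp add: cinner_compress[OF bounded_clinear_slice_maps(1) bounded_clinear_slice_maps(1)]
        bop_tensor_apply cinner_ell2_tensor id_rep_embed cinner_embed bop_apply_scaleC_left cinner_scaleC_right)
  then show "?f (a \<otimes>\<^sub>m b) = ?g (a \<otimes>\<^sub>m b)"
    by (simp add: ev_tensor[OF \<pi> \<rho>] ev_tensor[OF \<pi> star_hom_id_rep] bop_tensor_apply cinner_ell2_tensor
        clinear_star_hom[OF \<rho>] bop_apply_scaleC_left cinner_scaleC_right)
qed

lemma slice_left:
  fixes T :: "('h::complex_hilbert bop, 'b::cstar_algebra) min_tensor"
  assumes \<pi>: "star_hom \<pi>" and \<rho>: "star_hom \<rho>"
  shows "cinner (ell2_tensor w u) (ev (Abs_rep_pair (\<pi>, \<rho>)) T \<bullet>\<^sub>o ell2_tensor w' u')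
    = cinner w (\<pi> (compress (\<lambda>x. ell2_tensor (embed x) u) (\<lambda>x. ell2_tensor (embed x) u')
        (ev (Abs_rep_pair (id_rep, \<rho>)) T)) \<bullet>\<^sub>o w')"
    (is "?f T = ?g T")
proof (rule tensor_bounded_linear_eq)
  show "bounded_linear ?f"
    by (rule bounded_linear_compose[OF bounded_linear_cinner_bop bounded_clinearD(3)[OF bounded_clinear_ev]])
  show "bounded_linear ?g"
    by (rule bounded_linear_compose[OF bounded_linear_cinner_bop],
        rule bounded_linear_compose[OF bounded_linear_star_hom[OF \<pi>]],
        rule bounded_linear_compose[OF bounded_clinearD(3)[OF bounded_clinear_compress]],
        (rule bounded_clinear_slice_maps)+, rule bounded_clinearD(3)[OF bounded_clinear_ev])
  fix a :: "'h bop" and b :: 'b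
  have "compress (\<lambda>x. ell2_tensor (embed x) u) (\<lambda>x. ell2_tensor (embed x) u') (bop_tensor (id_rep a) (\<rho> b))
      = cinner u (\<rho> b \<bullet>\<^sub>o u') *\<^sub>C a"
    by (rule bop_eqI_cinner)
      (simp add: cinner_compress[OF bounded_clinear_slice_maps(2) bounded_clinear_slice_maps(2)]
        bop_tensor_apply cinner_ell2_tensor id_rep_embed cinner_embed bop_apply_scaleC_left cinner_scaleC_right)
  then show "?f (a \<otimes>\<^sub>m b) = ?g (a \<otimes>\<^sub>m b)"
    by (simp add: ev_tensor[OF \<pi> \<rho>] ev_tensor[OF star_hom_id_rep \<rho>] bop_tensor_apply cinner_ell2_tensor
        clinear_star_hom[OF \<pi>] bop_apply_scaleC_left cinner_scaleC_right)
qed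

text \<open>The vector functional of \<xi> acts on the left factor and the values lie in the right
  one. Written as a compression of a representation, the slice is seen to be completely
  positive.\<close>

definition vector_slice_left ::
  "'h::complex_hilbert \<Rightarrow> ('h bop, 'k::complex_hilbert bop) min_tensor \<Rightarrow> 'k bop" where
  "vector_slice_left \<xi> T = compress (\<lambda>y. ell2_tensor (embed \<xi>) (embed y)) (\<lambda>y. ell2_tensor (embed \<xi>) (embed y))
    (ev (Abs_rep_pair (id_rep, id_rep)) T)"

definition vector_slice_right ::
  "'k::complex_hilbert \<Rightarrow> ('h::complex_hilbert bop, 'k bop) min_tensor \<Rightarrow> 'h bop" where
  "vector_slice_right \<eta> T = compress (\<lambda>x. ell2_tensor (embed x) (embed \<eta>)) (\<lambda>x. ell2_tensor (embed x) (embed \<eta>))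
    (ev (Abs_rep_pair (id_rep, id_rep)) T)"

lemma cinner_vector_slice:
  "cinner y (vector_slice_left \<xi> T \<bullet>\<^sub>o y') =
    cinner (ell2_tensor (embed \<xi>) (embed y)) (ev (Abs_rep_pair (id_rep, id_rep)) T \<bullet>\<^sub>o ell2_tensor (embed \<xi>) (embed y'))"
  "cinner x (vector_slice_right \<eta> T \<bullet>\<^sub>o x') =
    cinner (ell2_tensor (embed x) (embed \<eta>)) (ev (Abs_rep_pair (id_rep, id_rep)) T \<bullet>\<^sub>o ell2_tensor (embed x') (embed \<eta>))"
  unfolding vector_slice_left_def vector_slice_right_def
  by (simp_all add: cinner_compress bounded_clinear_slice_maps)

lemma vector_slice_tensor:
  "vector_slice_left \<xi> (S \<otimes>\<^sub>m R) = cinner \<xi> (S \<bullet>\<^sub>o \<xi>) *\<^sub>C R"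
  "vector_slice_right \<eta> (S \<otimes>\<^sub>m R) = cinner \<eta> (R \<bullet>\<^sub>o \<eta>) *\<^sub>C S"
  by (rule bop_eqI_cinner, simp add: cinner_vector_slice ev_tensor star_hom_id_rep bop_tensor_apply cinner_ell2_tensor
        id_rep_embed cinner_embed bop_apply_scaleC_left cinner_scaleC_right)+

text \<open>The norm of the minimal tensor product is a supremum over all pairs \<open>(\<pi>, \<rho>)\<close>, while the slices only see
  the identity representations. One passes from \<open>(id, id)\<close> to \<open>(id, \<rho>)\<close> and then to \<open>(\<pi>, \<rho>)\<close>: the matrix
  coefficients on one side determine an operator, to which the representation of that side can be applied.\<close>

lemma vector_slices_separate:
  fixes T :: "('h::complex_hilbert bop, 'k::complex_hilbert bop) min_tensor"
  assumes T: "\<And>\<xi>. vector_slice_left \<xi> T = 0"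
  shows "T = 0"
proof (rule min_tensor_eqI)
  fix \<pi> :: "'h bop \<Rightarrow> 'h bop ell2 bop" and \<rho> :: "'k bop \<Rightarrow> 'k bop ell2 bop"
  assume \<pi>: "star_hom \<pi>" and \<rho>: "star_hom \<rho>"
  have \<pi>0: "\<pi> 0 = 0" and \<rho>0: "\<rho> 0 = 0"
    using clinear_star_hom[OF \<pi>, of 0 0] clinear_star_hom[OF \<rho>, of 0 0] by simp_all
  \<comment> \<open>The hypothesis covers equal vectors in the first factor and arbitrary
    \<open>y\<close>, \<open>y'\<close> in the second; polarization in the first factor makes its
    vectors independent.\<close>
  have 1: "compress (\<lambda>x. ell2_tensor (embed x) (embed y)) (\<lambda>x. ell2_tensor (embed x) (embed y'))
      (ev (Abs_rep_pair (id_rep, id_rep)) T) = 0" for y y'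
    by (rule bop_polarization)
       (simp add: cinner_compress bounded_clinear_slice_maps cinner_vector_slice(1)[symmetric] T)
  have 2: "compress (\<lambda>y. ell2_tensor (embed x) (embed y)) (\<lambda>y. ell2_tensor (embed x') (embed y))
      (ev (Abs_rep_pair (id_rep, id_rep)) T) = 0" for x x'
  proof (rule bop_eqI_cinner)
    fix y y'
    have "cinner x (0 \<bullet>\<^sub>o x') = cinner (ell2_tensor (embed x) (embed y))
        (ev (Abs_rep_pair (id_rep, id_rep)) T \<bullet>\<^sub>o ell2_tensor (embed x') (embed y'))"
      unfolding 1[of y y', symmetric] by (rule cinner_compress) (rule bounded_clinear_slice_maps)+
    then show "cinner y (compress (\<lambda>y. ell2_tensor (embed x) (embed y)) (\<lambda>y. ell2_tensor (embed x') (embed y))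
        (ev (Abs_rep_pair (id_rep, id_rep)) T) \<bullet>\<^sub>o y') = cinner y (0 \<bullet>\<^sub>o y')"
      by (simp add: cinner_compress bounded_clinear_slice_maps)
  qed
  \<comment> \<open>By \<open>slice_right\<close> these coefficients are \<rho> applied to the
    vanishing slices of fact 2, for all \<open>u\<close> and \<open>u'\<close> and not only for
    embedded vectors.\<close>
  have 3: "compress (\<lambda>x. ell2_tensor (embed x) u) (\<lambda>x. ell2_tensor (embed x) u')
      (ev (Abs_rep_pair (id_rep, \<rho>)) T) = 0" for u u'
    by (rule bop_eqI_cinner)
       (simp add: cinner_compress bounded_clinear_slice_maps slice_right[OF star_hom_id_rep \<rho>] 2 \<rho>0)
  have "ev (Abs_rep_pair (\<pi>, \<rho>)) T = 0"
  proof (rule bop_ket_eqI, rule ell2_eqI)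
    fix p q
    show "coord (ev (Abs_rep_pair (\<pi>, \<rho>)) T \<bullet>\<^sub>o ket p) q = coord (0 \<bullet>\<^sub>o ket p) q"
      unfolding cinner_ket[symmetric]
      by (cases p; cases q) (simp add: ket_tensor[symmetric] slice_left[OF \<pi> \<rho>] 3 \<pi>0)
  qed
  also have "\<dots> = ev (Abs_rep_pair (\<pi>, \<rho>)) 0"
    by (simp add: ev_def zero_min_tensor.rep_eq)
  finally show "ev (Abs_rep_pair (\<pi>, \<rho>)) T = ev (Abs_rep_pair (\<pi>, \<rho>)) 0" .
qed

section \<open>Completely positive maps into \<open>B(H)\<close>\<close>

lemma completely_positiveD:
  assumes "completely_positive \<phi>"
  shows "\<phi> (x + y) = \<phi> x + \<phi> y" "\<phi> (c *\<^sub>C x) = c *\<^sub>C \<phi> x" "clinear \<phi>"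
  using assms by (auto simp: completely_positive_def clinear_def)

lemma completely_positive_compose:
  "completely_positive \<psi> \<Longrightarrow> completely_positive \<phi> \<Longrightarrow> completely_positive (\<lambda>x. \<psi> (\<phi> x))"
  unfolding completely_positive_def by (auto simp: clinear_def)

lemma completely_positive_scaleR:
  "completely_positive \<phi> \<Longrightarrow> 0 \<le> r \<Longrightarrow> completely_positive (\<lambda>x. r *\<^sub>R \<phi> x)"
  unfolding completely_positive_def
  by (auto simp: clinear_def scaleR_right_distrib scaleC_scaleR_commute intro: matrix_positive_scaleR)

lemma completely_positive_zero: "completely_positive (\<lambda>_. 0)"
  unfolding completely_positive_def matrix_positive_def
  by (auto simp: clinear_def intro!: exI[of _ "\<lambda>_ _. 0"])

lemma tensor_sum_left: "(\<Sum>k\<in>K. f k) \<otimes>\<^sub>m b = (\<Sum>k\<in>K. f k \<otimes>\<^sub>m b)"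
  using tensor_scaleC_left[of 0 0 b]
  by (induction K rule: infinite_finite_induct) (simp_all add: tensor_add_left)

lemma tensor_sum_right: "a \<otimes>\<^sub>m (\<Sum>k\<in>K. f k) = (\<Sum>k\<in>K. a \<otimes>\<^sub>m f k)"
  using tensor_scaleC_right[of a 0 0]
  by (induction K rule: infinite_finite_induct) (simp_all add: tensor_add_right)

text \<open>Giving the positive factor as a square makes the factorisation explicit: tensoring a
  factor \<open>Y\<close> of the matrix with \<open>d\<close> or \<open>e\<close> yields a factor of
  the new matrix.\<close>

lemma completely_positive_tensor:
  "completely_positive (\<lambda>b. (star d * d) \<otimes>\<^sub>m b)"
  "completely_positive (\<lambda>a. a \<otimes>\<^sub>m (star e * e))"
proof -
  have "matrix_positive n (\<lambda>i j. (star d * d) \<otimes>\<^sub>m X i j)" if X: "matrix_positive n X" for n X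
  proof -
    obtain Y where "\<forall>i<n. \<forall>j<n. X i j = (\<Sum>k<n. star (Y k i) * Y k j)"
      using X by (auto simp: matrix_positive_def)
    then show ?thesis
      unfolding matrix_positive_def
      by (intro exI[of _ "\<lambda>k i. d \<otimes>\<^sub>m Y k i"]) (simp add: tensor_sum_right tensor_star tensor_mult)
  qed
  then show "completely_positive (\<lambda>b. (star d * d) \<otimes>\<^sub>m b)"
    unfolding completely_positive_def by (auto simp: clinear_def tensor_add_right tensor_scaleC_right)
  have "matrix_positive n (\<lambda>i j. X i j \<otimes>\<^sub>m (star e * e))" if X: "matrix_positive n X" for n X
  proof -
    obtain Y where "\<forall>i<n. \<forall>j<n. X i j = (\<Sum>k<n. star (Y k i) * Y k j)"
      using X by (auto simp: matrix_positive_def)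
    then show ?thesis
      unfolding matrix_positive_def
      by (intro exI[of _ "\<lambda>k i. Y k i \<otimes>\<^sub>m e"]) (simp add: tensor_sum_left tensor_star tensor_mult)
  qed
  then show "completely_positive (\<lambda>a. a \<otimes>\<^sub>m (star e * e))"
    unfolding completely_positive_def by (auto simp: clinear_def tensor_add_left tensor_scaleC_left)
qed

text \<open>The easy half of Stinespring's theorem. The natural factors \<sigma>(Y) V map between
  different spaces and so are no matrix over \<open>B(H)\<close>; they do show that the quadratic
  form is a sum of squared norms, and \<open>matrix_positive_bopI\<close> then supplies the
  factorisation.\<close>

lemma completely_positive_compress:
  fixes \<sigma> :: "'c::cstar_algebra \<Rightarrow> 'l::complex_hilbert bop" and V :: "'h::complex_hilbert \<Rightarrow> 'l"
  assumes \<sigma>: "star_hom \<sigma>" and V: "bounded_clinear V"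
  shows "completely_positive (\<lambda>c. compress V V (\<sigma> c))"
  unfolding completely_positive_def
proof (intro conjI allI impI)
  show "clinear (\<lambda>c. compress V V (\<sigma> c))"
    using \<sigma> bounded_clinearD[OF bounded_clinear_compress[OF V V]] by (simp add: clinear_def star_hom_def)
  fix n and X :: "nat \<Rightarrow> nat \<Rightarrow> 'c" assume "matrix_positive n X"
  then obtain Y where Y: "\<And>i j. i < n \<Longrightarrow> j < n \<Longrightarrow> X i j = (\<Sum>k<n. star (Y k i) * Y k j)"
    by (auto simp: matrix_positive_def)
  have \<sigma>_sum: "\<sigma> (\<Sum>k\<in>K. f k) = (\<Sum>k\<in>K. \<sigma> (f k))" for f and K :: "nat set"
    using \<sigma> by (intro linear_sum clinear_imp_linear) (simp add: star_hom_def)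
  have form: "cinner x (compress V V (\<sigma> (X i j)) \<bullet>\<^sub>o y)
      = (\<Sum>k<n. cinner (\<sigma> (Y k i) \<bullet>\<^sub>o V x) (\<sigma> (Y k j) \<bullet>\<^sub>o V y))" if "i < n" "j < n" for i j x y
    using \<sigma> by (simp add: cinner_compress[OF V V] Y[OF that] \<sigma>_sum bop_apply_sum cinner_sum_right star_hom_def
        bop_apply_times cinner_star_right)
  show "matrix_positive n (\<lambda>i j. compress V V (\<sigma> (X i j)))"
  proof (rule matrix_positive_bopI)
    fix i j assume ij: "i < n" "j < n"
    show "star (compress V V (\<sigma> (X i j))) = compress V V (\<sigma> (X j i))"
    proof (rule bop_eqI_cinner)
      fix x y
      have "cinner y (compress V V (\<sigma> (X i j)) \<bullet>\<^sub>o x) = cinner (compress V V (\<sigma> (X j i)) \<bullet>\<^sub>o y) x"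
        unfolding cinner_commute[of "compress V V (\<sigma> (X j i)) \<bullet>\<^sub>o y"] form[OF ij] form[OF ij(2,1)] cnj_sum
        by (intro sum.cong refl cinner_commute)
      then show "cinner x (star (compress V V (\<sigma> (X i j))) \<bullet>\<^sub>o y) = cinner x (compress V V (\<sigma> (X j i)) \<bullet>\<^sub>o y)"
        unfolding cinner_star_right by (rule cinner_eq_swap)
    qed
  next
    fix x :: "nat \<Rightarrow> 'h"
    have "(\<Sum>i<n. \<Sum>j<n. cinner (x i) (compress V V (\<sigma> (X i j)) \<bullet>\<^sub>o x j))
        = (\<Sum>i<n. \<Sum>j<n. \<Sum>k<n. cinner (\<sigma> (Y k i) \<bullet>\<^sub>o V (x i)) (\<sigma> (Y k j) \<bullet>\<^sub>o V (x j)))"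
      by (simp add: form)
    also have "\<dots> = (\<Sum>i<n. \<Sum>k<n. \<Sum>j<n. cinner (\<sigma> (Y k i) \<bullet>\<^sub>o V (x i)) (\<sigma> (Y k j) \<bullet>\<^sub>o V (x j)))"
      by (intro sum.cong refl sum.swap)
    also have "\<dots> = (\<Sum>k<n. \<Sum>i<n. \<Sum>j<n. cinner (\<sigma> (Y k i) \<bullet>\<^sub>o V (x i)) (\<sigma> (Y k j) \<bullet>\<^sub>o V (x j)))"
      by (rule sum.swap)
    also have "\<dots> = (\<Sum>k<n. of_real ((norm (\<Sum>i<n. \<sigma> (Y k i) \<bullet>\<^sub>o V (x i)))\<^sup>2))"
      unfolding cinner_self[symmetric] cinner_sum_left unfolding cinner_sum_right ..
    also have "\<dots> = of_real (\<Sum>k<n. (norm (\<Sum>i<n. \<sigma> (Y k i) \<bullet>\<^sub>o V (x i)))\<^sup>2)" by simp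
    finally show "0 \<le> Re (\<Sum>i<n. \<Sum>j<n. cinner (x i) (compress V V (\<sigma> (X i j)) \<bullet>\<^sub>o x j))"
      by (simp only: Re_complex_of_real) (simp add: sum_nonneg)
  qed
qed

lemma completely_positive_vector_slice:
  "completely_positive (vector_slice_left \<xi>)" "completely_positive (vector_slice_right \<eta>)"
  unfolding vector_slice_left_def vector_slice_right_def
  by (intro completely_positive_compress star_hom_ev bounded_clinear_slice_maps)+

section \<open>Values on squares, and purity up to a scalar\<close>

lemma completely_positive_cinner:
  assumes "completely_positive \<phi>"
  shows "\<exists>r\<ge>0. cinner x (\<phi> (star d * d) \<bullet>\<^sub>o x) = complex_of_real r"
proof -
  have "matrix_positive 1 (\<lambda>_ _. star d * d)"
    by (auto simp: matrix_positive_def)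
  then have "matrix_positive 1 (\<lambda>_ _. \<phi> (star d * d))"
    using assms by (auto simp: completely_positive_def)
  then obtain Y where "\<phi> (star d * d) = star Y * Y"
    by (auto simp: matrix_positive_def)
  then have "cinner x (\<phi> (star d * d) \<bullet>\<^sub>o x) = complex_of_real ((norm (Y \<bullet>\<^sub>o x))\<^sup>2)"
    by (simp add: bop_apply_times cinner_star_right cinner_self)
  then show ?thesis by (metis zero_le_power2)
qed

text \<open>Squares span a unital algebra: expanding the square of 1 + c a for c = 1 and c = i kills
  both the sum and the difference of \<open>h a\<close> and \<open>h (star a)\<close>.\<close>

lemma clinear_eq_on_squares:
  fixes f g :: "'a::cstar_algebra \<Rightarrow> 'b::complex_vector"
  assumes f: "clinear f" and g: "clinear g" and eq: "\<And>d. f (star d * d) = g (star d * d)"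
  shows "f a = g a"
proof -
  define h where "h x = f x - g x" for x
  have add: "h (x + y) = h x + h y" and sc: "h (c *\<^sub>C x) = c *\<^sub>C h x" for x y c
    using f g by (simp_all add: h_def clinear_def scaleC_diff_right)
  have sq: "h (star d * d) = 0" for d by (simp add: h_def eq)
  have "h (star (1 + c *\<^sub>C a) * (1 + c *\<^sub>C a)) = c *\<^sub>C h a + cnj c *\<^sub>C h (star a)" for c
    using sq[of 1] sq[of a]
    by (simp add: star_add star_scaleC distrib_left distrib_right add sc mult_scaleC_left mult_scaleC_right)
  then have *: "c *\<^sub>C h a + cnj c *\<^sub>C h (star a) = 0" for c
    by (simp only: sq)
  have "h a + h (star a) = 0" using *[of 1] by simp
  moreover have "(-\<i>) *\<^sub>C (\<i> *\<^sub>C h a + (-\<i>) *\<^sub>C h (star a)) = 0" using *[of \<i>] by simp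
  then have "h a - h (star a) = 0" by (simp add: scaleC_add_right scaleC_minus1)
  ultimately have "h a + h a = 0" by simp
  then have "2 *\<^sub>R h a = 0" by (simp add: scaleR_2)
  then show ?thesis by (simp add: h_def)
qed

lemma completely_positive_uminus_zero:
  assumes "completely_positive \<phi>" "completely_positive (\<lambda>x. - \<phi> x)"
  shows "\<phi> x = (0 :: 'h::complex_hilbert bop)"
proof (rule clinear_eq_on_squares[of \<phi> "\<lambda>_. 0"])
  fix d
  show "\<phi> (star d * d) = 0"
  proof (rule bop_polarization)
    fix x
    obtain r s where "r \<ge> 0" "cinner x (\<phi> (star d * d) \<bullet>\<^sub>o x) = complex_of_real r"
      and "s \<ge> 0" "cinner x ((- \<phi> (star d * d)) \<bullet>\<^sub>o x) = complex_of_real s"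
      using completely_positive_cinner[OF assms(1)] completely_positive_cinner[OF assms(2)] by metis
    moreover from this have "- complex_of_real r = complex_of_real s"
      by (simp add: bop_apply_uminus cinner_minus_right)
    then have "- r = s" by (simp only: of_real_minus[symmetric] of_real_eq_iff)
    ultimately show "cinner x (\<phi> (star d * d) \<bullet>\<^sub>o x) = 0" by simp
  qed
qed (use assms in \<open>simp_all add: completely_positive_def clinear_def\<close>)

text \<open>Purity is applied after dividing by \<open>s\<close>. For \<open>s = 0\<close> that is
  impossible, but then both \<gamma> and its negative are completely positive, which forces \<gamma>
  to vanish.\<close>

lemma pure_cp_dominated:
  assumes pure: "pure_cp \<alpha>" and \<gamma>: "completely_positive \<gamma>" and s: "0 \<le> (s::real)"
    and dom: "completely_positive (\<lambda>b. s *\<^sub>R \<alpha> b - \<gamma> b)"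
  shows "\<exists>c::real. \<forall>b. \<gamma> b = c *\<^sub>R \<alpha> b"
proof (cases "s = 0")
  case True
  then have "completely_positive (\<lambda>b. - \<gamma> b)" using dom by simp
  then have "\<gamma> b = 0 *\<^sub>R \<alpha> b" for b using completely_positive_uminus_zero[OF \<gamma>] by simp
  then show ?thesis by blast
next
  case False
  then have s: "s > 0" using s by simp
  have "completely_positive (\<lambda>b. (1/s) *\<^sub>R \<gamma> b)"
    using s by (intro completely_positive_scaleR \<gamma>) simp
  moreover have "completely_positive (\<lambda>b. (1/s) *\<^sub>R (s *\<^sub>R \<alpha> b - \<gamma> b))"
    using s by (intro completely_positive_scaleR dom) simp
  then have "dominates \<alpha> (\<lambda>b. (1/s) *\<^sub>R \<gamma> b)"
    using s by (simp add: dominates_def scaleR_diff_right)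
  ultimately obtain c where "(\<lambda>b. (1/s) *\<^sub>R \<gamma> b) = (\<lambda>b. c *\<^sub>R \<alpha> b)"
    using pure unfolding pure_cp_def by blast
  then have "s *\<^sub>R (1/s) *\<^sub>R \<gamma> b = s *\<^sub>R c *\<^sub>R \<alpha> b" for b by metis
  then have "\<gamma> b = (s * c) *\<^sub>R \<alpha> b" for b using s by simp
  then show ?thesis by blast
qed

theorem theorem2p4:
  fixes \<alpha>\<^sub>1 :: "'a::cstar_algebra \<Rightarrow> 'h::complex_hilbert bop"
    and \<alpha>\<^sub>2 :: "'b::cstar_algebra \<Rightarrow> 'k::complex_hilbert bop"
    and \<alpha> \<beta> :: "('a, 'b) min_tensor \<Rightarrow> ('h bop, 'k bop) min_tensor"
  assumes "completely_positive \<alpha>\<^sub>1" and "completely_positive \<alpha>\<^sub>2" and "pure_cp \<alpha>\<^sub>2"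
    and "is_cp_tensor \<alpha>\<^sub>1 \<alpha>\<^sub>2 \<alpha>"
    and "completely_positive \<beta>" and "dominates \<alpha> \<beta>"
  shows "\<exists>\<beta>\<^sub>1 :: 'a \<Rightarrow> 'h bop. completely_positive \<beta>\<^sub>1 \<and> dominates \<alpha>\<^sub>1 \<beta>\<^sub>1 \<and> is_cp_tensor \<beta>\<^sub>1 \<alpha>\<^sub>2 \<beta>"
proof -
  note \<beta> = assms(5)
  have \<alpha>: "\<alpha> (a \<otimes>\<^sub>m b) = \<alpha>\<^sub>1 a \<otimes>\<^sub>m \<alpha>\<^sub>2 b" for a b
    using assms(4) by (simp add: is_cp_tensor_def)
  have diff: "completely_positive (\<lambda>x. \<alpha> x - \<beta> x)"
    using assms(6) by (simp add: dominates_def)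
  have slice_diff: "vector_slice_left \<xi> (S - T) = vector_slice_left \<xi> S - vector_slice_left \<xi> T"
    "vector_slice_right \<eta> (S - T) = vector_slice_right \<eta> S - vector_slice_right \<eta> T"
    for \<xi> \<eta> and S T :: "('h bop, 'k bop) min_tensor"
    by (intro linear_diff clinear_imp_linear completely_positiveD(3) completely_positive_vector_slice)+
  have "\<exists>c::real. \<forall>b. vector_slice_left \<xi> (\<beta> ((star d * d) \<otimes>\<^sub>m b)) = c *\<^sub>R \<alpha>\<^sub>2 b" for \<xi> d
  proof -
    obtain s where s: "s \<ge> 0" "cinner \<xi> (\<alpha>\<^sub>1 (star d * d) \<bullet>\<^sub>o \<xi>) = complex_of_real s"
      using completely_positive_cinner[OF assms(1)] by blast
    have "completely_positive (\<lambda>b. vector_slice_left \<xi> (\<alpha> ((star d * d) \<otimes>\<^sub>m b) - \<beta> ((star d * d) \<otimes>\<^sub>m b)))"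
      by (intro completely_positive_compose[OF completely_positive_vector_slice(1)]
          completely_positive_compose[OF diff] completely_positive_tensor)
    then have "completely_positive (\<lambda>b. s *\<^sub>R \<alpha>\<^sub>2 b - vector_slice_left \<xi> (\<beta> ((star d * d) \<otimes>\<^sub>m b)))"
      by (simp add: slice_diff \<alpha> vector_slice_tensor s scaleR_scaleC)
    moreover have "completely_positive (\<lambda>b. vector_slice_left \<xi> (\<beta> ((star d * d) \<otimes>\<^sub>m b)))"
      by (intro completely_positive_compose[OF completely_positive_vector_slice(1)]
          completely_positive_compose[OF \<beta>] completely_positive_tensor)
    ultimately show ?thesis using pure_cp_dominated[OF assms(3)] s(1) by blast
  qed
  then obtain c :: "'h \<Rightarrow> 'a \<Rightarrow> real" where
    c: "\<And>\<xi> d b. vector_slice_left \<xi> (\<beta> ((star d * d) \<otimes>\<^sub>m b)) = c \<xi> d *\<^sub>R \<alpha>\<^sub>2 b"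
    by metis
  \<comment> \<open>The condition compares scalars only after multiplication by
    \<open>\<alpha>\<^sub>2 b\<close>, so it also serves the case
    \<open>\<alpha>\<^sub>2 = 0\<close>, where \<open>c\<close> is not determined.\<close>
  have tensorI: "is_cp_tensor \<beta>\<^sub>1 \<alpha>\<^sub>2 \<beta>"
    if lin: "clinear \<beta>\<^sub>1" and eq: "\<And>\<xi> d b. c \<xi> d *\<^sub>R \<alpha>\<^sub>2 b = cinner \<xi> (\<beta>\<^sub>1 (star d * d) \<bullet>\<^sub>o \<xi>) *\<^sub>C \<alpha>\<^sub>2 b" for \<beta>\<^sub>1
  proof -
    have "\<beta> (a \<otimes>\<^sub>m b) = \<beta>\<^sub>1 a \<otimes>\<^sub>m \<alpha>\<^sub>2 b" for a b
    proof (rule clinear_eq_on_squares[of "\<lambda>a. \<beta> (a \<otimes>\<^sub>m b)" "\<lambda>a. \<beta>\<^sub>1 a \<otimes>\<^sub>m \<alpha>\<^sub>2 b"])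
      show "clinear (\<lambda>a. \<beta> (a \<otimes>\<^sub>m b))" "clinear (\<lambda>a. \<beta>\<^sub>1 a \<otimes>\<^sub>m \<alpha>\<^sub>2 b)"
        using lin by (simp_all add: clinear_def tensor_add_left tensor_scaleC_left completely_positiveD[OF \<beta>])
      fix d
      have "\<beta> ((star d * d) \<otimes>\<^sub>m b) - \<beta>\<^sub>1 (star d * d) \<otimes>\<^sub>m \<alpha>\<^sub>2 b = 0"
        by (rule vector_slices_separate) (simp add: slice_diff vector_slice_tensor c eq)
      then show "\<beta> ((star d * d) \<otimes>\<^sub>m b) = \<beta>\<^sub>1 (star d * d) \<otimes>\<^sub>m \<alpha>\<^sub>2 b" by simp
    qed
    then show ?thesis using \<beta> by (simp add: is_cp_tensor_def)
  qed
  show ?thesis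
  \<comment> \<open>By polarization and linearity the first case means
    \<open>\<alpha>\<^sub>2 = 0\<close>; then \<beta> vanishes on elementary tensors and
    \<open>\<beta>\<^sub>1 = 0\<close> works.\<close>
  proof (cases "\<forall>e \<eta>. cinner \<eta> (\<alpha>\<^sub>2 (star e * e) \<bullet>\<^sub>o \<eta>) = 0")
    case True
    have "\<alpha>\<^sub>2 b = 0" for b
      by (rule clinear_eq_on_squares[where g="\<lambda>_. 0"])
         (use True completely_positiveD(3)[OF assms(2)] in \<open>auto intro: bop_polarization simp: clinear_def\<close>)
    then have "is_cp_tensor (\<lambda>_. 0) \<alpha>\<^sub>2 \<beta>"
      by (intro tensorI) (simp_all add: clinear_def)
    then show ?thesis
      using completely_positive_zero assms(1) by (intro exI[of _ "\<lambda>_. 0"]) (simp add: dominates_def)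
  next
    case False
    then obtain e \<eta> where "cinner \<eta> (\<alpha>\<^sub>2 (star e * e) \<bullet>\<^sub>o \<eta>) \<noteq> 0" by blast
    moreover obtain k where k0: "k \<ge> 0" "cinner \<eta> (\<alpha>\<^sub>2 (star e * e) \<bullet>\<^sub>o \<eta>) = complex_of_real k"
      using completely_positive_cinner[OF assms(2)] by blast
    ultimately have k: "k > 0" by auto
    \<comment> \<open>The factor 1/k normalises the slice so that the same construction applied to
      \<alpha> returns \<open>\<alpha>\<^sub>1\<close>.\<close>
    define \<beta>\<^sub>1 where "\<beta>\<^sub>1 a = (1/k) *\<^sub>R vector_slice_right \<eta> (\<beta> (a \<otimes>\<^sub>m (star e * e)))" for a
    have 1: "completely_positive \<beta>\<^sub>1"
      unfolding \<beta>\<^sub>1_def using k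
      by (intro completely_positive_scaleR completely_positive_compose[OF completely_positive_vector_slice(2)]
          completely_positive_compose[OF \<beta>] completely_positive_tensor) simp
    have "completely_positive (\<lambda>a. (1/k) *\<^sub>R vector_slice_right \<eta>
        (\<alpha> (a \<otimes>\<^sub>m (star e * e)) - \<beta> (a \<otimes>\<^sub>m (star e * e))))"
      using k
      by (intro completely_positive_scaleR completely_positive_compose[OF completely_positive_vector_slice(2)]
          completely_positive_compose[OF diff] completely_positive_tensor) simp
    moreover have "(1/k) *\<^sub>R vector_slice_right \<eta> (\<alpha> (a \<otimes>\<^sub>m (star e * e)) - \<beta> (a \<otimes>\<^sub>m (star e * e)))
        = \<alpha>\<^sub>1 a - \<beta>\<^sub>1 a" for a
      using k by (simp add: slice_diff \<alpha> vector_slice_tensor k0(2) scaleR_scaleC[symmetric] scaleR_diff_right \<beta>\<^sub>1_def)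
    ultimately have 2: "dominates \<alpha>\<^sub>1 \<beta>\<^sub>1" by (simp add: dominates_def)
    have "cinner \<xi> (\<beta>\<^sub>1 (star d * d) \<bullet>\<^sub>o \<xi>) = of_real (c \<xi> d)" for \<xi> d
    proof -
      \<comment> \<open>Both sides are one matrix coefficient of \<beta> at the tensor of \<xi> and
        \<eta>, read as a right slice and as a left slice.\<close>
      have "cinner \<xi> (vector_slice_right \<eta> (\<beta> ((star d * d) \<otimes>\<^sub>m (star e * e))) \<bullet>\<^sub>o \<xi>)
          = cinner \<eta> (vector_slice_left \<xi> (\<beta> ((star d * d) \<otimes>\<^sub>m (star e * e))) \<bullet>\<^sub>o \<eta>)"
        by (simp add: cinner_vector_slice)
      also have "\<dots> = of_real (c \<xi> d * k)"
        by (simp add: c bop_apply_scaleR_left cinner_scaleR_right k0(2) scaleR_conv_of_real)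
      finally show ?thesis
        using k by (simp add: \<beta>\<^sub>1_def bop_apply_scaleR_left cinner_scaleR_right scaleR_conv_of_real)
    qed
    then have "is_cp_tensor \<beta>\<^sub>1 \<alpha>\<^sub>2 \<beta>"
      using completely_positiveD(3)[OF 1] by (intro tensorI) (simp_all add: scaleR_scaleC)
    then show ?thesis using 1 2 by blast
  qed
qed

end
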